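(* Let $u$ be a finite excessive function of a right process $X$ with state space $E$ that is the potential $u(x)=\mathbb{E}_xA_\infty$ of a continuous adapted increasing additive functional $A$, and such that in the decomposition $u(X_t)=u(X_0)+M_t-A_t$ the martingale $M$ is continuous. Assume that $X$ has an excessive $\sigma$-finite reference measure $\xi$. Let $\nu_u$ be the energy measure of $u$, and let $\mu_u^a$ be the measure associated with the local time $L^a$ of $u(X)$ at $a$. Then each $\mu_u^a$ is supported on $\{u=a\}$, and the measures $\mu^a_u$ provide a disintegration of $\nu_u$ under the mapping $x\mapsto u(x)$; in particular, for every positive measurable $f$ on $\mathbb{R}$, $$\int f\circ u\,d\nu_u=\int_{\mathbb{R}}\Big(\int f\circ u\,d\mu_u^a\Big)da .$$ Moreover the image under $u$ of the restriction of $\nu_u$ to any measurable set on which $\nu_u$ is finite is absolutely continuous with respect to Lebesgue measure on $\mathbb{R}$.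
   Context: $(\Omega,X,\mathbb{P}_x)$ is a right process with canonical $\sigma$-fields $(\mathscr{F}_t)$. The martingale $M$, starting from zero, is $M_t=\mathbb{E}[A_\infty\mid\mathscr{F}_t]-\mathbb{E}[A_\infty\mid\mathscr{F}_0]$. $L^a_t$ is the local time at $a\in\mathbb{R}$ of the continuous semimartingale $Y_t=u(X_t)$, a continuous increasing additive functional satisfying $(u\wedge a)(X_t)=(u\wedge a)(X_0)+\int_0^t\mathbf 1_{\{u(X_s)<a\}}(dM_s-dA_s)-\frac12L^a_t$ and $\int_0^tg(Y_s)\,d\langle M,M\rangle_s=\int_{\mathbb{R}}g(a)L^a_t\,da$ ($\mathbb{P}_x$-a.s. for every $x$, $g$ positive Borel). With every continuous increasing additive functional $C_t$ is associated a positive $\sigma$-finite measure $\mu_C$ on $E$, not charging semipolar sets, by $\mu_C(f)=\lim_{t\downarrow0}\frac1t\mathbb{E}_\xi\int_0^tf(X_s)\,dC_s$ for $f$ positive measurable, with $\mathbb{E}_\xi=\int\mathbb{E}_x\,\xi(dx)$. The energy measure $\nu_u$ is the measure so associated with $\langle M,M\rangle_t$, and $\mu_u^a$ the measure so associated with $L^a_t$. Disintegration means $\nu_u=\int_{\mathbb{R}}\mu^a_u\,da$ with $\mu^a_u$ carried by $\{u=a\}$. *)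

theory Defs
  imports "HOL-Probability.Probability"
begin

section \<open>Processes on a filtered probability space\<close>

text \<open>
  Time runs through \<open>{0..}\<close>, as a subset of the reals; the values of a process or of a
  filtration at negative times are irrelevant.
\<close>

text \<open>The measure \<open>dc\<close> of a continuous nondecreasing path \<open>c\<close> on \<open>{0..}\<close>.\<close>

definition stieltjes :: "(real \<Rightarrow> real) \<Rightarrow> real measure" where
  "stieltjes c = interval_measure (\<lambda>s. c (max 0 s))"

definition path_integral ::
  "(real \<Rightarrow> 'w \<Rightarrow> real) \<Rightarrow> (real \<Rightarrow> 'w \<Rightarrow> real) \<Rightarrow> real \<Rightarrow> 'w \<Rightarrow> real" where
  "path_integral H C t \<omega> = (LINT s:{0..t}|stieltjes (\<lambda>r. C r \<omega>). H s \<omega>)"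

definition martingale ::
  "'w measure \<Rightarrow> (real \<Rightarrow> 'w measure) \<Rightarrow> (real \<Rightarrow> 'w \<Rightarrow> real) \<Rightarrow> bool" where
  "martingale p F N \<longleftrightarrow>
     (\<forall>t\<ge>0. N t \<in> borel_measurable (F t) \<and> integrable p (N t)) \<and>
     (\<forall>s t. 0 \<le> s \<and> s \<le> t \<longrightarrow> (AE \<omega> in p. real_cond_exp p (F s) (N t) \<omega> = N s \<omega>))"

text \<open>
  Finite stopping times suffice for localization: \<open>T n\<close> may be replaced by \<open>min (T n) n\<close>.
\<close>

definition cont_local_martingale ::
  "'w measure \<Rightarrow> (real \<Rightarrow> 'w measure) \<Rightarrow> (real \<Rightarrow> 'w \<Rightarrow> real) \<Rightarrow> bool" where
  "cont_local_martingale p F N \<longleftrightarrow>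
     (\<forall>t\<ge>0. N t \<in> borel_measurable (F t)) \<and>
     (AE \<omega> in p. continuous_on {0..} (\<lambda>t. N t \<omega>)) \<and>
     (\<exists>T :: nat \<Rightarrow> 'w \<Rightarrow> real.
        (\<forall>n. stopping_time F (T n) \<and> (\<forall>\<omega>\<in>space p. 0 \<le> T n \<omega>)) \<and>
        (AE \<omega> in p. incseq (\<lambda>n. T n \<omega>) \<and> filterlim (\<lambda>n. T n \<omega>) at_top sequentially) \<and>
        (\<forall>n. martingale p F (\<lambda>t \<omega>. N (min t (T n \<omega>)) \<omega> - N 0 \<omega>)))"

definition cont_increasing ::
  "'w measure \<Rightarrow> (real \<Rightarrow> 'w measure) \<Rightarrow> (real \<Rightarrow> 'w \<Rightarrow> real) \<Rightarrow> bool" where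
  "cont_increasing p F C \<longleftrightarrow>
     (\<forall>t\<ge>0. C t \<in> borel_measurable (F t)) \<and>
     (AE \<omega> in p. C 0 \<omega> = 0 \<and> continuous_on {0..} (\<lambda>t. C t \<omega>) \<and> mono_on {0..} (\<lambda>t. C t \<omega>))"

text \<open>
  \<open>B1 - B2\<close> is the bracket \<open>\<langle>M,K\<rangle>\<close>, written as a difference of two continuous
  increasing processes.
\<close>

definition is_bracket ::
  "'w measure \<Rightarrow> (real \<Rightarrow> 'w measure) \<Rightarrow> (real \<Rightarrow> 'w \<Rightarrow> real) \<Rightarrow> (real \<Rightarrow> 'w \<Rightarrow> real)
     \<Rightarrow> (real \<Rightarrow> 'w \<Rightarrow> real) \<Rightarrow> (real \<Rightarrow> 'w \<Rightarrow> real) \<Rightarrow> bool" where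
  "is_bracket p F M K B1 B2 \<longleftrightarrow>
     cont_increasing p F B1 \<and> cont_increasing p F B2 \<and>
     cont_local_martingale p F (\<lambda>t \<omega>. M t \<omega> * K t \<omega> - (B1 t \<omega> - B2 t \<omega>))"

text \<open>
  \<open>N\<close> is a version of the stochastic integral of the bounded progressive process \<open>H\<close> with respect
  to the continuous local martingale \<open>M\<close>: the continuous local martingale null at zero with
  \<open>\<langle>N,K\<rangle> = \<integral> H d\<langle>M,K\<rangle>\<close> for every continuous local martingale \<open>K\<close>
  (Revuz and Yor, Continuous Martingales and Brownian Motion, Chapter IV, Section 2).
\<close>

definition is_stoch_integral ::
  "'w measure \<Rightarrow> (real \<Rightarrow> 'w measure) \<Rightarrow> (real \<Rightarrow> 'w \<Rightarrow> real) \<Rightarrow> (real \<Rightarrow> 'w \<Rightarrow> real)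
     \<Rightarrow> (real \<Rightarrow> 'w \<Rightarrow> real) \<Rightarrow> bool" where
  "is_stoch_integral p F H M N \<longleftrightarrow>
     cont_local_martingale p F N \<and> (AE \<omega> in p. N 0 \<omega> = 0) \<and>
     (\<forall>K B1 B2. cont_local_martingale p F K \<and> is_bracket p F M K B1 B2 \<longrightarrow>
        cont_local_martingale p F
          (\<lambda>t \<omega>. N t \<omega> * K t \<omega> - (path_integral H B1 t \<omega> - path_integral H B2 t \<omega>)))"

section \<open>Right processes\<close>

definition universal_completion :: "'a measure \<Rightarrow> 'a measure" where
  "universal_completion M =
     sigma (space M) {A. A \<subseteq> space M \<and>
       (\<forall>\<mu>. prob_space \<mu> \<and> sets \<mu> = sets M \<longrightarrow> A \<in> sets (completion \<mu>))}"

text \<open>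
  The data of a Markov process: state space \<open>E\<close>, cemetery point, sample space, coordinates
  \<open>X t\<close>, shifts \<open>\<theta> t\<close>, and the laws \<open>P x\<close> on the uncompleted sigma-algebra
  generated by the coordinates.
\<close>

record ('e, 'w) process =
  St :: "'e set"
  Cem :: 'e
  Paths :: "'w set"
  X :: "real \<Rightarrow> 'w \<Rightarrow> 'e"
  Shift :: "real \<Rightarrow> 'w \<Rightarrow> 'w"
  P :: "'e \<Rightarrow> 'w measure"

definition points :: "('e, 'w) process \<Rightarrow> 'e set" where
  "points W = insert (Cem W) (St W)"

text \<open>Functions on \<open>E\<close> vanish at the cemetery point.\<close>

definition ext0 :: "('e, 'w) process \<Rightarrow> ('e \<Rightarrow> 'b::zero) \<Rightarrow> 'e \<Rightarrow> 'b" where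
  "ext0 W f x = (if x \<in> St W then f x else 0)"

definition natural_alg ::
  "('e::polish_space, 'w) process \<Rightarrow> real set \<Rightarrow> 'w measure" where
  "natural_alg W I = sigma (Paths W) {X W s -` B \<inter> Paths W |s B. s \<in> I \<and> B \<in> sets borel}"

definition initial_laws :: "('e::polish_space, 'w) process \<Rightarrow> 'e measure set" where
  "initial_laws W = {\<mu>. prob_space \<mu> \<and> sets \<mu> = sets (restrict_space borel (points W))}"

text \<open>
  The law \<open>P\<^sub>\<mu>\<close>. The integrand is only universally measurable; the nonnegative integral of
  the library agrees with the one for the completion of \<open>\<mu>\<close>
  (fact \<open>nn_integral_completion\<close>). The same applies to the integrals below.
\<close>

definition law_from :: "('e::polish_space, 'w) process \<Rightarrow> 'e measure \<Rightarrow> 'w measure" where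
  "law_from W \<mu> = measure_of (Paths W) (sets (natural_alg W {0..}))
     (\<lambda>\<Gamma>. \<integral>\<^sup>+x. emeasure (P W x) \<Gamma> \<partial>\<mu>)"

definition semigroup_op ::
  "('e, 'w) process \<Rightarrow> real \<Rightarrow> ('e \<Rightarrow> ennreal) \<Rightarrow> 'e \<Rightarrow> ennreal" where
  "semigroup_op W t f x = (\<integral>\<^sup>+\<omega>. ext0 W f (X W t \<omega>) \<partial>P W x)"

definition excessive ::
  "('e::polish_space, 'w) process \<Rightarrow> real \<Rightarrow> ('e \<Rightarrow> ennreal) \<Rightarrow> bool" where
  "excessive W \<alpha> f \<longleftrightarrow>
     f \<in> borel_measurable (universal_completion (restrict_space borel (St W))) \<and>
     (\<forall>x\<in>St W.
        (\<forall>t\<ge>0. ennreal (exp (- \<alpha> * t)) * semigroup_op W t f x \<le> f x) \<and>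
        ((\<lambda>t. ennreal (exp (- \<alpha> * t)) * semigroup_op W t f x) \<longlongrightarrow> f x) (at_right 0))"

text \<open>
  Right processes in the sense of Sharpe (General Theory of Markov Processes): \<open>E\<close> is a Radon
  space, i.e. a universally measurable subset of a Polish space, the realization is right
  continuous and Markovian (first two hypotheses droites), and alpha-excessive functions are
  almost surely right continuous along the paths. As the cemetery point is absorbing, its
  position relative to \<open>E\<close> in the ambient topology plays no role.
\<close>

locale right_process =
  fixes W :: "('e::polish_space, 'w) process"
  assumes radon: "St W \<in> sets (universal_completion borel)"
    and cemetery: "Cem W \<notin> St W"
    and X_in_points: "\<And>t \<omega>. 0 \<le> t \<Longrightarrow> \<omega> \<in> Paths W \<Longrightarrow> X W t \<omega> \<in> points W"
    and absorbing: "\<And>s t \<omega>. 0 \<le> s \<Longrightarrow> s \<le> t \<Longrightarrow> \<omega> \<in> Paths W \<Longrightarrow>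
          X W s \<omega> = Cem W \<Longrightarrow> X W t \<omega> = Cem W"
    and right_cont: "\<And>t \<omega>. 0 \<le> t \<Longrightarrow> \<omega> \<in> Paths W \<Longrightarrow>
          ((\<lambda>s. X W s \<omega>) \<longlongrightarrow> X W t \<omega>) (at_right t)"
    and Shift_in_Paths: "\<And>t \<omega>. 0 \<le> t \<Longrightarrow> \<omega> \<in> Paths W \<Longrightarrow> Shift W t \<omega> \<in> Paths W"
    and X_Shift: "\<And>s t \<omega>. 0 \<le> s \<Longrightarrow> 0 \<le> t \<Longrightarrow> \<omega> \<in> Paths W \<Longrightarrow>
          X W s (Shift W t \<omega>) = X W (s + t) \<omega>"
    and prob_space_P: "\<And>x. x \<in> points W \<Longrightarrow> prob_space (P W x)"
    and sets_P: "\<And>x. x \<in> points W \<Longrightarrow> sets (P W x) = sets (natural_alg W {0..})"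
    and measurable_P: "\<And>\<Gamma>. \<Gamma> \<in> sets (natural_alg W {0..}) \<Longrightarrow>
          (\<lambda>x. emeasure (P W x) \<Gamma>)
            \<in> borel_measurable (universal_completion (restrict_space borel (points W)))"
    and normal: "\<And>x. x \<in> points W \<Longrightarrow> AE \<omega> in P W x. X W 0 \<omega> = x"
    and markov: "\<And>x t \<Lambda> \<Gamma>. x \<in> points W \<Longrightarrow> 0 \<le> t \<Longrightarrow>
          \<Lambda> \<in> sets (natural_alg W {0..t}) \<Longrightarrow> \<Gamma> \<in> sets (natural_alg W {0..}) \<Longrightarrow>
          emeasure (P W x) (\<Lambda> \<inter> Shift W t -` \<Gamma>) =
            (\<integral>\<^sup>+\<omega>. indicator \<Lambda> \<omega> * emeasure (P W (X W t \<omega>)) \<Gamma> \<partial>P W x)"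
    and excessive_right_cont: "\<And>\<mu> \<alpha> f. \<mu> \<in> initial_laws W \<Longrightarrow> 0 < \<alpha> \<Longrightarrow> excessive W \<alpha> f \<Longrightarrow>
          AE \<omega> in law_from W \<mu>. \<forall>t\<ge>0.
            ((\<lambda>s. ext0 W f (X W s \<omega>)) \<longlongrightarrow> ext0 W f (X W t \<omega>)) (at_right t)"

text \<open>
  \<open>canonical_alg W t\<close> is the usual \<open>\<F>\<^sub>t\<close>, the intersection over all initial laws
  \<open>\<mu>\<close> of the augmentation of \<open>\<sigma>(X\<^sub>s, s \<le> t)\<close> by the \<open>P\<^sub>\<mu>\<close>-null sets.
  The augmentation \<open>filt_at W x\<close> for the single law \<open>P\<^sub>x\<close> satisfies the usual conditions
  under \<open>P\<^sub>x\<close> and differs from the canonical one only by \<open>P\<^sub>x\<close>-null sets.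
\<close>

definition augment :: "'w measure \<Rightarrow> 'w measure \<Rightarrow> 'w measure" where
  "augment p G = sigma (space p)
     {A. A \<subseteq> space p \<and> (\<exists>B\<in>sets G. \<exists>N\<in>null_sets p. (A - B) \<union> (B - A) \<subseteq> N)}"

definition canonical_alg :: "('e::polish_space, 'w) process \<Rightarrow> real \<Rightarrow> 'w measure" where
  "canonical_alg W t = sigma (Paths W)
     (\<Inter>\<mu>\<in>initial_laws W. sets (augment (law_from W \<mu>) (natural_alg W {0..t})))"

definition filt_at :: "('e::polish_space, 'w) process \<Rightarrow> 'e \<Rightarrow> real \<Rightarrow> 'w measure" where
  "filt_at W x t = augment (P W x) (natural_alg W {0..t})"

text \<open>
  The sigma-algebra \<open>\<E>\<^sup>e\<close> generated by the alpha-excessive functions. It contains the Borel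
  sets and is contained in the universally measurable ones. Excessive functions need not be Borel,
  so this is the sigma-algebra on \<open>E\<close> on which the measures below live.
\<close>

definition state_alg :: "('e::polish_space, 'w) process \<Rightarrow> 'e measure" where
  "state_alg W = sigma (St W)
     {f -` B \<inter> St W |f B \<alpha>. 0 \<le> \<alpha> \<and> excessive W \<alpha> f \<and> B \<in> sets borel}"

definition thin :: "('e::polish_space, 'w) process \<Rightarrow> 'e set \<Rightarrow> bool" where
  "thin W B \<longleftrightarrow> B \<in> sets (state_alg W) \<and>
     (\<forall>x\<in>St W. AE \<omega> in P W x. \<exists>\<epsilon>>0. \<forall>t\<in>{0<..<\<epsilon>}. X W t \<omega> \<notin> B)"

definition semipolar :: "('e::polish_space, 'w) process \<Rightarrow> 'e set \<Rightarrow> bool" where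
  "semipolar W B \<longleftrightarrow> (\<exists>T :: nat \<Rightarrow> 'e set. (\<forall>n. thin W (T n)) \<and> B \<subseteq> (\<Union>n. T n))"

definition excessive_reference_measure ::
  "('e::polish_space, 'w) process \<Rightarrow> 'e measure \<Rightarrow> bool" where
  "excessive_reference_measure W \<xi> \<longleftrightarrow>
     sets \<xi> = sets (state_alg W) \<and> sigma_finite_measure \<xi> \<and>
     (\<forall>t\<ge>0. \<forall>B\<in>sets \<xi>. (\<integral>\<^sup>+x. semigroup_op W t (indicator B) x \<partial>\<xi>) \<le> emeasure \<xi> B) \<and>
     (\<forall>B\<in>sets \<xi>. emeasure \<xi> B = 0 \<longleftrightarrow>
        (\<forall>x\<in>St W. (\<integral>\<^sup>+t\<in>{0..}. semigroup_op W t (indicator B) x \<partial>lborel) = 0))"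

section \<open>Continuous additive functionals and associated measures\<close>

definition cont_additive_functional ::
  "('e::polish_space, 'w) process \<Rightarrow> (real \<Rightarrow> 'w \<Rightarrow> real) \<Rightarrow> bool" where
  "cont_additive_functional W C \<longleftrightarrow>
     (\<forall>t\<ge>0. C t \<in> borel_measurable (canonical_alg W t)) \<and>
     (\<forall>x\<in>points W. AE \<omega> in P W x.
        C 0 \<omega> = 0 \<and> continuous_on {0..} (\<lambda>t. C t \<omega>) \<and> mono_on {0..} (\<lambda>t. C t \<omega>) \<and>
        (\<forall>s t. 0 \<le> s \<and> s \<le> t \<and> X W s \<omega> = Cem W \<longrightarrow> C t \<omega> = C s \<omega>)) \<and>
     (\<forall>x\<in>points W. \<forall>s\<ge>0. \<forall>t\<ge>0. AE \<omega> in P W x.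
        C (t + s) \<omega> = C t \<omega> + C s (Shift W t \<omega>))"

definition terminal_value :: "(real \<Rightarrow> 'w \<Rightarrow> real) \<Rightarrow> 'w \<Rightarrow> ennreal" where
  "terminal_value C \<omega> = (SUP t\<in>{0..}. ennreal (C t \<omega>))"

definition is_associated_measure ::
  "('e::polish_space, 'w) process \<Rightarrow> 'e measure \<Rightarrow> (real \<Rightarrow> 'w \<Rightarrow> real) \<Rightarrow> 'e measure \<Rightarrow> bool" where
  "is_associated_measure W \<xi> C \<mu> \<longleftrightarrow>
     sets \<mu> = sets (state_alg W) \<and> sigma_finite_measure \<mu> \<and>
     (\<forall>B\<in>sets \<mu>. semipolar W B \<longrightarrow> emeasure \<mu> B = 0) \<and>
     (\<forall>f\<in>borel_measurable (state_alg W).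
        ((\<lambda>t. ennreal (1 / t) *
            (\<integral>\<^sup>+x. \<integral>\<^sup>+\<omega>. (\<integral>\<^sup>+s\<in>{0..t}. ext0 W f (X W s \<omega>) \<partial>stieltjes (\<lambda>r. C r \<omega>)) \<partial>P W x \<partial>\<xi>))
          \<longlongrightarrow> (\<integral>\<^sup>+x. f x \<partial>\<mu>)) (at_right 0))"

section \<open>The martingale of a potential, its bracket and the local times\<close>

definition is_martingale_part ::
  "('e::polish_space, 'w) process \<Rightarrow> (real \<Rightarrow> 'w \<Rightarrow> real) \<Rightarrow> (real \<Rightarrow> 'w \<Rightarrow> real) \<Rightarrow> bool" where
  "is_martingale_part W A M \<longleftrightarrow>
     (\<forall>t\<ge>0. M t \<in> borel_measurable (canonical_alg W t)) \<and>
     (\<forall>x\<in>St W. \<forall>t\<ge>0. AE \<omega> in P W x.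
        M t \<omega> =
          real_cond_exp (completion (P W x)) (canonical_alg W t) (\<lambda>\<omega>. enn2real (terminal_value A \<omega>)) \<omega> -
          real_cond_exp (completion (P W x)) (canonical_alg W 0) (\<lambda>\<omega>. enn2real (terminal_value A \<omega>)) \<omega>)"

definition is_bracket_functional ::
  "('e::polish_space, 'w) process \<Rightarrow> (real \<Rightarrow> 'w \<Rightarrow> real) \<Rightarrow> (real \<Rightarrow> 'w \<Rightarrow> real) \<Rightarrow> bool" where
  "is_bracket_functional W M Q \<longleftrightarrow>
     cont_additive_functional W Q \<and>
     (\<forall>x\<in>St W. is_bracket (completion (P W x)) (filt_at W x) M M Q (\<lambda>t \<omega>. 0))"

text \<open>
  \<open>L a\<close> is the local time at \<open>a\<close> of \<open>Y\<^sub>t = u(X\<^sub>t)\<close>, where \<open>u(X\<^sub>t) = u(X\<^sub>0) + M\<^sub>t - A\<^sub>t\<close> and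
  \<open>Q = \<langle>M,M\<rangle>\<close>: Tanaka's formula for \<open>u \<and> a\<close> and the occupation formula. The
  joint measurability in the level and the path is what gives the occupation formula its meaning.
\<close>

definition is_local_time ::
  "('e::polish_space, 'w) process \<Rightarrow> ('e \<Rightarrow> real) \<Rightarrow> (real \<Rightarrow> 'w \<Rightarrow> real) \<Rightarrow> (real \<Rightarrow> 'w \<Rightarrow> real)
     \<Rightarrow> (real \<Rightarrow> 'w \<Rightarrow> real) \<Rightarrow> (real \<Rightarrow> real \<Rightarrow> 'w \<Rightarrow> real) \<Rightarrow> bool" where
  "is_local_time W u A M Q L \<longleftrightarrow>
     (let Y = (\<lambda>t \<omega>. ext0 W u (X W t \<omega>)) in
       (\<forall>a. cont_additive_functional W (L a)) \<and>
       (\<forall>t\<ge>0. (\<lambda>(a, \<omega>). L a t \<omega>) \<in> borel_measurable (borel \<Otimes>\<^sub>M canonical_alg W t)) \<and>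
       (\<forall>a. \<forall>x\<in>St W. \<exists>N.
          is_stoch_integral (completion (P W x)) (filt_at W x)
            (\<lambda>s \<omega>. of_bool (Y s \<omega> < a)) M N \<and>
          (AE \<omega> in P W x. \<forall>t\<ge>0.
            min (Y t \<omega>) a = min (Y 0 \<omega>) a
              + (N t \<omega> - path_integral (\<lambda>s \<omega>. of_bool (Y s \<omega> < a)) A t \<omega>)
              - L a t \<omega> / 2)) \<and>
       (\<forall>g\<in>borel_measurable borel. \<forall>x\<in>St W. \<forall>t\<ge>0. AE \<omega> in P W x.
          (\<integral>\<^sup>+s\<in>{0..t}. g (Y s \<omega>) \<partial>stieltjes (\<lambda>r. Q r \<omega>)) =
          (\<integral>\<^sup>+a. g a * ennreal (L a t \<omega>) \<partial>lborel)))"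

end

(*
  Carrier: let Y = u(X). While Y < a, Tanaka's formula makes M - N equal to -L/2 up to a constant,
  hence decreasing; while Y > a, it makes N equal to L/2, hence increasing. A continuous martingale
  that is monotone up to the first rational time at which such a phase may have ended is constant
  up to that time, by optional stopping along finite grids. So the measure dL^a does not charge
  {Y <> a}, and this holds for every level a, not just for almost every one.

  Disintegration: the occupation formula with g = 1 says that dQ is the mixture of the measures
  dL^a over da, which gives E_xi int_0^t f(X) dQ = int (E_xi int_0^t f(X) dL^a) da. By the Markov
  property and the excessivity of xi, E_xi int_0^t f(X) dC is subadditive in t, so its quotient by
  t increases as t decreases through the powers of 1/2, and monotone convergence yields the
  formula for the associated measures.
*)

theory Submission
  imports Defs
begin

section \<open>Completions\<close>

text \<open>The obstacle that shapes the proof is measurability. The laws depend on x through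
  universally measurable functions only, sets of \<open>state_alg W\<close> need not be Borel, and
  additive functionals are regular and additive only off null sets that vary with the law, the level
  and the times. In order to integrate over levels, paths and starting points at once, one initial
  law dominating \<xi> is fixed, and exceptional paths are collected in a single null set of its
  path law. The Markov property and the excessivity of \<xi> show that, for \<xi>-almost every
  starting point, shifted paths that are still alive avoid this set as well. Off it the integrals
  along \<open>L a\<close> are jointly measurable in level and path, because they are rebuilt from
  rational times; Tonelli's theorem then applies. Powers of 1/2 are suitable times because they are
  rational and each is twice the next. In the martingale part only times with finitely many values
  are stopped at. The infimum of the bad times is reached as a limit of such times, so that
  expectations have to be controlled in this limit.\<close>

lemma measurable_completion_AE_cong:
  assumes g: "g \<in> measurable (completion M) N" and eq: "AE x in M. f x = g x"
    and f: "f \<in> space M \<rightarrow> space N"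
  shows "f \<in> measurable (completion M) N"
proof (rule measurableI)
  from eq obtain Z where Z: "Z \<in> null_sets M" "{x\<in>space M. f x \<noteq> g x} \<subseteq> Z"
    by (auto elim!: AE_E simp: null_sets_def)
  fix A assume A: "A \<in> sets N"
  have "f -` A \<inter> space M = ((g -` A \<inter> space M) - {x\<in>space M. f x \<noteq> g x})
      \<union> {x\<in>space M. f x \<noteq> g x \<and> f x \<in> A}" by auto
  moreover have "g -` A \<inter> space M \<in> sets (completion M)"
    using measurable_sets[OF g A] by simp
  moreover have "{x\<in>space M. f x \<noteq> g x} \<in> sets (completion M)"
    by (rule null_sets_completion[OF Z])
  moreover have "{x\<in>space M. f x \<noteq> g x \<and> f x \<in> A} \<in> sets (completion M)"
    by (rule null_sets_completion[OF Z(1)]) (use Z(2) in auto)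
  ultimately show "f -` A \<inter> space (completion M) \<in> sets (completion M)" by simp
qed (use f in auto)

text \<open>Null sets of the image law pull back to null sets, so the decomposition of A into a
  measurable set and part of a null set pulls back as well.\<close>

lemma completion_vimage:
  assumes f: "f \<in> measurable M N" and A: "A \<in> sets (completion (distr M N f))"
  shows "f -` A \<inter> space M \<in> sets (completion M)"
proof -
  from A obtain S Z Z' where *: "A = S \<union> Z" "Z \<subseteq> Z'" "Z' \<in> null_sets (distr M N f)" "S \<in> sets N"
    by (auto elim!: sets_completionE)
  have "f -` A \<inter> space M = (f -` S \<inter> space M) \<union> (f -` Z \<inter> space M)" using * by auto
  moreover have "f -` Z' \<inter> space M \<in> null_sets M"
    using *(3) f by (auto simp: null_sets_distr_iff)
  ultimately show ?thesis
    using *(2,4) measurable_sets[OF f] by (intro sets_completionI[where S="f -` S \<inter> space M" and N="f -` Z \<inter> space M" and N'="f -` Z' \<inter> space M"]) auto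
qed

text \<open>Induction over the generated sigma-algebra: a rectangle costs one null set of the second
  factor, and countable unions collect countably many of them. The exceptional set Z lies in the
  second factor alone and no measure on the first is involved, so a single Z serves all levels a at
  once.\<close>

lemma pair_completion_sets_ex:
  assumes "S \<in> sets (M \<Otimes>\<^sub>M completion N)"
  shows "\<exists>S'\<in>sets (M \<Otimes>\<^sub>M N). \<exists>Z\<in>null_sets N. \<forall>a\<in>space M. \<forall>w\<in>space N - Z. (a, w) \<in> S \<longleftrightarrow> (a, w) \<in> S'"
proof -
  have "S \<in> sigma_sets (space M \<times> space N) {a \<times> b | a b. a \<in> sets M \<and> b \<in> sets (completion N)}"
    using assms by (simp add: sets_pair_measure)
  then show ?thesis
  proof induct
    case (Basic S)
    then obtain a b where ab: "S = a \<times> b" "a \<in> sets M" "b \<in> sets (completion N)" by auto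
    from ab(3) obtain B Y Z where *: "b = B \<union> Y" "Y \<subseteq> Z" "Z \<in> null_sets N" "B \<in> sets N"
      by (auto elim!: sets_completionE)
    show ?case
      by (rule bexI[of _ "a \<times> B"], rule bexI[of _ Z]) (use ab * in auto)
  next
    case Empty then show ?case by (intro bexI[of _ "{}"]) auto
  next
    case (Compl S)
    then obtain S' Z where *: "S'\<in>sets (M \<Otimes>\<^sub>M N)" "Z\<in>null_sets N" "\<forall>a\<in>space M. \<forall>w\<in>space N - Z. (a, w) \<in> S \<longleftrightarrow> (a, w) \<in> S'" by auto
    show ?case
      by (rule bexI[of _ "space (M \<Otimes>\<^sub>M N) - S'"], rule bexI[of _ Z]) (use * in \<open>auto simp: space_pair_measure\<close>)
  next
    case (Union A)
    define R where "R i S' Z \<longleftrightarrow> S'\<in>sets (M \<Otimes>\<^sub>M N) \<and> Z\<in>null_sets N \<and> (\<forall>a\<in>space M. \<forall>w\<in>space N - Z. (a, w) \<in> A i \<longleftrightarrow> (a, w) \<in> S')" for i :: nat and S' Z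
    have "\<exists>S' Z. R i S' Z" for i
      using Union(2)[of i] unfolding R_def by (elim bexE) (intro exI conjI)
    then obtain S' Z where R: "R i (S' i) (Z i)" for i by metis
    have *: "S' i\<in>sets (M \<Otimes>\<^sub>M N)" "Z i\<in>null_sets N" "\<forall>a\<in>space M. \<forall>w\<in>space N - Z i. (a, w) \<in> A i \<longleftrightarrow> (a, w) \<in> S' i" for i
      using R[of i] unfolding R_def by simp_all
    show ?case
    proof (rule bexI[of _ "\<Union>i. S' i"], rule bexI[of _ "\<Union>i. Z i"], intro ballI)
      fix a w assume "a \<in> space M" "w \<in> space N - (\<Union>i. Z i)"
      with *(3) show "(a, w) \<in> (\<Union>i. A i) \<longleftrightarrow> (a, w) \<in> (\<Union>i. S' i)" by simp
    next
      show "(\<Union>i. S' i) \<in> sets (M \<Otimes>\<^sub>M N)" using *(1) by auto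
      show "(\<Union>i. Z i) \<in> null_sets N" using *(2) by (intro null_sets_UN) auto
    qed
  qed
qed

text \<open>Sums and suprema in the approximation by simple functions unite at most countably many
  exceptional sets, so that again one null set in the second factor remains.\<close>

lemma pair_completion_borel_ex:
  fixes g :: "'a \<times> 'b \<Rightarrow> ennreal"
  assumes "g \<in> borel_measurable (M \<Otimes>\<^sub>M completion N)"
  shows "\<exists>g'\<in>borel_measurable (M \<Otimes>\<^sub>M N). \<exists>Z\<in>null_sets N. \<forall>a\<in>space M. \<forall>w\<in>space N - Z. g (a, w) = g' (a, w)"
  using assms
proof (induct rule: borel_measurable_induct)
  case (cong f g)
  then show ?case by (auto simp: space_pair_measure)
next
  case (set S)
  from pair_completion_sets_ex[OF this] obtain S' Z where
    *: "S'\<in>sets (M \<Otimes>\<^sub>M N)" "Z\<in>null_sets N" "\<forall>a\<in>space M. \<forall>w\<in>space N - Z. (a, w) \<in> S \<longleftrightarrow> (a, w) \<in> S'" by auto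
  show ?case
  proof (rule bexI[of _ "indicator S'"], rule bexI[of _ Z], intro ballI)
    fix a w assume "a \<in> space M" "w \<in> space N - Z"
    with *(3) show "indicator S (a, w) = (indicator S' (a, w) :: ennreal)" by (simp add: indicator_def)
  qed (use *(1,2) in simp_all)
next
  case (mult u c)
  then obtain u' Z where *: "u'\<in>borel_measurable (M \<Otimes>\<^sub>M N)" "Z\<in>null_sets N"
    "\<And>a w. a \<in> space M \<Longrightarrow> w \<in> space N - Z \<Longrightarrow> u (a, w) = u' (a, w)" by blast
  show ?case
  proof (rule bexI[of _ "\<lambda>x. c * u' x"], rule bexI[of _ Z], intro ballI)
    fix a w assume "a \<in> space M" "w \<in> space N - Z"
    from *(3)[OF this] show "c * u (a, w) = c * u' (a, w)" by simp
  qed (use *(1,2) in simp_all)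
next
  case (add u v)
  from add(3) obtain u' Z where 1: "u'\<in>borel_measurable (M \<Otimes>\<^sub>M N)" "Z\<in>null_sets N"
    "\<And>a w. a \<in> space M \<Longrightarrow> w \<in> space N - Z \<Longrightarrow> u (a, w) = u' (a, w)" by blast
  from add(7) obtain v' Z' where 2: "v'\<in>borel_measurable (M \<Otimes>\<^sub>M N)" "Z'\<in>null_sets N"
    "\<And>a w. a \<in> space M \<Longrightarrow> w \<in> space N - Z' \<Longrightarrow> v (a, w) = v' (a, w)" by blast
  show ?case
  proof (rule bexI[of _ "\<lambda>x. v' x + u' x"], rule bexI[of _ "Z \<union> Z'"], intro ballI)
    fix a w assume "a \<in> space M" "w \<in> space N - (Z \<union> Z')"
    with 1(3)[of a w] 2(3)[of a w] show "v (a, w) + u (a, w) = v' (a, w) + u' (a, w)" by simp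
  qed (use 1(1,2) 2(1,2) in \<open>simp_all add: null_sets.Un\<close>)
next
  case (seq U)
  from seq(3) have "\<forall>i. \<exists>u' Z. u'\<in>borel_measurable (M \<Otimes>\<^sub>M N) \<and> Z\<in>null_sets N \<and> (\<forall>a\<in>space M. \<forall>w\<in>space N - Z. U i (a, w) = u' (a, w))" by blast
  then obtain u' Z where *: "u' i\<in>borel_measurable (M \<Otimes>\<^sub>M N)" "Z i\<in>null_sets N" "\<forall>a\<in>space M. \<forall>w\<in>space N - Z i. U i (a, w) = u' i (a, w)" for i :: nat
    by metis
  have sq: "(SUP i. U i) x = (SUP i. U i x)" for x by (simp add: image_comp)
  show ?case
  proof (rule bexI[of _ "\<lambda>x. SUP i. u' i x"], rule bexI[of _ "\<Union>i. Z i"], intro ballI)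
    fix a w assume "a \<in> space M" "w \<in> space N - (\<Union>i. Z i)"
    with *(3) show "(SUP i. U i) (a, w) = (SUP i. u' i (a, w))" unfolding sq by simp
  next
    show "(\<lambda>x. SUP i. u' i x) \<in> borel_measurable (M \<Otimes>\<^sub>M N)"
      using *(1) by (intro borel_measurable_SUP) auto
    show "(\<Union>i. Z i) \<in> null_sets N" using *(2) by (intro null_sets_UN) auto
  qed
qed

text \<open>Agreement up to a null set is stable under complements and countable unions, so
  generating a sigma-algebra adds nothing, and every set of the augmentation has a representative in
  \<open>G\<close>.\<close>

lemma augment_sets:
  assumes G: "sets G \<subseteq> sets p" "space G = space p"
  shows "sets (augment p G) = {A. A \<subseteq> space p \<and> (\<exists>B\<in>sets G. \<exists>N\<in>null_sets p. (A - B) \<union> (B - A) \<subseteq> N)}" (is "_ = ?S")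
proof -
  have *: "A \<in> ?S" if "A \<in> sigma_sets (space p) ?S" for A
    using that
  proof induct
    case Empty then show ?case by (auto intro!: bexI[of _ "{}"])
  next
    case (Compl A)
    then obtain B N where *: "B \<in> sets G" "N \<in> null_sets p" "(A - B) \<union> (B - A) \<subseteq> N" "A \<subseteq> space p" by auto
    have "((space p - A) - (space G - B)) \<union> ((space G - B) - (space p - A)) \<subseteq> N"
      using *(3,4) G(2) by auto
    with * show ?case by blast
  next
    case (Union A)
    then have "\<forall>i. \<exists>B N. B\<in>sets G \<and> N\<in>null_sets p \<and> (A i - B) \<union> (B - A i) \<subseteq> N" by fast
    then obtain B N where *: "B i \<in> sets G" "N i \<in> null_sets p" "(A i - B i) \<union> (B i - A i) \<subseteq> N i" for i :: nat
      by metis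
    have "((\<Union>i. A i) - (\<Union>i. B i)) \<union> ((\<Union>i. B i) - (\<Union>i. A i)) \<subseteq> (\<Union>i. N i)"
      using *(3) by blast
    moreover have "(\<Union>i. A i) \<subseteq> space p" using Union by auto
    moreover have "(\<Union>i. B i) \<in> sets G" "(\<Union>i. N i) \<in> null_sets p" using * by (auto intro!: null_sets_UN)
    ultimately show ?case by blast
  qed auto
  have "sets (augment p G) = sigma_sets (space p) ?S"
    unfolding augment_def by (rule sets_measure_of) auto
  also have "\<dots> = ?S"
    by (intro equalityI subsetI, erule *, rule sigma_sets.Basic)
  finally show ?thesis .
qed

lemma space_augment [simp]: "space (augment p G) = space p"
  unfolding augment_def by (rule space_measure_of) auto

lemma sets_augment_completion:
  assumes G: "sets G \<subseteq> sets p" "space G = space p"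
  shows "sets (augment p G) \<subseteq> sets (completion p)"
proof
  fix A assume "A \<in> sets (augment p G)"
  then obtain B N where *: "B\<in>sets G" "N\<in>null_sets p" "(A - B) \<union> (B - A) \<subseteq> N" "A \<subseteq> space p"
    unfolding augment_sets[OF G] by auto
  have "A = (B - (B - A)) \<union> (A - B)" by auto
  moreover have "B - A \<in> sets (completion p)" "A - B \<in> sets (completion p)"
    using * by (auto intro!: null_sets_completion[of N])
  ultimately show "A \<in> sets (completion p)" using *(1) G(1)
    by (metis Un_commute sets.Diff sets.Un sets_completionI_sets subsetD)
qed

section \<open>Universally measurable sets\<close>

lemma space_universal_completion [simp]: "space (universal_completion M) = space M"
  unfolding universal_completion_def by (rule space_measure_of) auto

lemma sets_universal_completionI:
  assumes "A \<subseteq> space M" "\<And>\<mu>. prob_space \<mu> \<Longrightarrow> sets \<mu> = sets M \<Longrightarrow> A \<in> sets (completion \<mu>)"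
  shows "A \<in> sets (universal_completion M)"
  unfolding universal_completion_def using assms by (auto simp: sets_measure_of)

lemma sets_le_universal_completion: "sets M \<subseteq> sets (universal_completion M)"
  by (auto intro!: sets_universal_completionI dest: sets.sets_into_space)

lemma sets_universal_completion_prob:
  assumes "prob_space \<mu>" "sets \<mu> = sets M"
  shows "sets (universal_completion M) \<subseteq> sets (completion \<mu>)"
proof -
  let ?S = "{A. A \<subseteq> space M \<and> (\<forall>\<mu>. prob_space \<mu> \<and> sets \<mu> = sets M \<longrightarrow> A \<in> sets (completion \<mu>))}"
  have sp: "space (completion \<mu>) = space M" using sets_eq_imp_space_eq[OF assms(2)] by simp
  have "sigma_sets (space (completion \<mu>)) ?S \<subseteq> sets (completion \<mu>)"
    by (rule sets.sigma_sets_subset) (use assms in auto)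
  then show ?thesis unfolding universal_completion_def using sp by (subst sets_measure_of) auto
qed

text \<open>An integrable function that is positive everywhere, divided by its integral, serves as
  density. This reduces statements about sigma-finite measures to probability measures, against
  which universal measurability is defined.\<close>

lemma equivalent_probability_ex:
  assumes "sigma_finite_measure m" and nz: "emeasure m (space m) \<noteq> 0"
  shows "\<exists>\<mu>. prob_space \<mu> \<and> sets \<mu> = sets m \<and> null_sets \<mu> = null_sets m"
proof -
  interpret sigma_finite_measure m by fact
  obtain h where h[measurable]: "h \<in> borel_measurable m" and fin: "integral\<^sup>N m h \<noteq> \<infinity>"
    and pos: "\<And>x. x \<in> space m \<Longrightarrow> 0 < h x \<and> h x < \<infinity>"
    using Ex_finite_integrable_function by auto
  have n0: "integral\<^sup>N m h \<noteq> 0"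
  proof
    assume "integral\<^sup>N m h = 0"
    then have "AE x in m. h x = 0" by (simp add: nn_integral_0_iff_AE)
    then have "AE x in m. False" using AE_space by eventually_elim (use pos in force)
    then show False using nz by (simp add: AE_iff_null null_sets_def)
  qed
  have hm: "(\<lambda>x. h x / integral\<^sup>N m h) \<in> borel_measurable m" by measurable
  define \<mu> where "\<mu> = density m (\<lambda>x. h x / integral\<^sup>N m h)"
  have "emeasure \<mu> (space \<mu>) = (\<integral>\<^sup>+x. h x / integral\<^sup>N m h * indicator (space m) x \<partial>m)"
    unfolding \<mu>_def by (simp add: emeasure_density)
  also have "\<dots> = (\<integral>\<^sup>+x. h x \<partial>m) / integral\<^sup>N m h"
    by (subst nn_integral_divide[symmetric]) (auto intro!: nn_integral_cong)
  also have "\<dots> = 1" using fin n0 by (simp add: ennreal_divide_self less_top)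
  finally have "prob_space \<mu>" by (rule prob_spaceI)
  moreover have "null_sets \<mu> = null_sets m"
  proof -
    have "h x / integral\<^sup>N m h \<noteq> 0" if "x \<in> space m" for x
      using pos[OF that] fin by auto
    then have "(AE x in m. x \<in> X \<longrightarrow> h x / integral\<^sup>N m h = 0) \<longleftrightarrow> (AE x in m. x \<notin> X)" for X
      by (intro AE_cong) auto
    then have "X \<in> null_sets \<mu> \<longleftrightarrow> X \<in> null_sets m" for X
      unfolding \<mu>_def null_sets_density_iff[OF hm] using AE_iff_null_sets[of X m] by (metis null_setsD2)
    then show ?thesis by blast
  qed
  moreover have "sets \<mu> = sets m" by (simp add: \<mu>_def)
  ultimately show ?thesis by blast
qed

text \<open>An equivalent probability measure has the same null sets, hence the same completion.
  Only the zero measure has no such equivalent; its completion contains every subset of the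
  space.\<close>

lemma sets_universal_completion_sigma_finite:
  assumes m: "sigma_finite_measure m" and sets: "sets m = sets M"
  shows "sets (universal_completion M) \<subseteq> sets (completion m)"
proof (cases "emeasure m (space m) = 0")
  case True
  then have "space m \<in> null_sets m" by auto
  then show ?thesis using null_sets_completion[of "space m" m] sets.space_closed[of "universal_completion M"]
      sets_eq_imp_space_eq[OF sets] by auto
next
  case False
  obtain \<mu> where \<mu>: "prob_space \<mu>" "sets \<mu> = sets m" "null_sets \<mu> = null_sets m"
    using equivalent_probability_ex[OF m False] by blast
  then have "sets (completion \<mu>) = sets (completion m)"
    using sets_eq_imp_space_eq[OF \<mu>(2)] by (simp add: sets_completion)
  then show ?thesis using sets_universal_completion_prob[OF \<mu>(1), of M] \<mu>(2) sets by simp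
qed

text \<open>A probability measure on the source is pushed forward by \<open>f\<close>, and the given
  set is measurable for the completion of the image.\<close>

lemma measurable_universal_completion_map:
  assumes f: "f \<in> measurable M N"
  shows "f \<in> measurable (universal_completion M) (universal_completion N)"
proof (rule measurableI)
  fix A assume A: "A \<in> sets (universal_completion N)"
  show "f -` A \<inter> space (universal_completion M) \<in> sets (universal_completion M)"
  proof (rule sets_universal_completionI)
    fix \<mu> assume \<mu>: "prob_space \<mu>" "sets \<mu> = sets M"
    have f': "f \<in> measurable \<mu> N" using f \<mu>(2) by (simp cong: measurable_cong_sets)
    interpret prob_space \<mu> by fact
    have "prob_space (distr \<mu> N f)" using f' by (rule prob_space_distr)
    then have "A \<in> sets (completion (distr \<mu> N f))" using A sets_universal_completion_prob by fastforce
    from completion_vimage[OF f' this] show "f -` A \<inter> space (universal_completion M) \<in> sets (completion \<mu>)"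
      using sets_eq_imp_space_eq[OF \<mu>(2)] by simp
  qed auto
qed (simp add: measurable_space[OF f])

lemma measurable_completion_universal:
  assumes f: "f \<in> measurable M N" and m: "prob_space M"
  shows "f \<in> measurable (completion M) (universal_completion N)"
proof (rule measurableI)
  fix A assume "A \<in> sets (universal_completion N)"
  from measurable_sets[OF measurable_universal_completion_map[OF f] this]
  show "f -` A \<inter> space (completion M) \<in> sets (completion M)"
    using sets_universal_completion_prob[OF m refl] by auto
qed (simp add: measurable_space[OF f])

section \<open>Increasing paths and their Stieltjes measures\<close>

definition rat_mono :: "(real \<Rightarrow> real) \<Rightarrow> bool" where
  "rat_mono c \<longleftrightarrow> (\<forall>q\<in>\<rat>. \<forall>r\<in>\<rat>. 0 \<le> q \<and> q \<le> r \<longrightarrow> c q \<le> c r)"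

text \<open>
  An additive functional is regular only almost surely, for each level and each law separately.
  Rebuilding its path from rational times gives paths which are regular everywhere and depend
  measurably on all parameters.
\<close>

definition regularize :: "(real \<Rightarrow> real) \<Rightarrow> real \<Rightarrow> real" where
  "regularize c t = (if rat_mono c then INF q\<in>\<rat> \<inter> {t<..}. c q else 0)"

text \<open>Monotone paths have left limits automatically, so right continuity is all that remains
  to be demanded.\<close>

definition cadlag_increasing :: "(real \<Rightarrow> real) \<Rightarrow> bool" where
  "cadlag_increasing g \<longleftrightarrow> mono_on {0..} g \<and> (\<forall>t\<ge>0. continuous (at_right t) g)"

lemma rat_greater: "\<exists>q::real. q \<in> \<rat> \<inter> {t<..}"
  using Rats_dense_in_real[of t "t + 1"] by auto

lemma regularize_bdd:
  assumes "rat_mono c" "0 \<le> t" shows "bdd_below (c ` (\<rat> \<inter> {t<..}))"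
  using assms by (intro bdd_belowI[of _ "c 0"]) (auto simp: rat_mono_def)

text \<open>Unconditional in \<open>c\<close>: an infimum over later rationals is nondecreasing and
  right continuous, and the default value 0 takes care of paths that are not monotone on the
  rationals. A regularized path can thus be integrated against before any null set is
  discarded.\<close>

lemma regularize_cadlag: "cadlag_increasing (regularize c)"
proof (cases "rat_mono c")
  case True
  have mono: "regularize c s \<le> regularize c t" if "0 \<le> s" "s \<le> t" for s t
    unfolding regularize_def using True that rat_greater[of t] regularize_bdd[OF True, of s]
    by (auto intro!: cINF_superset_mono)
  moreover have "(regularize c \<longlongrightarrow> regularize c t) (at_right t)" if t: "0 \<le> t" for t
  proof (rule order_tendstoI)
    fix a assume "a < regularize c t"
    then have "\<forall>x>t. a < regularize c x" using mono[OF t] by (auto intro: less_le_trans)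
    then show "eventually (\<lambda>x. a < regularize c x) (at_right t)"
      using eventually_at_right_less[of t] by (auto elim!: eventually_mono)
  next
    fix a assume "regularize c t < a"
    then obtain q where q: "q \<in> \<rat>" "t < q" "c q < a"
      using True cINF_less_iff[OF _ regularize_bdd[OF True t]] rat_greater[of t] by (auto simp: regularize_def)
    have "regularize c x < a" if "t < x" "x < q" for x
    proof -
      have "regularize c x \<le> c q"
        unfolding regularize_def using True that q t by (auto intro!: cINF_lower regularize_bdd)
      with q show ?thesis by simp
    qed
    then show "eventually (\<lambda>x. regularize c x < a) (at_right t)"
      using q(2) by (auto simp: eventually_at_right)
  qed
  ultimately show ?thesis
    by (auto simp: cadlag_increasing_def continuous_within intro!: mono_onI)
next
  case False
  then have "regularize c = (\<lambda>_. 0)" by (auto simp: regularize_def)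
  then show ?thesis by (auto simp: cadlag_increasing_def mono_on_def)
qed

lemma cadlag_increasing_continuous:
  assumes "continuous_on {0..} c" "mono_on {0..} c"
  shows "cadlag_increasing c"
proof -
  have "continuous (at_right t) c" if "0 \<le> t" for t
  proof -
    have "continuous (at t within {0..}) c"
      using assms(1) that by (auto simp: continuous_on_eq_continuous_within)
    then show ?thesis using that by (auto intro: continuous_within_subset)
  qed
  then show ?thesis using assms by (auto simp: cadlag_increasing_def)
qed

text \<open>Right continuity recovers \<open>c t\<close> from the rationals just after t, and
  monotonicity keeps all later values above it.\<close>

lemma regularize_eq:
  assumes "cadlag_increasing c" "0 \<le> t"
  shows "rat_mono c" "regularize c t = c t"
proof -
  have m: "\<And>s t. 0 \<le> s \<Longrightarrow> s \<le> t \<Longrightarrow> c s \<le> c t"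
    using assms(1) by (auto simp: cadlag_increasing_def mono_on_def)
  then show g: "rat_mono c" by (auto simp: rat_mono_def)
  show "regularize c t = c t"
  proof (rule antisym)
    have "c t \<le> (INF q\<in>\<rat> \<inter> {t<..}. c q)"
      using rat_greater[of t] m assms(2) by (intro cINF_greatest) auto
    then show "c t \<le> regularize c t" using g by (simp add: regularize_def)
    show "regularize c t \<le> c t"
    proof (rule dense_ge)
      fix a assume "c t < a"
      moreover have "(c \<longlongrightarrow> c t) (at_right t)"
        using assms by (auto simp: cadlag_increasing_def continuous_within)
      ultimately have "eventually (\<lambda>x. c x < a) (at_right t)" by (auto dest: order_tendstoD)
      then obtain b where b: "t < b" "\<And>y. t < y \<Longrightarrow> y < b \<Longrightarrow> c y < a"
        by (auto simp: eventually_at_right_field)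
      obtain q where q: "q \<in> \<rat>" "t < q" "q < b" using Rats_dense_in_real[OF b(1)] by auto
      have "regularize c t \<le> c q"
        unfolding regularize_def using g q assms(2) by (auto intro!: cINF_lower regularize_bdd)
      also have "\<dots> \<le> a" using b(2)[OF q(2,3)] by simp
      finally show "regularize c t \<le> a" .
    qed
  qed
qed

text \<open>Only nonnegative rational times are ever looked at, so identities that hold almost
  surely at each fixed time, such as additivity, determine the regularized path.\<close>

lemma regularize_cong:
  assumes "\<And>q. q \<in> \<rat> \<Longrightarrow> 0 \<le> q \<Longrightarrow> c q = d q" "0 \<le> t"
  shows "regularize c t = regularize d t"
proof -
  have "(0 \<le> q \<and> q \<le> r \<longrightarrow> c q \<le> c r) = (0 \<le> q \<and> q \<le> r \<longrightarrow> d q \<le> d r)"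
    if "q \<in> \<rat>" "r \<in> \<rat>" for q r using assms(1)[of q] assms(1)[of r] that by auto
  then have "rat_mono c = rat_mono d" unfolding rat_mono_def by (intro ball_cong refl)
  moreover have "c ` (\<rat> \<inter> {t<..}) = d ` (\<rat> \<inter> {t<..})" using assms by (intro image_cong) auto
  ultimately show ?thesis by (simp add: regularize_def)
qed

lemma borel_measurable_regularize:
  assumes [measurable]: "\<And>q. q \<in> \<rat> \<Longrightarrow> 0 \<le> q \<Longrightarrow> (\<lambda>y. c y q) \<in> borel_measurable M"
    and t: "0 \<le> t"
  shows "(\<lambda>y. regularize (c y) t) \<in> borel_measurable M"
proof -
  define R where "R = {q::real. q \<in> \<rat> \<and> 0 \<le> q}"
  have cR: "countable R" using countable_rat by (rule countable_subset[rotated]) (auto simp: R_def)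
  have cm[measurable]: "q \<in> R \<Longrightarrow> (\<lambda>y. c y q) \<in> borel_measurable M" for q
    using assms(1) by (auto simp: R_def)
  have "rat_mono (c y) \<longleftrightarrow> (\<forall>q\<in>R. \<forall>r\<in>R. q \<le> r \<longrightarrow> c y q \<le> c y r)" for y
    unfolding rat_mono_def R_def by (auto intro: order_trans)
  moreover have "Measurable.pred M (\<lambda>y. \<forall>q\<in>R. \<forall>r\<in>R. q \<le> r \<longrightarrow> c y q \<le> c y r)"
    using cR cm by measurable
  ultimately have [measurable]: "Measurable.pred M (\<lambda>y. rat_mono (c y))" by simp
  have "(\<lambda>y. INF q\<in>\<rat> \<inter> {t<..}. c y q) \<in> borel_measurable M"
    using t countable_rat by (intro borel_measurable_cINF_real) (auto intro!: assms(1))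
  then show ?thesis unfolding regularize_def by measurable
qed

section \<open>Stieltjes measures of right continuous increasing paths and their dependence on
  parameters\<close>

lemma stieltjes_cong: "(\<And>t. 0 \<le> t \<Longrightarrow> c t = d t) \<Longrightarrow> stieltjes c = stieltjes d"
  unfolding stieltjes_def by (intro arg_cong[where f=interval_measure] ext) auto

lemma sets_stieltjes [simp, measurable_cong]: "sets (stieltjes c) = sets borel"
  by (simp add: stieltjes_def)

lemma space_stieltjes [simp]: "space (stieltjes c) = UNIV"
  by (simp add: stieltjes_def)

lemma cadlag_increasing_clamp:
  assumes "cadlag_increasing c"
  shows "x \<le> y \<Longrightarrow> c (max 0 x) \<le> c (max 0 y)" "continuous (at_right a) (\<lambda>s. c (max 0 s))"
proof -
  show "x \<le> y \<Longrightarrow> c (max 0 x) \<le> c (max 0 y)"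
    using assms by (auto simp: cadlag_increasing_def mono_on_def max_def)
  show "continuous (at_right a) (\<lambda>s. c (max 0 s))"
  proof (cases "0 \<le> a")
    case True
    have "(c \<longlongrightarrow> c a) (at_right a)" using assms True by (auto simp: cadlag_increasing_def continuous_within)
    moreover have "eventually (\<lambda>s. c (max 0 s) = c s) (at_right a)"
      using eventually_at_right_less[of a] True by (auto elim!: eventually_mono)
    ultimately show ?thesis using True by (simp add: continuous_within tendsto_cong)
  next
    case False
    have "eventually (\<lambda>s. c (max 0 s) = c 0) (at_right a)"
      using False by (auto simp: eventually_at_right_field intro!: exI[of _ 0])
    then show ?thesis using False by (simp add: continuous_within tendsto_eventually)
  qed
qed

lemma emeasure_stieltjes_Ioc:
  assumes "cadlag_increasing c" "a \<le> b"
  shows "emeasure (stieltjes c) {a<..b} = ennreal (c (max 0 b) - c (max 0 a))"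
  unfolding stieltjes_def
  using emeasure_interval_measure_Ioc[of a b "\<lambda>s. c (max 0 s)"] cadlag_increasing_clamp[OF assms(1)] assms(2) by auto

lemma emeasure_stieltjes_greaterThan:
  assumes c: "cadlag_increasing c" and t: "0 \<le> t"
  shows "emeasure (stieltjes c) ({x<..} \<inter> {0..t}) = ennreal (c t - c (max 0 (min x t)))"
proof -
  consider "t \<le> x" | "0 \<le> x" "x < t" | "x < 0" by linarith
  then show ?thesis
  proof cases
    case 1
    then have "{x<..} \<inter> {0..t} = {}" by auto
    then show ?thesis using 1 t by simp
  next
    case 2
    then have "{x<..} \<inter> {0..t} = {x<..t}" by auto
    then show ?thesis using 2 emeasure_stieltjes_Ioc[OF c, of x t] by simp
  next
    case 3
    then have e: "{x<..} \<inter> {0..t} = {0..t}" by auto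
    \<comment> \<open>Extending the path by \<open>c 0\<close> to negative times leaves no mass on
      the negative half-line and no atom at 0, so the lower and the upper bound coincide.\<close>
    have "emeasure (stieltjes c) {0<..t} \<le> emeasure (stieltjes c) {0..t}"
      "emeasure (stieltjes c) {0..t} \<le> emeasure (stieltjes c) {x<..t}"
      using 3 by (auto intro!: emeasure_mono)
    then show ?thesis using 3 t emeasure_stieltjes_Ioc[OF c, of x t] emeasure_stieltjes_Ioc[OF c, of 0 t]
      by (simp add: e)
  qed
qed

lemma emeasure_stieltjes_Icc:
  assumes c: "cadlag_increasing c" and t: "0 \<le> t"
  shows "emeasure (stieltjes c) {0..t} = ennreal (c t - c 0)"
proof -
  have "{-1<..} \<inter> {0..t} = {0..t}" by auto
  then show ?thesis using emeasure_stieltjes_greaterThan[OF c t, of "-1"] t by simp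
qed

text \<open>The normalization gives mass at most one, so that the kernel lemmas of the Giry monad apply.\<close>

definition capped_stieltjes :: "(real \<Rightarrow> real) \<Rightarrow> real \<Rightarrow> real measure" where
  "capped_stieltjes c t =
     density (stieltjes c) (\<lambda>s. indicator {0..t} s * ennreal (1 / (1 + (c t - c 0))))"

lemma sets_capped_stieltjes [simp, measurable_cong]: "sets (capped_stieltjes c t) = sets borel"
  by (simp add: capped_stieltjes_def)

lemma space_capped_stieltjes [simp]: "space (capped_stieltjes c t) = UNIV"
  by (simp add: capped_stieltjes_def)

lemma emeasure_capped_stieltjes:
  assumes [measurable]: "A \<in> sets borel"
  shows "emeasure (capped_stieltjes c t) A = ennreal (1 / (1 + (c t - c 0))) * emeasure (stieltjes c) (A \<inter> {0..t})"
proof -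
  have "emeasure (capped_stieltjes c t) A = (\<integral>\<^sup>+s. ennreal (1 / (1 + (c t - c 0))) * indicator (A \<inter> {0..t}) s \<partial>stieltjes c)"
    unfolding capped_stieltjes_def by (subst emeasure_density) (auto intro!: nn_integral_cong simp: indicator_def)
  then show ?thesis by (simp add: nn_integral_cmult_indicator)
qed

lemma nn_integral_capped_stieltjes:
  assumes c: "cadlag_increasing c" and t: "0 \<le> t" and [measurable]: "f \<in> borel_measurable borel"
  shows "(\<integral>\<^sup>+s\<in>{0..t}. f s \<partial>stieltjes c) = ennreal (1 + (c t - c 0)) * (\<integral>\<^sup>+s. f s \<partial>capped_stieltjes c t)"
proof -
  have pos: "0 \<le> c t - c 0" using c t by (auto simp: cadlag_increasing_def mono_on_def)
  have "(\<integral>\<^sup>+s. f s \<partial>capped_stieltjes c t) = (\<integral>\<^sup>+s. ennreal (1 / (1 + (c t - c 0))) * (f s * indicator {0..t} s) \<partial>stieltjes c)"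
    unfolding capped_stieltjes_def by (subst nn_integral_density) (auto intro!: nn_integral_cong simp: ac_simps)
  also have "\<dots> = ennreal (1 / (1 + (c t - c 0))) * (\<integral>\<^sup>+s\<in>{0..t}. f s \<partial>stieltjes c)"
    by (rule nn_integral_cmult) measurable
  finally have "ennreal (1 + (c t - c 0)) * (\<integral>\<^sup>+s. f s \<partial>capped_stieltjes c t) =
      (ennreal (1 + (c t - c 0)) * ennreal (1 / (1 + (c t - c 0)))) * (\<integral>\<^sup>+s\<in>{0..t}. f s \<partial>stieltjes c)"
    by (simp only: mult.assoc)
  moreover have "ennreal (1 + (c t - c 0)) * ennreal (1 / (1 + (c t - c 0))) = 1"
    using pos by (subst ennreal_mult'[symmetric]) auto
  ultimately show ?thesis by simp
qed

text \<open>Open half-lines are a generating class stable under intersection, and their masses are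
  explicit in finitely many values of the regularized path, which are measurable in the
  parameter.\<close>

lemma capped_stieltjes_kernel:
  assumes [measurable]: "\<And>q. q \<in> \<rat> \<Longrightarrow> 0 \<le> q \<Longrightarrow> (\<lambda>y. c y q) \<in> borel_measurable M" and t: "0 \<le> t"
  shows "(\<lambda>y. capped_stieltjes (regularize (c y)) t) \<in> measurable M (subprob_algebra borel)"
proof (rule measurable_subprob_algebra_generated[where \<Omega>=UNIV and G="range (\<lambda>x. {x<..})"])
  have [measurable]: "(\<lambda>y. regularize (c y) t) \<in> borel_measurable M"
    "(\<lambda>y. regularize (c y) 0) \<in> borel_measurable M"
    "(\<lambda>y. regularize (c y) (max 0 x)) \<in> borel_measurable M" for x
    using t by (auto intro!: borel_measurable_regularize assms(1))
  note c = regularize_cadlag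
  show "sets borel = sigma_sets UNIV (range (\<lambda>x::real. {x<..}))"
    by (subst borel_Ioi) (simp add: sets_measure_of)
  show "Int_stable (range (\<lambda>x::real. {x<..}))" by (auto simp: Int_stable_def lessThan_Int_lessThan)
  show "subprob_space (capped_stieltjes (regularize (c y)) t)" for y
  proof (rule subprob_spaceI)
    have pos: "0 \<le> regularize (c y) t - regularize (c y) 0"
      using c[of "c y"] t by (auto simp: cadlag_increasing_def mono_on_def)
    then show "emeasure (capped_stieltjes (regularize (c y)) t) (space (capped_stieltjes (regularize (c y)) t)) \<le> 1"
      by (simp add: emeasure_capped_stieltjes emeasure_stieltjes_Icc[OF c t] ennreal_mult'[symmetric] ennreal_le_1)
  qed auto
  show "(\<lambda>y. emeasure (capped_stieltjes (regularize (c y)) t) UNIV) \<in> borel_measurable M"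
    using t by (simp add: emeasure_capped_stieltjes emeasure_stieltjes_Icc[OF regularize_cadlag t]) measurable
  fix A assume "A \<in> range (\<lambda>x::real. {x<..})"
  then obtain x where A: "A = {x<..}" by auto
  show "(\<lambda>y. emeasure (capped_stieltjes (regularize (c y)) t) A) \<in> borel_measurable M"
    unfolding A using t by (simp add: emeasure_capped_stieltjes emeasure_stieltjes_greaterThan[OF regularize_cadlag t]) measurable
qed auto

lemma borel_measurable_stieltjes_integral:
  assumes cm: "\<And>q. q \<in> \<rat> \<Longrightarrow> 0 \<le> q \<Longrightarrow> (\<lambda>y. c y q) \<in> borel_measurable M" and t: "0 \<le> t"
    and f: "(\<lambda>(y, s). f y s) \<in> borel_measurable (M \<Otimes>\<^sub>M borel)"
  shows "(\<lambda>y. \<integral>\<^sup>+s\<in>{0..t}. f y s \<partial>stieltjes (regularize (c y))) \<in> borel_measurable M"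
proof -
  have [measurable]: "(\<lambda>y. regularize (c y) s) \<in> borel_measurable M" if "0 \<le> s" for s
    using that by (intro borel_measurable_regularize cm)
  have fy: "f y \<in> borel_measurable borel" if "y \<in> space M" for y
    using measurable_Pair2[OF f that] by simp
  have [measurable]: "(\<lambda>y. \<integral>\<^sup>+s. f y s \<partial>capped_stieltjes (regularize (c y)) t) \<in> borel_measurable M"
    by (rule nn_integral_measurable_subprob_algebra2[OF f capped_stieltjes_kernel[OF cm t]])
  have "(\<lambda>y. ennreal (1 + (regularize (c y) t - regularize (c y) 0)) *
      (\<integral>\<^sup>+s. f y s \<partial>capped_stieltjes (regularize (c y)) t)) \<in> borel_measurable M"
    using t by measurable
  then show ?thesis
    by (subst measurable_cong) (auto simp: nn_integral_capped_stieltjes[OF regularize_cadlag t fy])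
qed

text \<open>Every open half-line is the union of the rational ones inside it, so these already
  generate the Borel sets. Rational end points are used because the occupation formula holds almost
  surely at countably many times simultaneously.\<close>

lemma measure_eqI_rat_greaterThan:
  fixes M N :: "real measure"
  assumes sets: "sets M = sets borel" "sets N = sets borel"
    and fin: "\<And>q. q \<in> \<rat> \<Longrightarrow> emeasure M {q<..} < \<infinity>"
    and eq: "\<And>q. q \<in> \<rat> \<Longrightarrow> emeasure M {q<..} = emeasure N {q<..}"
  shows "M = N"
proof (rule measure_eqI_generator_eq_countable)
  let ?E = "(\<lambda>a::real. {a<..}) ` \<rat>"
  show "Int_stable ?E" by (auto simp: Int_stable_def lessThan_Int_lessThan max_def)
  have "sets borel = sigma_sets UNIV (range (\<lambda>x::real. {x<..}))"
    by (subst borel_Ioi) (simp add: sets_measure_of)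
  also have "\<dots> = sigma_sets UNIV ?E"
  proof (intro equalityI sigma_sets_mono)
    show "range (\<lambda>x::real. {x<..}) \<subseteq> sigma_sets UNIV ?E"
    proof safe
      fix x :: real
      have "{x<..} = (\<Union>q\<in>\<rat> \<inter> {x<..}. {q<..})"
        using Rats_dense_in_real by fastforce
      moreover have "countable ((\<lambda>q. {q<..}) ` (\<rat> \<inter> {x<..}))" using countable_rat by auto
      ultimately show "{x<..} \<in> sigma_sets UNIV ?E"
        using sigma_sets_UNION[of "(\<lambda>q. {q<..}) ` (\<rat> \<inter> {x<..})" UNIV ?E] by (auto intro: sigma_sets.Basic)
    qed
  qed auto
  finally show "sets M = sigma_sets UNIV ?E" "sets N = sigma_sets UNIV ?E" using sets by auto
  show "?E \<subseteq> ?E" "\<Union>?E = UNIV" "\<And>a. a \<in> ?E \<Longrightarrow> emeasure M a \<noteq> \<infinity>"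
    using fin by (auto intro: Rats_no_bot_less simp: less_top)
qed (use eq countable_rat in auto)

text \<open>The right side integrates against the mixture, over Lebesgue measure, of the measures of
  the paths \<open>c a\<close>. It suffices to compare the two measures on rational half-lines,
  where the claim is a difference of two instances of \<open>eq\<close>.\<close>

lemma stieltjes_integral_mixture:
  assumes C: "cadlag_increasing C" "C 0 = 0" and t: "0 \<le> t" "t \<in> \<rat>"
    and cm: "\<And>q. q \<in> \<rat> \<Longrightarrow> 0 \<le> q \<Longrightarrow> (\<lambda>a. c a q) \<in> borel_measurable lborel"
    and c0: "AE a in lborel. regularize (c a) 0 = 0"
    and eq: "\<And>q. q \<in> \<rat> \<Longrightarrow> 0 \<le> q \<Longrightarrow> ennreal (C q) = (\<integral>\<^sup>+a. ennreal (regularize (c a) q) \<partial>lborel)"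
    and f[measurable]: "f \<in> borel_measurable borel"
  shows "(\<integral>\<^sup>+s\<in>{0..t}. f s \<partial>stieltjes C) = (\<integral>\<^sup>+a. (\<integral>\<^sup>+s\<in>{0..t}. f s \<partial>stieltjes (regularize (c a))) \<partial>lborel)"
proof -
  let ?r = "\<lambda>a. regularize (c a)"
  note rc = regularize_cadlag
  have rm[measurable]: "(\<lambda>a. ?r a s) \<in> borel_measurable borel" if "0 \<le> s" for s
    using borel_measurable_regularize[of c lborel s, OF cm that] by simp
  have mono: "?r a x \<le> ?r a y" if "0 \<le> x" "x \<le> y" for a x y
    using rc[of "c a"] that by (auto simp: cadlag_increasing_def mono_on_def)
  have monoC: "C x \<le> C y" if "0 \<le> x" "x \<le> y" for x y
    using C that by (auto simp: cadlag_increasing_def mono_on_def)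
  \<comment> \<open>The density restores the factor by which \<open>capped_stieltjes\<close> was
    divided, so that \<open>D \<bind> K\<close> is the mixture of the uncapped measures.\<close>
  define D where "D = density lborel (\<lambda>a. ennreal (1 + (?r a t - ?r a 0)))"
  define K where "K a = capped_stieltjes (?r a) t" for a
  have DM: "(\<lambda>a. ennreal (1 + (?r a t - ?r a 0))) \<in> borel_measurable lborel"
    using t by measurable
  have Km: "K \<in> measurable lborel (subprob_algebra borel)"
    unfolding K_def by (rule capped_stieltjes_kernel[OF cm t(1)])
  then have KD: "K \<in> measurable D (subprob_algebra borel)" by (simp add: D_def)
  have bind: "(\<integral>\<^sup>+s. g s \<partial>(D \<bind> K)) = (\<integral>\<^sup>+a. (\<integral>\<^sup>+s\<in>{0..t}. g s \<partial>stieltjes (?r a)) \<partial>lborel)"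
    if [measurable]: "g \<in> borel_measurable borel" for g
  proof -
    have [measurable]: "(\<lambda>a. \<integral>\<^sup>+s. g s \<partial>K a) \<in> borel_measurable lborel"
      using Km by measurable
    have "(\<integral>\<^sup>+s. g s \<partial>(D \<bind> K)) = (\<integral>\<^sup>+a. \<integral>\<^sup>+s. g s \<partial>K a \<partial>D)"
      by (rule nn_integral_bind[OF that KD])
    also have "\<dots> = (\<integral>\<^sup>+a. ennreal (1 + (?r a t - ?r a 0)) * (\<integral>\<^sup>+s. g s \<partial>K a) \<partial>lborel)"
      unfolding D_def by (rule nn_integral_density[OF DM]) measurable
    also have "\<dots> = (\<integral>\<^sup>+a. (\<integral>\<^sup>+s\<in>{0..t}. g s \<partial>stieltjes (?r a)) \<partial>lborel)"
      unfolding K_def by (subst nn_integral_capped_stieltjes[OF rc t(1) that]) simp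
    finally show ?thesis .
  qed
  let ?M = "density (stieltjes C) (indicator {0..t})"
  have setsb: "sets (D \<bind> K) = sets borel"
    by (rule sets_bind[where N=borel]) (auto simp: K_def D_def)
  have "?M = D \<bind> K"
  proof (rule measure_eqI_rat_greaterThan)
    fix q :: real assume q: "q \<in> \<rat>"
    \<comment> \<open>Clamping q to \<open>{0..t}\<close> keeps it rational because t is rational,
      so \<open>eq\<close> applies at m.\<close>
    define m where "m = max 0 (min q t)"
    have m: "0 \<le> m" "m \<le> t" "m \<in> \<rat>" using t q by (auto simp: m_def max_def min_def)
    have "emeasure ?M {q<..} = emeasure (stieltjes C) ({q<..} \<inter> {0..t})"
      by (subst emeasure_density) (auto simp: nn_integral_indicator[symmetric] simp del: nn_integral_indicator intro!: nn_integral_cong split: split_indicator)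
    also have "\<dots> = ennreal (C t - C m)"
      unfolding m_def by (rule emeasure_stieltjes_greaterThan[OF C(1) t(1)])
    finally have 1: "emeasure ?M {q<..} = ennreal (C t - C m)" .
    then show "emeasure ?M {q<..} < \<infinity>" by simp
    have "emeasure (D \<bind> K) {q<..} = (\<integral>\<^sup>+s. indicator {q<..} s \<partial>(D \<bind> K))"
      using setsb by simp
    also have "\<dots> = (\<integral>\<^sup>+a. ennreal (?r a t - ?r a m) \<partial>lborel)"
    proof (subst bind)
      have "(\<integral>\<^sup>+s\<in>{0..t}. indicator {q<..} s \<partial>stieltjes (?r a)) = ennreal (?r a t - ?r a m)" for a
      proof -
        have "(\<integral>\<^sup>+s\<in>{0..t}. indicator {q<..} s \<partial>stieltjes (?r a)) = (\<integral>\<^sup>+s. indicator ({q<..} \<inter> {0..t}) s \<partial>stieltjes (?r a))"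
          by (intro nn_integral_cong) (auto split: split_indicator)
        then show ?thesis unfolding m_def using emeasure_stieltjes_greaterThan[OF rc[of "c a"] t(1)] by simp
      qed
      then show "(\<integral>\<^sup>+a. (\<integral>\<^sup>+s\<in>{0..t}. indicator {q<..} s \<partial>stieltjes (?r a)) \<partial>lborel) = (\<integral>\<^sup>+a. ennreal (?r a t - ?r a m) \<partial>lborel)"
        by simp
    qed measurable
    also have "\<dots> = (\<integral>\<^sup>+a. ennreal (?r a t) - ennreal (?r a m) \<partial>lborel)"
    proof (intro nn_integral_cong_AE, use c0 in eventually_elim)
      fix a assume "regularize (c a) 0 = 0"
      then have "0 \<le> ?r a m" using mono[of 0 m a] m by simp
      then show "ennreal (?r a t - ?r a m) = ennreal (?r a t) - ennreal (?r a m)" by (simp add: ennreal_minus)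
    qed
    also have "\<dots> = (\<integral>\<^sup>+a. ennreal (?r a t) \<partial>lborel) - (\<integral>\<^sup>+a. ennreal (?r a m) \<partial>lborel)"
    proof (rule nn_integral_diff)
      show "AE a in lborel. ennreal (?r a m) \<le> ennreal (?r a t)" using mono[OF m(1,2)] by (simp add: ennreal_leI)
      show "(\<integral>\<^sup>+a. ennreal (?r a m) \<partial>lborel) \<noteq> \<infinity>" using eq[OF m(3,1)] by (metis ennreal_neq_top infinity_ennreal_def)
    qed (use t m in measurable)
    also have "\<dots> = ennreal (C t) - ennreal (C m)" using eq m t by simp
    also have "\<dots> = ennreal (C t - C m)" using monoC[of 0 m] C(2) m by (simp add: ennreal_minus)
    finally show "emeasure ?M {q<..} = emeasure (D \<bind> K) {q<..}" using 1 by simp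
  qed (use setsb in auto)
  then have "(\<integral>\<^sup>+s. f s \<partial>?M) = (\<integral>\<^sup>+a. (\<integral>\<^sup>+s\<in>{0..t}. f s \<partial>stieltjes (?r a)) \<partial>lborel)" using bind[OF f] by simp
  moreover have "(\<integral>\<^sup>+s. f s \<partial>?M) = (\<integral>\<^sup>+s\<in>{0..t}. f s \<partial>stieltjes C)"
    by (subst nn_integral_density) (auto intro!: nn_integral_cong simp: mult.commute)
  ultimately show ?thesis by simp
qed

section \<open>Martingales stopped along grids\<close>

locale filtered_prob_space = prob_space p for p :: "'w measure" +
  fixes F :: "real \<Rightarrow> 'w measure"
  assumes space_F: "\<And>t. 0 \<le> t \<Longrightarrow> space (F t) = space p"
    and sets_F: "\<And>t. 0 \<le> t \<Longrightarrow> sets (F t) \<subseteq> sets p"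
    and mono_F: "\<And>s t. 0 \<le> s \<Longrightarrow> s \<le> t \<Longrightarrow> sets (F s) \<subseteq> sets (F t)"
begin

text \<open>Testing against sets of \<open>F s\<close> instead of forming conditional expectations
  makes the property linear and insensitive to null sets. It therefore passes easily from the
  canonical filtration to the augmented one, and it splits over the values of a discrete
  time.\<close>

definition mart :: "(real \<Rightarrow> 'w \<Rightarrow> real) \<Rightarrow> bool" where
  "mart U \<longleftrightarrow> (\<forall>t\<ge>0. U t \<in> borel_measurable (F t) \<and> integrable p (U t)) \<and>
    (\<forall>s t \<Lambda>. 0 \<le> s \<and> s \<le> t \<and> \<Lambda> \<in> sets (F s) \<longrightarrow>
      (\<integral>\<omega>. indicator \<Lambda> \<omega> * U s \<omega> \<partial>p) = (\<integral>\<omega>. indicator \<Lambda> \<omega> * U t \<omega> \<partial>p))"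

lemma measurable_F: "0 \<le> t \<Longrightarrow> f \<in> measurable (F t) N \<Longrightarrow> f \<in> measurable p N"
  using space_F[of t] sets_F[of t] by (auto simp: measurable_def)

lemma mart_diff:
  assumes "mart U" "mart V" shows "mart (\<lambda>t \<omega>. U t \<omega> - V t \<omega>)"
proof -
  have *: "integrable p (\<lambda>\<omega>. indicator \<Lambda> \<omega> * W t \<omega>)"
    if "mart W" "0 \<le> s" "s \<le> t" "\<Lambda> \<in> sets (F s)" for W s t \<Lambda>
    using that sets_F[of s] integrable_mult_indicator[of \<Lambda> p "W t"] by (auto simp: mart_def)
  show ?thesis
    using assms *[OF assms(1)] *[OF assms(2)] by (auto simp: mart_def right_diff_distrib intro!: borel_measurable_diff)
qed

lemma mart_uminus: "mart U \<Longrightarrow> mart (\<lambda>t \<omega>. - U t \<omega>)"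
  by (auto simp: mart_def)

text \<open>
  The function \<open>max 0 (\<bar>x\<bar> - K)\<close> is convex; its expectations replace uniform integrability below.
\<close>

lemma mart_excess:
  assumes U: "mart U" and st: "0 \<le> s" "s \<le> t" and \<Lambda>: "\<Lambda> \<in> sets (F s)" and K: "0 \<le> K"
  shows "(\<integral>\<omega>. indicator \<Lambda> \<omega> * max 0 (\<bar>U s \<omega>\<bar> - K) \<partial>p)
    \<le> (\<integral>\<omega>. indicator \<Lambda> \<omega> * max 0 (\<bar>U t \<omega>\<bar> - K) \<partial>p)"
proof -
  have t: "0 \<le> t" using st by simp
  have [measurable]: "U s \<in> borel_measurable (F s)" and int: "integrable p (U s)" "integrable p (U t)"
    using U st t by (auto simp: mart_def)
  have [measurable]: "\<Lambda> \<in> sets (F s)" by fact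
  \<comment> \<open>On A and B the excess of \<open>U s\<close> is the linear expression
    \<open>U s - K\<close> or \<open>- U s - K\<close>, whose integral is the same at time t by the
    martingale property. At time t these expressions are lower bounds for the excess.\<close>
  define A where "A = {\<omega>\<in>space (F s). \<omega> \<in> \<Lambda> \<and> K < U s \<omega>}"
  define B where "B = {\<omega>\<in>space (F s). \<omega> \<in> \<Lambda> \<and> U s \<omega> < - K}"
  have AB: "A \<in> sets (F s)" "B \<in> sets (F s)" unfolding A_def B_def by measurable
  then have ABp: "A \<in> sets p" "B \<in> sets p" "\<Lambda> \<in> sets p" using sets_F[OF st(1)] \<Lambda> by auto
  have sub: "\<Lambda> \<subseteq> space (F s)" using sets.sets_into_space[OF \<Lambda>] .
  have I: "integrable p (\<lambda>\<omega>. indicator C \<omega> * f \<omega>)"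
    if "C \<in> sets p" "integrable p f" for C and f :: "'w \<Rightarrow> real"
    using that integrable_mult_indicator[of C p f] by simp
  have I1: "integrable p (\<lambda>\<omega>. indicator C \<omega> * K)" if "C \<in> sets p" for C
    using that integrable_mult_indicator[of C p "\<lambda>_. K"] by simp
  have Ie: "integrable p (\<lambda>\<omega>. indicator C \<omega> * max 0 (\<bar>U r \<omega>\<bar> - K))"
    if "C \<in> sets p" "integrable p (U r)" for C r
    using that integrable_mult_indicator[of C p "\<lambda>\<omega>. max 0 (\<bar>U r \<omega>\<bar> - K)"] by simp
  have "(\<integral>\<omega>. indicator \<Lambda> \<omega> * max 0 (\<bar>U s \<omega>\<bar> - K) \<partial>p)
    = (\<integral>\<omega>. (indicator A \<omega> * U s \<omega> - indicator A \<omega> * K) + (- (indicator B \<omega> * U s \<omega>) - indicator B \<omega> * K) \<partial>p)"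
    using sub K by (intro Bochner_Integration.integral_cong) (auto simp: A_def B_def indicator_def max_def)
  also have "\<dots> = (\<integral>\<omega>. indicator A \<omega> * U s \<omega> \<partial>p) - (\<integral>\<omega>. indicator A \<omega> * K \<partial>p)
     + (- (\<integral>\<omega>. indicator B \<omega> * U s \<omega> \<partial>p) - (\<integral>\<omega>. indicator B \<omega> * K \<partial>p))"
    using I[OF ABp(1) int(1)] I[OF ABp(2) int(1)] I1[OF ABp(1)] I1[OF ABp(2)] by simp
  also have "\<dots> = (\<integral>\<omega>. indicator A \<omega> * U t \<omega> \<partial>p) - (\<integral>\<omega>. indicator A \<omega> * K \<partial>p)
     + (- (\<integral>\<omega>. indicator B \<omega> * U t \<omega> \<partial>p) - (\<integral>\<omega>. indicator B \<omega> * K \<partial>p))"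
    using U st AB by (simp add: mart_def)
  also have "\<dots> = (\<integral>\<omega>. (indicator A \<omega> * U t \<omega> - indicator A \<omega> * K) + (- (indicator B \<omega> * U t \<omega>) - indicator B \<omega> * K) \<partial>p)"
    using I[OF ABp(1) int(2)] I[OF ABp(2) int(2)] I1[OF ABp(1)] I1[OF ABp(2)] by simp
  also have "\<dots> \<le> (\<integral>\<omega>. indicator \<Lambda> \<omega> * max 0 (\<bar>U t \<omega>\<bar> - K) \<partial>p)"
    using I[OF ABp(1) int(2)] I[OF ABp(2) int(2)] I1[OF ABp(1)] I1[OF ABp(2)] Ie[OF ABp(3) int(2)]
    using K by (intro integral_mono) (auto simp: A_def B_def indicator_def)
  finally show ?thesis .
qed

text \<open>Optional stopping for a time with finitely many values: the space splits along these
  values, and on each piece \<open>U g\<close> may be replaced by \<open>U t\<close>. The bound on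
  the excess is the same for all such times, and this uniformity is what survives in the
  limit.\<close>

lemma mart_discrete_time:
  assumes U: "mart U" and G: "finite G" "\<And>g. g \<in> G \<Longrightarrow> 0 \<le> g \<and> g \<le> t"
    and \<sigma>: "\<And>\<omega>. \<omega> \<in> space p \<Longrightarrow> \<sigma> \<omega> \<in> G" "\<And>g. g \<in> G \<Longrightarrow> {\<omega>\<in>space p. \<sigma> \<omega> = g} \<in> sets (F g)"
    and t: "0 \<le> t"
  shows "integrable p (\<lambda>\<omega>. U (\<sigma> \<omega>) \<omega>)"
    and "(\<integral>\<omega>. U (\<sigma> \<omega>) \<omega> \<partial>p) = (\<integral>\<omega>. U t \<omega> \<partial>p)"
    and "0 \<le> K \<Longrightarrow> (\<integral>\<omega>. max 0 (\<bar>U (\<sigma> \<omega>) \<omega>\<bar> - K) \<partial>p) \<le> (\<integral>\<omega>. max 0 (\<bar>U t \<omega>\<bar> - K) \<partial>p)"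
proof -
  define S where "S g = {\<omega>\<in>space p. \<sigma> \<omega> = g}" for g
  have S: "S g \<in> sets (F g)" "S g \<in> sets p" if "g \<in> G" for g
    using \<sigma>(2)[OF that] sets_F[of g] G(2)[OF that] by (auto simp: S_def)
  have sum: "f (\<sigma> \<omega>) \<omega> = (\<Sum>g\<in>G. indicator (S g) \<omega> * f g \<omega>)" if "\<omega> \<in> space p" for f :: "real \<Rightarrow> 'w \<Rightarrow> real" and \<omega>
  proof -
    have "(\<Sum>g\<in>G. indicator (S g) \<omega> * f g \<omega>) = (\<Sum>g\<in>G. if g = \<sigma> \<omega> then f g \<omega> else 0)"
      using that by (intro sum.cong) (auto simp: S_def indicator_def)
    then show ?thesis using G(1) \<sigma>(1)[OF that] by simp
  qed
  have int: "integrable p (U g)" if "g \<in> G \<or> g = t" for g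
    using U G(2) that t by (auto simp: mart_def)
  have I: "integrable p (\<lambda>\<omega>. indicator (S g) \<omega> * f \<omega>)" if "g \<in> G" "integrable p f" for g and f :: "'w \<Rightarrow> real"
    using that S integrable_mult_indicator[of "S g" p f] by simp
  show "integrable p (\<lambda>\<omega>. U (\<sigma> \<omega>) \<omega>)"
    using I int by (subst Bochner_Integration.integrable_cong[OF refl sum[of _ U]]) auto
  have "(\<integral>\<omega>. U (\<sigma> \<omega>) \<omega> \<partial>p) = (\<integral>\<omega>. (\<Sum>g\<in>G. indicator (S g) \<omega> * U g \<omega>) \<partial>p)"
    using sum[of _ U] by (intro Bochner_Integration.integral_cong) auto
  also have "\<dots> = (\<Sum>g\<in>G. \<integral>\<omega>. indicator (S g) \<omega> * U g \<omega> \<partial>p)"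
    using I int by (intro Bochner_Integration.integral_sum) auto
  also have "\<dots> = (\<Sum>g\<in>G. \<integral>\<omega>. indicator (S g) \<omega> * U t \<omega> \<partial>p)"
    using U G(2) S by (intro sum.cong) (auto simp: mart_def)
  also have "\<dots> = (\<integral>\<omega>. (\<Sum>g\<in>G. indicator (S g) \<omega> * U t \<omega>) \<partial>p)"
    using I int by (intro Bochner_Integration.integral_sum[symmetric]) auto
  also have "\<dots> = (\<integral>\<omega>. U t \<omega> \<partial>p)"
    using sum[of _ "\<lambda>_. U t"] by (intro Bochner_Integration.integral_cong) auto
  finally show "(\<integral>\<omega>. U (\<sigma> \<omega>) \<omega> \<partial>p) = (\<integral>\<omega>. U t \<omega> \<partial>p)" .
  assume K: "0 \<le> K"
  let ?e = "\<lambda>g \<omega>. max 0 (\<bar>U g \<omega>\<bar> - K)"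
  have inte: "integrable p (?e g)" if "g \<in> G \<or> g = t" for g
    using int[OF that] by simp
  have "(\<integral>\<omega>. ?e (\<sigma> \<omega>) \<omega> \<partial>p) = (\<integral>\<omega>. (\<Sum>g\<in>G. indicator (S g) \<omega> * ?e g \<omega>) \<partial>p)"
    using sum[of _ ?e] by (intro Bochner_Integration.integral_cong) auto
  also have "\<dots> = (\<Sum>g\<in>G. \<integral>\<omega>. indicator (S g) \<omega> * ?e g \<omega> \<partial>p)"
    by (intro Bochner_Integration.integral_sum I inte) auto
  also have "\<dots> \<le> (\<Sum>g\<in>G. \<integral>\<omega>. indicator (S g) \<omega> * ?e t \<omega> \<partial>p)"
    using G(2) S K by (intro sum_mono mart_excess[OF U]) auto
  also have "\<dots> = (\<integral>\<omega>. (\<Sum>g\<in>G. indicator (S g) \<omega> * ?e t \<omega>) \<partial>p)"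
    by (intro Bochner_Integration.integral_sum[symmetric] I inte) auto
  also have "\<dots> = (\<integral>\<omega>. ?e t \<omega> \<partial>p)"
    using sum[of _ "\<lambda>_. ?e t"] by (intro Bochner_Integration.integral_cong) auto
  finally show "(\<integral>\<omega>. ?e (\<sigma> \<omega>) \<omega> \<partial>p) \<le> (\<integral>\<omega>. ?e t \<omega> \<partial>p)" .
qed

text \<open>Almost sure convergence of stopped values does not by itself give convergence of
  expectations. Uniform integrability is supplied by the excess of \<open>U t\<close> over K, which
  bounds the truncation error of all stopped values at once and vanishes in mean as K grows.\<close>

lemma mart_limit_time:
  fixes \<sigma> :: "nat \<Rightarrow> 'w \<Rightarrow> real"
  assumes U: "mart U" and t: "0 \<le> t"
    and G: "\<And>k. finite (G k)" "\<And>k g. g \<in> G k \<Longrightarrow> 0 \<le> g \<and> g \<le> t"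
    and \<sigma>: "\<And>k \<omega>. \<omega> \<in> space p \<Longrightarrow> \<sigma> k \<omega> \<in> G k"
      "\<And>k g. g \<in> G k \<Longrightarrow> {\<omega>\<in>space p. \<sigma> k \<omega> = g} \<in> sets (F g)"
    and V[measurable]: "V \<in> borel_measurable p"
    and lim: "AE \<omega> in p. (\<lambda>k. U (\<sigma> k \<omega>) \<omega>) \<longlonglongrightarrow> V \<omega>"
  shows "integrable p V" and "(\<integral>\<omega>. V \<omega> \<partial>p) = (\<integral>\<omega>. U t \<omega> \<partial>p)"
proof -
  let ?g = "\<lambda>k \<omega>. U (\<sigma> k \<omega>) \<omega>"
  have D: "integrable p (?g k)" "(\<integral>\<omega>. ?g k \<omega> \<partial>p) = (\<integral>\<omega>. U t \<omega> \<partial>p)"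
    "0 \<le> K \<Longrightarrow> (\<integral>\<omega>. max 0 (\<bar>?g k \<omega>\<bar> - K) \<partial>p) \<le> (\<integral>\<omega>. max 0 (\<bar>U t \<omega>\<bar> - K) \<partial>p)" for k K
    using mart_discrete_time[OF U G(1)[of k] G(2)[of _ k] \<sigma>(1)[of _ k] \<sigma>(2)[of _ k] t] by auto
  have Ut: "integrable p (U t)" using U t by (auto simp: mart_def)
  have gm[measurable]: "?g k \<in> borel_measurable p" for k using D(1)[of k] by auto
  \<comment> \<open>Fatou's lemma together with the excess bound for K = 0 gives integrability of
    the limit.\<close>
  have "(\<integral>\<^sup>+\<omega>. ennreal \<bar>V \<omega>\<bar> \<partial>p) = (\<integral>\<^sup>+\<omega>. liminf (\<lambda>k. ennreal \<bar>?g k \<omega>\<bar>) \<partial>p)"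
  proof (rule nn_integral_cong_AE, use lim in eventually_elim)
    fix \<omega> assume "(\<lambda>k. ?g k \<omega>) \<longlonglongrightarrow> V \<omega>"
    then have "(\<lambda>k. ennreal \<bar>?g k \<omega>\<bar>) \<longlonglongrightarrow> ennreal \<bar>V \<omega>\<bar>"
      by (intro tendsto_ennrealI tendsto_rabs)
    then show "ennreal \<bar>V \<omega>\<bar> = liminf (\<lambda>k. ennreal \<bar>?g k \<omega>\<bar>)"
      using lim_imp_Liminf trivial_limit_sequentially by metis
  qed
  also have "\<dots> \<le> liminf (\<lambda>k. \<integral>\<^sup>+\<omega>. ennreal \<bar>?g k \<omega>\<bar> \<partial>p)"
    by (rule nn_integral_liminf) auto
  also have "\<dots> \<le> (\<integral>\<^sup>+\<omega>. ennreal \<bar>U t \<omega>\<bar> \<partial>p)"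
  proof -
    have "(\<integral>\<^sup>+\<omega>. ennreal \<bar>?g k \<omega>\<bar> \<partial>p) \<le> (\<integral>\<^sup>+\<omega>. ennreal \<bar>U t \<omega>\<bar> \<partial>p)" for k
      using D(3)[of 0 k] Ut D(1)[of k] by (simp add: nn_integral_eq_integral)
    then show ?thesis by (intro Liminf_le) auto
  qed
  also have "\<dots> < \<infinity>" using Ut by (simp add: integrable_iff_bounded)
  finally show intV: "integrable p V" by (simp add: integrable_iff_bounded)
  \<comment> \<open>Truncation to \<open>{-K..K}\<close>: it is bounded, so dominated convergence
    applies, and its error \<open>\<bar>\<phi> K x - x\<bar>\<close> is exactly the excess of x over
    K.\<close>
  define \<phi> where "\<phi> K x = max (- K) (min K x)" for K x :: real
  have \<phi>m[measurable]: "\<phi> K \<in> borel_measurable borel" for K unfolding \<phi>_def[abs_def] by measurable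
  have b: "\<bar>(\<integral>\<omega>. \<phi> K (V \<omega>) \<partial>p) - (\<integral>\<omega>. U t \<omega> \<partial>p)\<bar> \<le> (\<integral>\<omega>. max 0 (\<bar>U t \<omega>\<bar> - K) \<partial>p)" if K: "0 \<le> K" for K
  proof (rule LIMSEQ_le_const2)
    have "(\<lambda>k. \<integral>\<omega>. \<phi> K (?g k \<omega>) \<partial>p) \<longlonglongrightarrow> (\<integral>\<omega>. \<phi> K (V \<omega>) \<partial>p)"
    proof (rule integral_dominated_convergence[where w="\<lambda>_. K"])
      show "AE \<omega> in p. (\<lambda>k. \<phi> K (?g k \<omega>)) \<longlonglongrightarrow> \<phi> K (V \<omega>)"
        using lim by eventually_elim (auto simp: \<phi>_def intro!: tendsto_intros)
    qed (use K in \<open>auto simp: \<phi>_def\<close>)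
    then show "(\<lambda>k. \<bar>(\<integral>\<omega>. \<phi> K (?g k \<omega>) \<partial>p) - (\<integral>\<omega>. U t \<omega> \<partial>p)\<bar>) \<longlonglongrightarrow> \<bar>(\<integral>\<omega>. \<phi> K (V \<omega>) \<partial>p) - (\<integral>\<omega>. U t \<omega> \<partial>p)\<bar>"
      by (intro tendsto_intros)
    have "\<bar>(\<integral>\<omega>. \<phi> K (?g k \<omega>) \<partial>p) - (\<integral>\<omega>. U t \<omega> \<partial>p)\<bar> \<le> (\<integral>\<omega>. max 0 (\<bar>U t \<omega>\<bar> - K) \<partial>p)" for k
    proof -
      have i: "integrable p (\<lambda>\<omega>. \<phi> K (?g k \<omega>))"
        by (rule Bochner_Integration.integrable_bound[OF D(1)[of k]]) (use K in \<open>auto simp: \<phi>_def\<close>)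
      have "\<bar>(\<integral>\<omega>. \<phi> K (?g k \<omega>) \<partial>p) - (\<integral>\<omega>. U t \<omega> \<partial>p)\<bar> = \<bar>\<integral>\<omega>. \<phi> K (?g k \<omega>) - ?g k \<omega> \<partial>p\<bar>"
        using i D(1)[of k] D(2)[of k] by simp
      also have "\<dots> \<le> (\<integral>\<omega>. \<bar>\<phi> K (?g k \<omega>) - ?g k \<omega>\<bar> \<partial>p)" by (rule integral_abs_bound)
      also have "\<dots> = (\<integral>\<omega>. max 0 (\<bar>?g k \<omega>\<bar> - K) \<partial>p)"
        using K by (intro Bochner_Integration.integral_cong) (auto simp: \<phi>_def)
      also have "\<dots> \<le> (\<integral>\<omega>. max 0 (\<bar>U t \<omega>\<bar> - K) \<partial>p)" by (rule D(3)[OF K])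
      finally show ?thesis .
    qed
    then show "\<exists>N. \<forall>n\<ge>N. \<bar>(\<integral>\<omega>. \<phi> K (?g n \<omega>) \<partial>p) - (\<integral>\<omega>. U t \<omega> \<partial>p)\<bar> \<le> (\<integral>\<omega>. max 0 (\<bar>U t \<omega>\<bar> - K) \<partial>p)" by blast
  qed
  have ev: "eventually (\<lambda>n. \<phi> (real n) x = x) sequentially" "eventually (\<lambda>n. max 0 (\<bar>x\<bar> - real n) = 0) sequentially" for x
    using eventually_ge_at_top[of "nat \<lceil>\<bar>x\<bar>\<rceil>"] by (eventually_elim; simp add: \<phi>_def; linarith)+
  have "(\<lambda>n. \<integral>\<omega>. \<phi> (real n) (V \<omega>) \<partial>p) \<longlonglongrightarrow> (\<integral>\<omega>. V \<omega> \<partial>p)"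
    by (rule integral_dominated_convergence[where w="\<lambda>\<omega>. \<bar>V \<omega>\<bar>"])
      (use intV ev(1) in \<open>auto simp: \<phi>_def intro!: tendsto_eventually\<close>)
  then have "(\<lambda>n. \<bar>(\<integral>\<omega>. \<phi> (real n) (V \<omega>) \<partial>p) - (\<integral>\<omega>. U t \<omega> \<partial>p)\<bar>) \<longlonglongrightarrow> \<bar>(\<integral>\<omega>. V \<omega> \<partial>p) - (\<integral>\<omega>. U t \<omega> \<partial>p)\<bar>"
    by (intro tendsto_intros)
  moreover have "(\<lambda>n. \<integral>\<omega>. max 0 (\<bar>U t \<omega>\<bar> - real n) \<partial>p) \<longlonglongrightarrow> (\<integral>\<omega>. 0 \<partial>p)"
    by (rule integral_dominated_convergence[where w="\<lambda>\<omega>. \<bar>U t \<omega>\<bar>"])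
      (use Ut ev(2) in \<open>auto intro!: tendsto_eventually\<close>)
  ultimately have "\<bar>(\<integral>\<omega>. V \<omega> \<partial>p) - (\<integral>\<omega>. U t \<omega> \<partial>p)\<bar> \<le> (\<integral>\<omega>. 0 \<partial>p)"
    by (rule LIMSEQ_le) (auto intro!: exI[of _ 0] b)
  then show "(\<integral>\<omega>. V \<omega> \<partial>p) = (\<integral>\<omega>. U t \<omega> \<partial>p)" by simp
qed

text \<open>Optional stopping gives U the same expectation at \<tau> and at s, and an almost sure
  inequality between integrable variables of equal expectation is an equality. The stopping property
  is used for finite approximations of \<tau> only.\<close>

lemma mart_one_sided_at_hitting:
  assumes U: "mart U" and cont: "AE \<omega> in p. continuous_on {0..} (\<lambda>t. U t \<omega>)"
    and st: "0 \<le> s" "s < t"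
    and Bad: "\<And>g. g \<in> \<rat> \<Longrightarrow> s \<le> g \<Longrightarrow> g < t \<Longrightarrow> {\<omega>\<in>space p. Bad g \<omega>} \<in> sets (F g)"
    and \<tau>: "\<And>\<omega>. \<tau> \<omega> = Inf (insert t {g\<in>\<rat>. s \<le> g \<and> g < t \<and> Bad g \<omega>})"
    and le: "AE \<omega> in p. U (\<tau> \<omega>) \<omega> \<le> U s \<omega>"
  shows "AE \<omega> in p. U (\<tau> \<omega>) \<omega> = U s \<omega>"
proof -
  define R where "R = \<rat> \<inter> {s..<t}"
  have "countable R" unfolding R_def using countable_rat by blast
  have "R \<noteq> {}" using Rats_dense_in_real[OF st(2)] by (auto simp: R_def)
  define e where "e = from_nat_into R"
  have e: "range e = R" using \<open>countable R\<close> \<open>R \<noteq> {}\<close> by (simp add: e_def)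
  define G where "G k = insert t (e ` {..<k})" for k
  \<comment> \<open>The first bad time among the first k rationals of an enumeration, or t if there
    is none; as k grows it decreases to \<tau>.\<close>
  define \<sigma> where "\<sigma> k \<omega> = Min (insert t {g\<in>e ` {..<k}. Bad g \<omega>})" for k \<omega>
  have eR: "e i \<in> R" for i using e by auto
  have G: "finite (G k)" "g \<in> G k \<Longrightarrow> 0 \<le> g \<and> g \<le> t" for k g
    using eR st by (auto simp: G_def R_def intro: order_trans less_imp_le)
  have fin: "finite (insert t {g\<in>e ` {..<k}. Bad g \<omega>})" for k \<omega> by simp
  have \<sigma>G: "\<sigma> k \<omega> \<in> G k" for k \<omega>
    using Min_in[OF fin[of k \<omega>]] by (auto simp: \<sigma>_def G_def)
  have \<sigma>F: "{\<omega>\<in>space p. \<sigma> k \<omega> = g} \<in> sets (F g)" if g: "g \<in> G k" for k g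
  proof -
    have g0: "0 \<le> g" using G(2)[OF g] by simp
    have *: "{\<omega>\<in>space p. Bad h \<omega>} \<in> sets (F g)" if "h \<in> e ` {..<k}" "h \<le> g" for h
    proof -
      have "h \<in> \<rat>" "s \<le> h" "h < t" "0 \<le> h" using that(1) eR st by (auto simp: R_def intro: order_trans)
      then show ?thesis using Bad[of h] mono_F[of h g] that(2) by auto
    qed
    \<comment> \<open>The event depends on what happens at grid points up to g only: g is bad or
      equal to t, and no earlier grid point is bad.\<close>
    have "\<sigma> k \<omega> = g \<longleftrightarrow> (g = t \<or> Bad g \<omega>) \<and> (\<forall>h\<in>e ` {..<k}. h < g \<longrightarrow> \<not> Bad h \<omega>)" for \<omega>
    proof -
      have "\<sigma> k \<omega> = g \<longleftrightarrow> g \<in> insert t {g\<in>e ` {..<k}. Bad g \<omega>} \<and> (\<forall>h\<in>insert t {g\<in>e ` {..<k}. Bad g \<omega>}. g \<le> h)"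
        unfolding \<sigma>_def using Min_eq_iff[OF fin] by simp
      also have "\<dots> \<longleftrightarrow> (g = t \<or> Bad g \<omega>) \<and> (\<forall>h\<in>e ` {..<k}. h < g \<longrightarrow> \<not> Bad h \<omega>)"
        using g G(2)[OF g] by (auto simp: G_def not_le[symmetric])
      finally show ?thesis .
    qed
    then have "{\<omega>\<in>space p. \<sigma> k \<omega> = g} = {\<omega>\<in>space p. g = t \<or> Bad g \<omega>} - (\<Union>h\<in>{h\<in>e ` {..<k}. h < g}. {\<omega>\<in>space p. Bad h \<omega>})"
      by auto
    moreover have "{\<omega>\<in>space p. g = t \<or> Bad g \<omega>} \<in> sets (F g)"
    proof (cases "g = t")
      case True
      then have "{\<omega>\<in>space p. g = t \<or> Bad g \<omega>} = space (F g)" using space_F[OF g0] by auto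
      then show ?thesis by simp
    next
      case False
      then show ?thesis using *[of g] g by (auto simp: G_def)
    qed
    moreover have "(\<Union>h\<in>{h\<in>e ` {..<k}. h < g}. {\<omega>\<in>space p. Bad h \<omega>}) \<in> sets (F g)"
      using * by (intro sets.finite_UN) auto
    ultimately show ?thesis by (simp only: sets.Diff)
  qed
  have bdd: "bdd_below (insert t {g\<in>\<rat>. s \<le> g \<and> g < t \<and> Bad g \<omega>})" for \<omega>
    by (rule bdd_belowI[of _ s]) (use st in auto)
  have lim: "(\<lambda>k. \<sigma> k \<omega>) \<longlonglongrightarrow> \<tau> \<omega>" for \<omega>
  proof (rule order_tendstoI)
    fix a assume "a < \<tau> \<omega>"
    moreover have "\<tau> \<omega> \<le> \<sigma> k \<omega>" for k
    proof -
      have "\<sigma> k \<omega> \<in> insert t {g\<in>e ` {..<k}. Bad g \<omega>}" unfolding \<sigma>_def by (rule Min_in) auto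
      then have "\<sigma> k \<omega> \<in> insert t {g\<in>\<rat>. s \<le> g \<and> g < t \<and> Bad g \<omega>}" using eR by (auto simp: R_def)
      then show ?thesis unfolding \<tau> by (rule cInf_lower[OF _ bdd])
    qed
    ultimately show "eventually (\<lambda>k. a < \<sigma> k \<omega>) sequentially" by (intro always_eventually allI) (metis less_le_trans)
  next
    fix a assume "\<tau> \<omega> < a"
    then obtain g where g: "g \<in> insert t {g\<in>\<rat>. s \<le> g \<and> g < t \<and> Bad g \<omega>}" "g < a"
      unfolding \<tau> by (subst (asm) cInf_less_iff[OF _ bdd]) auto
    obtain n where n: "g = t \<or> (g = e n \<and> Bad g \<omega>)"
      using g(1) e by (auto simp: R_def image_iff set_eq_iff)
    have le: "\<sigma> k \<omega> \<le> g" if "k > n" for k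
      unfolding \<sigma>_def using n that by (intro Min_le) auto
    show "eventually (\<lambda>k. \<sigma> k \<omega> < a) sequentially"
      using eventually_gt_at_top[of n] by eventually_elim (rule le_less_trans[OF le g(2)])
  qed
  have \<tau>st: "s \<le> \<tau> \<omega>" "\<tau> \<omega> \<le> t" for \<omega>
    unfolding \<tau> using st bdd by (auto intro!: cInf_greatest cInf_lower)
  have t0: "0 \<le> t" using st by simp
  \<comment> \<open>\<open>U (\<tau> \<omega>) \<omega>\<close> is not known to be measurable in
    \<omega>; the limit of the stopped values is, and the two agree almost surely.\<close>
  define V where "V \<omega> = lim (\<lambda>k. U (\<sigma> k \<omega>) \<omega>)" for \<omega>
  have [measurable]: "(\<lambda>\<omega>. U (\<sigma> k \<omega>) \<omega>) \<in> borel_measurable p" for k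
    using mart_discrete_time(1)[OF U G(1)[of k] G(2)[of _ k] \<sigma>G \<sigma>F t0] by auto
  have Vm: "V \<in> borel_measurable p" unfolding V_def[abs_def] by measurable
  have Ulim: "AE \<omega> in p. (\<lambda>k. U (\<sigma> k \<omega>) \<omega>) \<longlonglongrightarrow> U (\<tau> \<omega>) \<omega>"
    using cont
  proof eventually_elim
    fix \<omega> assume "continuous_on {0..} (\<lambda>t. U t \<omega>)"
    moreover have "\<sigma> k \<omega> \<in> {0..}" for k using G(2)[OF \<sigma>G[of k \<omega>]] by auto
    moreover have "\<tau> \<omega> \<in> {0..}" using \<tau>st(1)[of \<omega>] st by auto
    ultimately show "(\<lambda>k. U (\<sigma> k \<omega>) \<omega>) \<longlonglongrightarrow> U (\<tau> \<omega>) \<omega>"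
      using lim[of \<omega>] by (auto simp: continuous_on_sequentially comp_def)
  qed
  then have VU: "AE \<omega> in p. V \<omega> = U (\<tau> \<omega>) \<omega>"
    by eventually_elim (auto simp: V_def dest: limI)
  have Vlim: "AE \<omega> in p. (\<lambda>k. U (\<sigma> k \<omega>) \<omega>) \<longlonglongrightarrow> V \<omega>"
    using Ulim VU by eventually_elim simp
  note L = mart_limit_time[OF U t0 G \<sigma>G \<sigma>F Vm Vlim]
  have "(\<integral>\<omega>. V \<omega> \<partial>p) = (\<integral>\<omega>. U t \<omega> \<partial>p)" using L(2) by simp
  also have "\<dots> = (\<integral>\<omega>. indicator (space p) \<omega> * U t \<omega> \<partial>p)" by (intro Bochner_Integration.integral_cong) auto
  also have "\<dots> = (\<integral>\<omega>. indicator (space p) \<omega> * U s \<omega> \<partial>p)"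
    using U st sets.top[of "F s"] space_F[of s] unfolding mart_def by (metis less_imp_le)
  also have "\<dots> = (\<integral>\<omega>. U s \<omega> \<partial>p)" by (intro Bochner_Integration.integral_cong) auto
  finally have eq: "(\<integral>\<omega>. V \<omega> \<partial>p) = (\<integral>\<omega>. U s \<omega> \<partial>p)" .
  have Us: "integrable p (U s)" using U st by (auto simp: mart_def)
  have "AE \<omega> in p. U s \<omega> - V \<omega> = 0"
  proof (subst integral_nonneg_eq_0_iff_AE[symmetric])
    show "AE \<omega> in p. 0 \<le> U s \<omega> - V \<omega>" using le VU by eventually_elim simp
  qed (use L(1) Us eq in auto)
  with VU show ?thesis by eventually_elim simp
qed

end

section \<open>Laws and filtrations of a right process\<close>

lemma space_natural_alg [simp]: "space (natural_alg W I) = Paths W"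
  unfolding natural_alg_def by (rule space_measure_of) auto

lemma sets_natural_alg:
  "sets (natural_alg W I) = sigma_sets (Paths W) {X W s -` B \<inter> Paths W |s B. s \<in> I \<and> B \<in> sets borel}"
  unfolding natural_alg_def by (rule sets_measure_of) auto

lemma natural_alg_mono: "I \<subseteq> J \<Longrightarrow> sets (natural_alg W I) \<subseteq> sets (natural_alg W J)"
  unfolding sets_natural_alg by (intro sigma_sets_mono' ) auto

lemma measurable_X_natural: "s \<in> I \<Longrightarrow> X W s \<in> borel_measurable (natural_alg W I)"
  by (rule measurableI) (auto simp: sets_natural_alg intro!: sigma_sets.Basic)

lemma space_canonical_alg [simp]: "space (canonical_alg W t) = Paths W"
  unfolding canonical_alg_def by (rule space_measure_of_conv)

context right_process begin

abbreviation nat_alg :: "'w measure" where "nat_alg \<equiv> natural_alg W {0..}"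

lemma space_P: "x \<in> points W \<Longrightarrow> space (P W x) = Paths W"
  using sets_eq_imp_space_eq[OF sets_P[of x]] by simp

lemma St_points: "x \<in> St W \<Longrightarrow> x \<in> points W" by (simp add: points_def)

lemma Cem_points: "Cem W \<in> points W" by (simp add: points_def)

lemma space_points [simp]: "space (restrict_space borel (points W)) = points W"
  by (simp add: space_restrict_space)

lemma initial_lawD:
  assumes "\<mu> \<in> initial_laws W"
  shows "prob_space \<mu>" "sets \<mu> = sets (restrict_space borel (points W))" "space \<mu> = points W"
  using assms sets_eq_imp_space_eq[of \<mu> "restrict_space borel (points W)"] by (auto simp: initial_laws_def)

lemma P_measurable_completion:
  assumes "\<mu> \<in> initial_laws W" "\<Gamma> \<in> sets nat_alg"
  shows "(\<lambda>x. emeasure (P W x) \<Gamma>) \<in> borel_measurable (completion \<mu>)"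
proof (rule measurableI)
  fix A :: "ennreal set" assume "A \<in> sets borel"
  from measurable_sets[OF measurable_P[OF assms(2)] this]
  show "(\<lambda>x. emeasure (P W x) \<Gamma>) -` A \<inter> space (completion \<mu>) \<in> sets (completion \<mu>)"
    using sets_universal_completion_prob[OF initial_lawD(1,2)[OF assms(1)]] initial_lawD(3)[OF assms(1)] by auto
qed auto

lemma sets_law_from [simp]: "sets (law_from W \<mu>) = sets nat_alg"
  unfolding law_from_def using sets.space_closed[of nat_alg] sets.sigma_sets_eq[of nat_alg]
  by (subst sets_measure_of) auto

lemma space_law_from [simp]: "space (law_from W \<mu>) = Paths W"
  using sets_eq_imp_space_eq[OF sets_law_from[of \<mu>]] by simp

text \<open>\<open>law_from\<close> is built by \<open>measure_of\<close>, so its values are as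
  announced only once countable additivity is verified. The integrands are universally measurable
  and not necessarily Borel, so sum and integral are interchanged for the completion of
  \<mu>.\<close>

lemma emeasure_law_from:
  assumes \<mu>: "\<mu> \<in> initial_laws W" and \<Gamma>: "\<Gamma> \<in> sets nat_alg"
  shows "emeasure (law_from W \<mu>) \<Gamma> = (\<integral>\<^sup>+x. emeasure (P W x) \<Gamma> \<partial>\<mu>)"
proof -
  have "countably_additive (sets nat_alg) (\<lambda>\<Gamma>. \<integral>\<^sup>+x. emeasure (P W x) \<Gamma> \<partial>\<mu>)"
  proof (rule countably_additiveI)
    fix A :: "nat \<Rightarrow> 'w set" assume A: "range A \<subseteq> sets nat_alg" "disjoint_family A"
    have "(\<integral>\<^sup>+x. emeasure (P W x) (\<Union>i. A i) \<partial>\<mu>) = (\<integral>\<^sup>+x. (\<Sum>i. emeasure (P W x) (A i)) \<partial>\<mu>)"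
    proof (rule nn_integral_cong)
      fix x assume "x \<in> space \<mu>"
      then have "x \<in> points W" using initial_lawD(3)[OF \<mu>] by simp
      then show "emeasure (P W x) (\<Union>i. A i) = (\<Sum>i. emeasure (P W x) (A i))"
        using A sets_P by (intro suminf_emeasure[symmetric]) auto
    qed
    also have "\<dots> = (\<integral>\<^sup>+x. (\<Sum>i. emeasure (P W x) (A i)) \<partial>completion \<mu>)"
      by (rule nn_integral_completion[symmetric])
    also have "\<dots> = (\<Sum>i. \<integral>\<^sup>+x. emeasure (P W x) (A i) \<partial>completion \<mu>)"
      using A by (intro nn_integral_suminf P_measurable_completion[OF \<mu>]) auto
    finally show "(\<Sum>i. \<integral>\<^sup>+x. emeasure (P W x) (A i) \<partial>\<mu>) = (\<integral>\<^sup>+x. emeasure (P W x) (\<Union>i. A i) \<partial>\<mu>)"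
      by (simp add: nn_integral_completion)
  qed
  moreover have "positive (sets nat_alg) (\<lambda>\<Gamma>. \<integral>\<^sup>+x. emeasure (P W x) \<Gamma> \<partial>\<mu>)"
    by (simp add: positive_def)
  ultimately show ?thesis
    using \<Gamma> emeasure_measure_of[OF law_from_def, of W \<mu> \<Gamma>] sets.space_closed[of nat_alg]
    by (simp add: sets_law_from[symmetric] del: sets_law_from) (simp add: sets_law_from)
qed

lemma prob_space_law_from:
  assumes \<mu>: "\<mu> \<in> initial_laws W" shows "prob_space (law_from W \<mu>)"
proof (rule prob_spaceI)
  interpret prob_space \<mu> using initial_lawD(1)[OF \<mu>] .
  have "emeasure (law_from W \<mu>) (Paths W) = (\<integral>\<^sup>+x. emeasure (P W x) (Paths W) \<partial>\<mu>)"
    using sets.top[of nat_alg] by (intro emeasure_law_from[OF \<mu>]) simp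
  also have "\<dots> = (\<integral>\<^sup>+x. 1 \<partial>\<mu>)"
    using initial_lawD(3)[OF \<mu>] space_P prob_space.emeasure_space_1[OF prob_space_P]
    by (intro nn_integral_cong) (metis)
  finally show "emeasure (law_from W \<mu>) (space (law_from W \<mu>)) = 1"
    using emeasure_space_1 by simp
qed

lemma return_initial_law:
  "x \<in> points W \<Longrightarrow> return (restrict_space borel (points W)) x \<in> initial_laws W"
  by (simp add: initial_laws_def prob_space_return)

lemma singleton_points: "x \<in> points W \<Longrightarrow> {x} \<in> sets (restrict_space borel (points W))"
  by (auto simp: sets_restrict_space intro!: image_eqI[of _ _ "{x}"])

text \<open>Points are Borel, so a point mass sees its own point only. Properties required of all
  initial laws thereby specialize to each \<open>P W x\<close>.\<close>

lemma law_from_return: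
  assumes x: "x \<in> points W"
  shows "law_from W (return (restrict_space borel (points W)) x) = P W x"
proof (rule measure_eqI)
  let ?R = "restrict_space borel (points W)"
  show "sets (law_from W (return ?R x)) = sets (P W x)" using sets_P[OF x] by simp
  fix \<Gamma> assume "\<Gamma> \<in> sets (law_from W (return ?R x))"
  then have \<Gamma>: "\<Gamma> \<in> sets nat_alg" by simp
  have ae: "AE y in return ?R x. y = x"
  proof (subst AE_return)
    show "Measurable.pred ?R (\<lambda>y. y = x)"
      using singleton_points[OF x] by (simp add: pred_def x Collect_conv_if)
  qed (use x in auto)
  interpret prob_space "return ?R x" using x by (intro prob_space_return) simp
  have "emeasure (law_from W (return ?R x)) \<Gamma> = (\<integral>\<^sup>+y. emeasure (P W y) \<Gamma> \<partial>return ?R x)"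
    by (rule emeasure_law_from[OF return_initial_law[OF x] \<Gamma>])
  also have "\<dots> = (\<integral>\<^sup>+y. emeasure (P W x) \<Gamma> \<partial>return ?R x)"
    by (intro nn_integral_cong_AE, use ae in eventually_elim) simp
  also have "\<dots> = emeasure (P W x) \<Gamma>" using emeasure_space_1 by simp
  finally show "emeasure (law_from W (return ?R x)) \<Gamma> = emeasure (P W x) \<Gamma>" .
qed

section \<open>Comparison of the natural, the canonical and the augmented filtration\<close>

lemma canonical_le_augment:
  assumes \<mu>: "\<mu> \<in> initial_laws W"
  shows "sets (canonical_alg W t) \<subseteq> sets (augment (law_from W \<mu>) (natural_alg W {0..t}))"
proof -
  let ?S = "\<Inter>\<mu>\<in>initial_laws W. sets (augment (law_from W \<mu>) (natural_alg W {0..t}))"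
  have "sigma_sets (space (augment (law_from W \<mu>) (natural_alg W {0..t}))) ?S
      \<subseteq> sets (augment (law_from W \<mu>) (natural_alg W {0..t}))"
    by (rule sets.sigma_sets_subset) (use \<mu> in auto)
  moreover have "?S \<subseteq> Pow (Paths W)"
    using \<mu> sets.space_closed[of "augment (law_from W \<mu>) (natural_alg W {0..t})"] by auto
  ultimately show ?thesis unfolding canonical_alg_def by (simp add: sets_measure_of)
qed

lemma natural_le_law: "sets (natural_alg W {0..t}) \<subseteq> sets (law_from W \<mu>)"
  using natural_alg_mono[of "{0..t}" "{0..}" W] by auto

lemma canonical_le_completion:
  assumes \<mu>: "\<mu> \<in> initial_laws W"
  shows "sets (canonical_alg W t) \<subseteq> sets (completion (law_from W \<mu>))"
  using canonical_le_augment[OF assms] sets_augment_completion[OF natural_le_law[of t \<mu>]] by fastforce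

lemma natural_le_canonical: "sets (natural_alg W {0..t}) \<subseteq> sets (canonical_alg W t)"
proof
  fix B assume B: "B \<in> sets (natural_alg W {0..t})"
  let ?S = "\<Inter>\<mu>\<in>initial_laws W. sets (augment (law_from W \<mu>) (natural_alg W {0..t}))"
  have "B \<in> sets (augment (law_from W \<mu>) (natural_alg W {0..t}))" for \<mu>
  proof (subst augment_sets)
    show "B \<in> {A. A \<subseteq> space (law_from W \<mu>) \<and> (\<exists>B\<in>sets (natural_alg W {0..t}).
        \<exists>N\<in>null_sets (law_from W \<mu>). (A - B) \<union> (B - A) \<subseteq> N)}"
      by (intro CollectI conjI bexI[of _ B] bexI[of _ "{}"]) (use B sets.sets_into_space[OF B] in auto)
  qed (use natural_le_law[of t \<mu>] in auto)
  then have "B \<in> ?S" by auto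
  \<comment> \<open>The intersection runs over a nonempty family: the point mass at the cemetery is
    an initial law.\<close>
  moreover have "?S \<subseteq> Pow (Paths W)"
    using return_initial_law[OF Cem_points] sets.space_closed[of "augment (law_from W _) (natural_alg W {0..t})"]
    by fastforce
  ultimately show "B \<in> sets (canonical_alg W t)"
    unfolding canonical_alg_def by (subst sets_measure_of) (auto intro: sigma_sets.Basic)
qed

lemma canonical_le_filt: "x \<in> points W \<Longrightarrow> sets (canonical_alg W t) \<subseteq> sets (filt_at W x t)"
  using canonical_le_augment[OF return_initial_law, of x t] law_from_return[of x] by (simp add: filt_at_def)

lemma natural_le_P: "x \<in> points W \<Longrightarrow> sets (natural_alg W {0..t}) \<subseteq> sets (P W x)"
  using natural_le_law[of t] sets_P by simp

lemma filtered_prob_space_P: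
  assumes x: "x \<in> points W" shows "filtered_prob_space (completion (P W x)) (filt_at W x)"
proof -
  interpret prob_space "completion (P W x)"
    by (rule prob_space.prob_space_completion[OF prob_space_P[OF x]])
  have sp: "space (natural_alg W {0..t}) = space (P W x)" for t using space_P[OF x] by simp
  show ?thesis
  proof
    show "space (filt_at W x t) = space (completion (P W x))" for t by (simp add: filt_at_def)
    show "sets (filt_at W x t) \<subseteq> sets (completion (P W x))" for t
      unfolding filt_at_def by (rule sets_augment_completion[OF natural_le_P[OF x] sp])
    show "sets (filt_at W x s) \<subseteq> sets (filt_at W x t)" if "s \<le> t" for s t
      using natural_alg_mono[of "{0..s}" "{0..t}" W] that
      unfolding filt_at_def augment_sets[OF natural_le_P[OF x] sp] by auto
  qed
qed

lemma canonical_measurable_filt: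
  "x \<in> points W \<Longrightarrow> f \<in> borel_measurable (canonical_alg W t) \<Longrightarrow> f \<in> borel_measurable (filt_at W x t)"
  using canonical_le_filt[of x t] space_P[of x] by (auto simp: measurable_def filt_at_def)

lemma canonical_measurable_completion:
  "x \<in> points W \<Longrightarrow> 0 \<le> t \<Longrightarrow> f \<in> borel_measurable (canonical_alg W t) \<Longrightarrow> f \<in> borel_measurable (completion (P W x))"
  by (rule filtered_prob_space.measurable_F[OF filtered_prob_space_P _ canonical_measurable_filt])

text \<open>The conditional expectations defining M are taken with respect to
  \<open>canonical_alg W\<close>, while the martingale property is wanted for
  \<open>filt_at W x\<close>. Each set of the latter differs by a null set from one of the natural
  filtration, and this one belongs to \<open>canonical_alg W\<close> at all later times.\<close>

lemma martingale_part_mart: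
  assumes A: "cont_additive_functional W A"
    and u: "(\<integral>\<^sup>+\<omega>. terminal_value A \<omega> \<partial>P W x) < \<infinity>"
    and M: "is_martingale_part W A M" and x: "x \<in> St W"
  shows "filtered_prob_space.mart (completion (P W x)) (filt_at W x) M"
proof -
  note xp = St_points[OF x]
  let ?p = "completion (P W x)" let ?F = "filt_at W x" let ?C = "canonical_alg W"
  interpret filtered_prob_space ?p ?F by (rule filtered_prob_space_P[OF xp])
  define Z where "Z \<omega> = enn2real (terminal_value A \<omega>)" for \<omega>
  have Am: "A t \<in> borel_measurable ?p" if "0 \<le> t" for t
    using A that canonical_measurable_completion[OF xp that] by (auto simp: cont_additive_functional_def)
  have "AE \<omega> in P W x. mono_on {0..} (\<lambda>t. A t \<omega>)"
    using A xp by (force simp: cont_additive_functional_def elim!: eventually_mono)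
  \<comment> \<open>Monotone paths reduce the supremum over all times to one over the integers,
    which makes it measurable for the completed law.\<close>
  then have "AE \<omega> in P W x. terminal_value A \<omega> = (SUP n. ennreal (A (real n) \<omega>))"
  proof eventually_elim
    fix \<omega> assume m: "mono_on {0..} (\<lambda>t. A t \<omega>)"
    show "terminal_value A \<omega> = (SUP n. ennreal (A (real n) \<omega>))"
      unfolding terminal_value_def
    proof (intro antisym SUP_least)
      fix t :: real assume "t \<in> {0..}"
      then have "ennreal (A t \<omega>) \<le> ennreal (A (real (nat \<lceil>t\<rceil>)) \<omega>)"
        by (intro ennreal_leI monotone_onD[OF m]) auto
      then show "ennreal (A t \<omega>) \<le> (SUP n. ennreal (A (real n) \<omega>))" by (rule SUP_upper2[rotated]) simp
    qed (auto intro!: SUP_upper)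
  qed
  then have Tm: "terminal_value A \<in> borel_measurable ?p"
    by (rule measurable_completion_AE_cong[rotated]) (use Am in auto)
  then have Zm: "Z \<in> borel_measurable ?p" unfolding Z_def[abs_def] by measurable
  have Zi: "integrable ?p Z"
  proof (rule integrableI_bounded[OF Zm])
    have "(\<integral>\<^sup>+\<omega>. ennreal (norm (Z \<omega>)) \<partial>?p) \<le> (\<integral>\<^sup>+\<omega>. terminal_value A \<omega> \<partial>?p)"
      unfolding Z_def by (intro nn_integral_mono) (simp add: ennreal_enn2real_if)
    then show "(\<integral>\<^sup>+\<omega>. ennreal (norm (Z \<omega>)) \<partial>?p) < \<infinity>" using u by (auto simp: nn_integral_completion)
  qed
  have sub: "sigma_finite_subalgebra ?p (?C t)" if "0 \<le> t" for t
  proof (intro finite_measure_subalgebra_is_sigma_finite finite_measure_subalgebra.intro finite_measure_subalgebra_axioms.intro)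
    show "subalgebra ?p (?C t)" "finite_measure ?p"
      using canonical_le_filt[OF xp, of t] sets_F[OF that] space_P[OF xp]
      by (auto simp: subalgebra_def finite_measure_axioms)
  qed
  let ?E = "\<lambda>t. real_cond_exp ?p (?C t) Z"
  have ME: "AE \<omega> in ?p. M t \<omega> = ?E t \<omega> - ?E 0 \<omega>" if "0 \<le> t" for t
    using M x that unfolding is_martingale_part_def Z_def[abs_def] by (auto intro!: AE_completion)
  have Ei: "integrable ?p (?E t)" if "0 \<le> t" for t
    using sigma_finite_subalgebra.real_cond_exp_int(1)[OF sub[OF that] Zi] .
  have Mm: "M t \<in> borel_measurable (?F t)" if "0 \<le> t" for t
    using M that by (intro canonical_measurable_filt[OF xp]) (auto simp: is_martingale_part_def)
  have Mi: "integrable ?p (M t)" if "0 \<le> t" for t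
  proof (subst integrable_cong_AE[OF _ _ ME[OF that]])
    show "M t \<in> borel_measurable ?p" by (rule measurable_F[OF that Mm[OF that]])
    show "integrable ?p (\<lambda>\<omega>. ?E t \<omega> - ?E 0 \<omega>)" using Ei that by auto
    then show "(\<lambda>\<omega>. ?E t \<omega> - ?E 0 \<omega>) \<in> borel_measurable ?p" by auto
  qed
  show ?thesis
    unfolding mart_def
  proof (intro conjI allI impI)
    fix s t \<Lambda> assume "0 \<le> s \<and> s \<le> t \<and> \<Lambda> \<in> sets (?F s)"
    then have st: "0 \<le> s" "s \<le> t" "0 \<le> t" and \<Lambda>: "\<Lambda> \<in> sets (?F s)" by auto
    have sp: "space (natural_alg W {0..s}) = space (P W x)" using space_P[OF xp] by simp
    obtain B Z' where B: "B \<in> sets (natural_alg W {0..s})" "Z' \<in> null_sets (P W x)" "(\<Lambda> - B) \<union> (B - \<Lambda>) \<subseteq> Z'"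
      using \<Lambda> unfolding filt_at_def augment_sets[OF natural_le_P[OF xp] sp] by auto
    have Bp: "B \<in> sets ?p" using B(1) natural_le_P[OF xp, of s] by auto
    have \<Lambda>p: "\<Lambda> \<in> sets ?p" using \<Lambda> sets_F[OF st(1)] by auto
    have "AE \<omega> in P W x. \<omega> \<notin> Z'" by (rule AE_not_in[OF B(2)])
    then have ae: "AE \<omega> in ?p. \<omega> \<in> \<Lambda> \<longleftrightarrow> \<omega> \<in> B"
      by (intro AE_completion, elim eventually_mono) (use B(3) in auto)
    \<comment> \<open>The right side does not involve r; comparing r = s with r = t is the
      martingale property.\<close>
    have "(\<integral>\<omega>. indicator \<Lambda> \<omega> * M r \<omega> \<partial>?p) = (\<integral>\<omega>. indicator B \<omega> * Z \<omega> \<partial>?p) - (\<integral>\<omega>. indicator B \<omega> * ?E 0 \<omega> \<partial>?p)"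
      if r: "s \<le> r" for r
    proof -
      have r0: "0 \<le> r" using st r by simp
      have I: "integrable ?p (\<lambda>\<omega>. indicator B \<omega> * f \<omega>)" if "integrable ?p f" for f :: "'w \<Rightarrow> real"
        using integrable_mult_indicator[OF Bp that] by simp
      have "(\<integral>\<omega>. indicator \<Lambda> \<omega> * M r \<omega> \<partial>?p) = (\<integral>\<omega>. indicator B \<omega> * ?E r \<omega> - indicator B \<omega> * ?E 0 \<omega> \<partial>?p)"
      proof (rule integral_cong_AE)
        show "AE \<omega> in ?p. indicator \<Lambda> \<omega> * M r \<omega> = indicator B \<omega> * ?E r \<omega> - indicator B \<omega> * ?E 0 \<omega>"
          using ae ME[OF r0] by eventually_elim (auto simp: indicator_def)
        show "(\<lambda>\<omega>. indicator \<Lambda> \<omega> * M r \<omega>) \<in> borel_measurable ?p"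
          using Mi[OF r0] \<Lambda>p by auto
        show "(\<lambda>\<omega>. indicator B \<omega> * ?E r \<omega> - indicator B \<omega> * ?E 0 \<omega>) \<in> borel_measurable ?p"
          using I[OF Ei[OF r0]] I[OF Ei[of 0]] by auto
      qed
      also have "\<dots> = (\<integral>\<omega>. indicator B \<omega> * ?E r \<omega> \<partial>?p) - (\<integral>\<omega>. indicator B \<omega> * ?E 0 \<omega> \<partial>?p)"
        using I[OF Ei[OF r0]] I[OF Ei[of 0]] by simp
      also have "(\<integral>\<omega>. indicator B \<omega> * ?E r \<omega> \<partial>?p) = (\<integral>\<omega>. indicator B \<omega> * Z \<omega> \<partial>?p)"
      proof -
        have "B \<in> sets (?C r)" using B(1) natural_alg_mono[of "{0..s}" "{0..r}" W] r natural_le_canonical[of r] by auto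
        from sigma_finite_subalgebra.real_cond_exp_intA[OF sub[OF r0] Zi this] show ?thesis
          by (simp add: set_lebesgue_integral_def)
      qed
      finally show ?thesis .
    qed
    from this[of s] this[of t] st show "(\<integral>\<omega>. indicator \<Lambda> \<omega> * M s \<omega> \<partial>?p) = (\<integral>\<omega>. indicator \<Lambda> \<omega> * M t \<omega> \<partial>?p)" by simp
  qed (use Mm Mi in auto)
qed

end

section \<open>The local time is carried by its level\<close>

lemma (in filtered_prob_space) martingale_imp_mart:
  assumes "martingale p F V" shows "mart V"
  unfolding mart_def
proof (intro conjI allI impI)
  fix s t \<Lambda> assume "0 \<le> s \<and> s \<le> t \<and> \<Lambda> \<in> sets (F s)"
  then have st: "0 \<le> s" "s \<le> t" "0 \<le> t" and \<Lambda>: "\<Lambda> \<in> sets (F s)" by auto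
  have i: "integrable p (V s)" "integrable p (V t)" using assms st by (auto simp: martingale_def)
  have sub: "sigma_finite_subalgebra p (F s)"
    by (intro finite_measure_subalgebra_is_sigma_finite finite_measure_subalgebra.intro finite_measure_subalgebra_axioms.intro)
      (use sets_F[OF st(1)] space_F[OF st(1)] in \<open>auto simp: subalgebra_def finite_measure_axioms\<close>)
  have \<Lambda>p: "\<Lambda> \<in> sets p" using \<Lambda> sets_F[OF st(1)] by auto
  have ae: "AE \<omega> in p. real_cond_exp p (F s) (V t) \<omega> = V s \<omega>" using assms st by (auto simp: martingale_def)
  have j: "integrable p (real_cond_exp p (F s) (V t))"
    by (rule sigma_finite_subalgebra.real_cond_exp_int(1)[OF sub i(2)])
  have "(\<integral>\<omega>. indicator \<Lambda> \<omega> * V t \<omega> \<partial>p) = (\<integral>\<omega>. indicator \<Lambda> \<omega> * real_cond_exp p (F s) (V t) \<omega> \<partial>p)"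
    using sigma_finite_subalgebra.real_cond_exp_intA[OF sub i(2) \<Lambda>] by (simp add: set_lebesgue_integral_def)
  also have "\<dots> = (\<integral>\<omega>. indicator \<Lambda> \<omega> * V s \<omega> \<partial>p)"
    by (rule integral_cong_AE) (use i j \<Lambda>p ae in \<open>auto elim!: eventually_mono\<close>)
  finally show "(\<integral>\<omega>. indicator \<Lambda> \<omega> * V s \<omega> \<partial>p) = (\<integral>\<omega>. indicator \<Lambda> \<omega> * V t \<omega> \<partial>p)" by simp
qed (use assms in \<open>auto simp: martingale_def\<close>)

text \<open>\<open>mart_one_sided_at_hitting\<close> is applied to the first rational time at which
  G fails, capped at t. Before that time G holds at every rational, so \<open>le\<close> can be used
  with r equal to it; on paths where G never fails it is t itself.\<close>

lemma (in filtered_prob_space) mart_constant_while_good: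
  assumes U: "mart U" "AE \<omega> in p. continuous_on {0..} (\<lambda>t. U t \<omega>)"
    and st: "0 \<le> s" "s < t"
    and G: "\<And>g. g \<in> \<rat> \<Longrightarrow> s \<le> g \<Longrightarrow> g < t \<Longrightarrow> {\<omega>\<in>space p. \<not> G g \<omega>} \<in> sets (F g)"
    and le: "AE \<omega> in p. \<forall>r. s < r \<and> r \<le> t \<and> (\<forall>g\<in>\<rat>. s \<le> g \<and> g < r \<longrightarrow> G g \<omega>) \<longrightarrow> U r \<omega> \<le> U s \<omega>"
  shows "AE \<omega> in p. (\<forall>g\<in>\<rat>. s \<le> g \<and> g < t \<longrightarrow> G g \<omega>) \<longrightarrow> U t \<omega> = U s \<omega>"
proof -
  define B where "B \<omega> = insert t {g\<in>\<rat>. s \<le> g \<and> g < t \<and> \<not> G g \<omega>}" for \<omega>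
  have bdd: "bdd_below (B \<omega>)" for \<omega>
    by (rule bdd_belowI[of _ s]) (use st in \<open>auto simp: B_def\<close>)
  have \<tau>: "s \<le> Inf (B \<omega>)" "Inf (B \<omega>) \<le> t" for \<omega>
    using st bdd[of \<omega>] by (auto simp: B_def intro!: cInf_greatest cInf_lower)
  have "AE \<omega> in p. U (Inf (B \<omega>)) \<omega> = U s \<omega>"
  proof (rule mart_one_sided_at_hitting[OF U st G])
    show "AE \<omega> in p. U (Inf (B \<omega>)) \<omega> \<le> U s \<omega>"
      using le
    proof eventually_elim
      fix \<omega> assume *: "\<forall>r. s < r \<and> r \<le> t \<and> (\<forall>g\<in>\<rat>. s \<le> g \<and> g < r \<longrightarrow> G g \<omega>) \<longrightarrow> U r \<omega> \<le> U s \<omega>"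
      show "U (Inf (B \<omega>)) \<omega> \<le> U s \<omega>"
      proof (cases "Inf (B \<omega>) = s")
        case False
        have "G g \<omega>" if "g \<in> \<rat>" "s \<le> g" "g < Inf (B \<omega>)" for g
          using cInf_lower[OF _ bdd[of \<omega>], of g] that \<tau>(2)[of \<omega>] by (force simp: B_def)
        then show ?thesis using * False \<tau>[of \<omega>] by auto
      qed simp
    qed
  qed (auto simp: B_def)
  then show ?thesis
  proof eventually_elim
    fix \<omega> assume *: "U (Inf (B \<omega>)) \<omega> = U s \<omega>"
    have "Inf (B \<omega>) = t" if "\<forall>g\<in>\<rat>. s \<le> g \<and> g < t \<longrightarrow> G g \<omega>"
    proof -
      have "B \<omega> = {t}" using that by (auto simp: B_def)
      then show ?thesis by simp
    qed
    with * show "(\<forall>g\<in>\<rat>. s \<le> g \<and> g < t \<longrightarrow> G g \<omega>) \<longrightarrow> U t \<omega> = U s \<omega>" by metis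
  qed
qed

text \<open>The integral is the \<open>stieltjes\<close> mass of the times at which Y is below a,
  and on \<open>{s<..t}\<close> this is all or nothing. The condition starts after s because the
  time s is already counted in the integral up to s.\<close>

lemma path_integral_threshold:
  assumes C: "continuous_on {0..} (\<lambda>r. C r \<omega>)" "mono_on {0..} (\<lambda>r. C r \<omega>)"
    and Y: "continuous_on {0..} (\<lambda>r. Y r \<omega>)" and st: "0 \<le> s" "s \<le> (t::real)"
  shows "(\<And>r. s < r \<Longrightarrow> r \<le> t \<Longrightarrow> Y r \<omega> < (a::real)) \<Longrightarrow>
      path_integral (\<lambda>s \<omega>. of_bool (Y s \<omega> < a)) C t \<omega> = path_integral (\<lambda>s \<omega>. of_bool (Y s \<omega> < a)) C s \<omega> + (C t \<omega> - C s \<omega>)"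
    and "(\<And>r. s < r \<Longrightarrow> r \<le> t \<Longrightarrow> a \<le> Y r \<omega>) \<Longrightarrow>
      path_integral (\<lambda>s \<omega>. of_bool (Y s \<omega> < a)) C t \<omega> = path_integral (\<lambda>s \<omega>. of_bool (Y s \<omega> < a)) C s \<omega>"
proof -
  let ?S = "stieltjes (\<lambda>r. C r \<omega>)"
  define J where "J r = {q\<in>{0..r}. Y q \<omega> < a}" for r
  note c = cadlag_increasing_continuous[OF C]
  have Jm: "J r \<in> sets borel" for r
  proof -
    have "continuous_on {0..r} (\<lambda>q. Y q \<omega>)" by (rule continuous_on_subset[OF Y]) auto
    then have [measurable]: "(\<lambda>q. Y q \<omega>) \<in> borel_measurable (restrict_space borel {0..r})"
      by (rule borel_measurable_continuous_on_restrict)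
    have "{q\<in>space (restrict_space borel {0..r}). Y q \<omega> < a} \<in> sets (restrict_space borel {0..r})"
      by measurable
    then show ?thesis by (auto simp: J_def sets_restrict_space_iff space_restrict_space)
  qed
  have Jf: "emeasure ?S (J r) \<noteq> \<infinity>" if "0 \<le> r" for r
  proof -
    have "emeasure ?S (J r) \<le> emeasure ?S {0..r}" by (rule emeasure_mono) (auto simp: J_def)
    also have "\<dots> < \<infinity>" using emeasure_stieltjes_Icc[OF c that] by simp
    finally show ?thesis by simp
  qed
  have pi: "path_integral (\<lambda>s \<omega>. of_bool (Y s \<omega> < a)) C r \<omega> = measure ?S (J r)" for r
  proof -
    have "path_integral (\<lambda>s \<omega>. of_bool (Y s \<omega> < a)) C r \<omega> = (\<integral>q. indicator (J r) q \<partial>?S)"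
      unfolding path_integral_def set_lebesgue_integral_def
      by (intro Bochner_Integration.integral_cong) (auto simp: J_def indicator_def)
    then show ?thesis using Jm by simp
  qed
  { assume "\<And>r. s < r \<Longrightarrow> r \<le> t \<Longrightarrow> Y r \<omega> < a"
    then have "J t = J s \<union> {s<..t}" using st by (auto simp: J_def)
    moreover have "measure ?S (J s \<union> {s<..t}) = measure ?S (J s) + measure ?S {s<..t}"
      using Jf[OF st(1)] Jm[of s] emeasure_stieltjes_Ioc[OF c st(2)] st
      by (intro measure_Union) (auto simp: J_def)
    moreover have "measure ?S {s<..t} = C t \<omega> - C s \<omega>"
    proof -
      have "C s \<omega> \<le> C t \<omega>" using C(2) st by (auto simp: mono_on_def)
      then show ?thesis using emeasure_stieltjes_Ioc[OF c st(2)] st by (simp add: measure_def)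
    qed
    ultimately show "path_integral (\<lambda>s \<omega>. of_bool (Y s \<omega> < a)) C t \<omega> = path_integral (\<lambda>s \<omega>. of_bool (Y s \<omega> < a)) C s \<omega> + (C t \<omega> - C s \<omega>)"
      unfolding pi by simp
  next
    assume *: "\<And>r. s < r \<Longrightarrow> r \<le> t \<Longrightarrow> a \<le> Y r \<omega>"
    have "J t = J s"
    proof (intro equalityI subsetI)
      fix q assume "q \<in> J t"
      then show "q \<in> J s" using *[of q] by (force simp: J_def)
    qed (use st in \<open>auto simp: J_def\<close>)
    then show "path_integral (\<lambda>s \<omega>. of_bool (Y s \<omega> < a)) C t \<omega> = path_integral (\<lambda>s \<omega>. of_bool (Y s \<omega> < a)) C s \<omega>"
      unfolding pi by simp }
qed

text \<open>By continuity every positive time with \<open>y r \<noteq> a\<close> lies in a rational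
  interval on which y keeps a distance from a and c is constant; these are countably many null
  intervals, and time 0 carries no mass. The margin \<open>1 / real (Suc n)\<close> is part of the
  premise because strict inequalities at rational times become weak ones at their limits.\<close>

lemma stieltjes_null_off_level:
  fixes y c :: "real \<Rightarrow> real"
  assumes c: "continuous_on {0..} c" "mono_on {0..} c" and y: "continuous_on {0..} y"
    and const: "\<And>s t n. s \<in> \<rat> \<Longrightarrow> t \<in> \<rat> \<Longrightarrow> 0 \<le> s \<Longrightarrow> s < t \<Longrightarrow>
      (\<forall>r\<in>{s..t}. y r < a - 1 / real (Suc n)) \<or> (\<forall>r\<in>{s..t}. a + 1 / real (Suc n) < y r) \<Longrightarrow> c t = c s"
  shows "AE s in stieltjes c. 0 \<le> s \<longrightarrow> y s = a"
proof -
  note cc = cadlag_increasing_continuous[OF c]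
  define D where "D = {(s, t). s \<in> \<rat> \<and> t \<in> \<rat> \<and> 0 \<le> s \<and> s < t \<and> c t = c s}"
  have cD: "countable D"
    by (rule countable_subset[of _ "\<rat> \<times> \<rat>"]) (auto simp: D_def countable_rat)
  have 1: "(\<lambda>(s, t). {s<..t}) i \<in> null_sets (stieltjes c)" if "i \<in> D" for i
    using that emeasure_stieltjes_Ioc[OF cc, of "fst i" "snd i"] by (auto simp: D_def null_sets_def)
  have 0: "{0} \<in> null_sets (stieltjes c)"
    using emeasure_stieltjes_Icc[OF cc, of 0] by (simp add: null_sets_def)
  have "(\<Union>i\<in>D. (\<lambda>(s, t). {s<..t}) i) \<union> {0} \<in> null_sets (stieltjes c)"
    by (intro null_sets.Un null_sets_UN' cD 1 0)
  then show ?thesis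
  proof (rule AE_I')
    have "r \<in> (\<Union>i\<in>D. (\<lambda>(s, t). {s<..t}) i)" if r: "0 < r" and ne: "y r \<noteq> a" for r
    proof -
      \<comment> \<open>Half of the distance is given to the oscillation of y, and the margin is
        smaller than the other half.\<close>
      obtain n where n: "1 / real (Suc n) < \<bar>y r - a\<bar> / 2"
        using nat_approx_posE[of "\<bar>y r - a\<bar> / 2"] ne by (metis half_gt_zero zero_less_abs_iff right_minus_eq)
      define \<eta> where "\<eta> = 1 / real (Suc n)"
      define \<epsilon> where "\<epsilon> = \<bar>y r - a\<bar> / 2"
      have "0 < \<epsilon>" using ne by (simp add: \<epsilon>_def)
      then obtain d where d: "0 < d" "\<And>q. 0 \<le> q \<Longrightarrow> \<bar>q - r\<bar> < d \<Longrightarrow> \<bar>y q - y r\<bar> < \<epsilon>"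
        using y r unfolding continuous_on_iff dist_real_def by (metis atLeast_iff less_imp_le)
      obtain s where s: "s \<in> \<rat>" "max 0 (r - d) < s" "s < r"
        using Rats_dense_in_real[of "max 0 (r - d)" r] r d by auto
      obtain t where t: "t \<in> \<rat>" "r < t" "t < r + d"
        using Rats_dense_in_real[of r "r + d"] d by auto
      have near: "\<bar>y q - y r\<bar> < \<epsilon>" if "q \<in> {s..t}" for q
        using that s t by (intro d(2)) auto
      have "(\<forall>q\<in>{s..t}. y q < a - 1 / real (Suc n)) \<or> (\<forall>q\<in>{s..t}. a + 1 / real (Suc n) < y q)"
      proof (cases "y r < a")
        case True
        have "y q < a - 1 / real (Suc n)" if "q \<in> {s..t}" for q
          using near[OF that] n[folded \<eta>_def] True unfolding \<epsilon>_def \<eta>_def[symmetric] abs_less_iff by (simp add: abs_if)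
        then show ?thesis by blast
      next
        case False
        have "a + 1 / real (Suc n) < y q" if "q \<in> {s..t}" for q
          using near[OF that] n[folded \<eta>_def] False unfolding \<epsilon>_def \<eta>_def[symmetric] abs_less_iff by (simp add: abs_if)
        then show ?thesis by blast
      qed
      then have "c t = c s" using s t by (intro const[of s t n]) auto
      then have "(s, t) \<in> D" using s t by (auto simp: D_def)
      then show ?thesis using s t by (intro UN_I[of "(s, t)"]) auto
    qed
    then show "{x \<in> space (stieltjes c). \<not> (0 \<le> x \<longrightarrow> y x = a)} \<subseteq> (\<Union>i\<in>D. (\<lambda>(s, t). {s<..t}) i) \<union> {0}"
      by (auto simp: not_le less_le)
  qed
qed

text \<open>Continuity extends the bound from the rationals to all times, the right end point
  included. Only a weak inequality survives, hence the margins in the events to which this is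
  applied.\<close>

lemma le_of_rat_less:
  fixes y :: "real \<Rightarrow> real"
  assumes y: "continuous_on {0..} y" and s: "0 \<le> s" "s < r"
    and b: "\<And>g. g \<in> \<rat> \<Longrightarrow> s \<le> g \<Longrightarrow> g < r \<Longrightarrow> y g \<le> b" and q: "s \<le> q" "q \<le> r"
  shows "y q \<le> b"
proof (rule ccontr)
  assume "\<not> y q \<le> b"
  then have e: "0 < y q - b" by simp
  obtain d where d: "0 < d" "\<And>p. 0 \<le> p \<Longrightarrow> \<bar>p - q\<bar> < d \<Longrightarrow> \<bar>y p - y q\<bar> < y q - b"
    using y s q e unfolding continuous_on_iff dist_real_def by (metis atLeast_iff order_trans)
  have "max s (q - d) < min r (q + d)" using s q d by auto
  then obtain g where g: "g \<in> \<rat>" "max s (q - d) < g" "g < min r (q + d)"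
    using Rats_dense_in_real by blast
  have "\<bar>g - q\<bar> < d" "0 \<le> g" using g s by auto
  from d(2)[OF this(2,1)] b[of g] g show False by auto
qed

lemma (in right_process) local_time_carried_by_level:
  assumes A: "cont_additive_functional W A"
    and u: "(\<integral>\<^sup>+\<omega>. terminal_value A \<omega> \<partial>P W x) < \<infinity>"
    and MP: "is_martingale_part W A M" and x: "x \<in> St W"
    and dec: "AE \<omega> in P W x. \<forall>t\<ge>0. ext0 W u (X W t \<omega>) = ext0 W u (X W 0 \<omega>) + M t \<omega> - A t \<omega>"
    and Mc: "AE \<omega> in P W x. continuous_on {0..} (\<lambda>t. M t \<omega>)"
    and LT: "is_local_time W u A M Q L"
  shows "AE \<omega> in P W x. AE s in stieltjes (\<lambda>r. L a r \<omega>). 0 \<le> s \<longrightarrow> ext0 W u (X W s \<omega>) = a"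
proof -
  note xp = St_points[OF x]
  let ?p = "completion (P W x)" let ?F = "filt_at W x"
  interpret filtered_prob_space ?p ?F by (rule filtered_prob_space_P[OF xp])
  define Y where "Y t \<omega> = ext0 W u (X W t \<omega>)" for t \<omega>
  let ?I = "path_integral (\<lambda>s \<omega>. of_bool (Y s \<omega> < a)) A"
  obtain N where N: "is_stoch_integral ?p ?F (\<lambda>s \<omega>. of_bool (Y s \<omega> < a)) M N"
    and Tanaka: "AE \<omega> in P W x. \<forall>t\<ge>0. min (Y t \<omega>) a = min (Y 0 \<omega>) a + (N t \<omega> - ?I t \<omega>) - L a t \<omega> / 2"
    and CL: "cont_additive_functional W (L a)"
    using LT x unfolding is_local_time_def Let_def Y_def[abs_def] by blast
  have Nlm: "cont_local_martingale ?p ?F N" using N by (simp add: is_stoch_integral_def)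
  then obtain T :: "nat \<Rightarrow> 'w \<Rightarrow> real" where T: "\<And>n. stopping_time ?F (T n)" "\<And>n \<omega>. \<omega> \<in> space ?p \<Longrightarrow> 0 \<le> T n \<omega>"
    and Tlim: "AE \<omega> in ?p. filterlim (\<lambda>n. T n \<omega>) at_top sequentially"
    and NT: "\<And>n. martingale ?p ?F (\<lambda>t \<omega>. N (min t (T n \<omega>)) \<omega> - N 0 \<omega>)"
    unfolding cont_local_martingale_def by auto
  have Nc: "AE \<omega> in ?p. continuous_on {0..} (\<lambda>t. N t \<omega>)" using Nlm by (simp add: cont_local_martingale_def)
  have caf: "AE \<omega> in P W x. continuous_on {0..} (\<lambda>t. C t \<omega>) \<and> mono_on {0..} (\<lambda>t. C t \<omega>)"
    if "cont_additive_functional W C" for C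
    using that xp by (force simp: cont_additive_functional_def elim!: eventually_mono)
  \<comment> \<open>The path properties used below, gathered in one almost sure event. By normality
    \<open>u x\<close> replaces \<open>Y 0\<close>, which expresses Y through the adapted processes
    M and A.\<close>
  define OK where "OK \<omega> \<longleftrightarrow> continuous_on {0..} (\<lambda>t. N t \<omega>) \<and> continuous_on {0..} (\<lambda>t. M t \<omega>) \<and>
     continuous_on {0..} (\<lambda>t. A t \<omega>) \<and> mono_on {0..} (\<lambda>t. A t \<omega>) \<and>
     continuous_on {0..} (\<lambda>t. L a t \<omega>) \<and> mono_on {0..} (\<lambda>t. L a t \<omega>) \<and>
     (\<forall>t\<ge>0. Y t \<omega> = u x + M t \<omega> - A t \<omega>) \<and>
     (\<forall>t\<ge>0. min (Y t \<omega>) a = min (Y 0 \<omega>) a + (N t \<omega> - ?I t \<omega>) - L a t \<omega> / 2)" for \<omega>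
  have "AE \<omega> in P W x. OK \<omega>"
    using normal[OF xp] dec Mc Tanaka caf[OF A] caf[OF CL] Nc[unfolded AE_completion_iff]
    by eventually_elim (use x in \<open>simp add: OK_def Y_def ext0_def[of W u x]\<close>)
  then have OK: "AE \<omega> in ?p. OK \<omega>" by (rule AE_completion)
  have Yc: "continuous_on {0..} (\<lambda>t. Y t \<omega>)" if "OK \<omega>" for \<omega>
  proof -
    have "continuous_on {0..} (\<lambda>t. u x + M t \<omega> - A t \<omega>)"
      using that unfolding OK_def by (intro continuous_intros) auto
    then show ?thesis using that by (subst continuous_on_cong[OF refl]) (auto simp: OK_def)
  qed
  have okM: "continuous_on {0..} (\<lambda>t. M t \<omega>)" if "OK \<omega>" for \<omega>
    using that[unfolded OK_def] by (elim conjE)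
  have okY: "Y q \<omega> = u x + M q \<omega> - A q \<omega>" if "OK \<omega>" "0 \<le> q" for q \<omega>
    using that(1)[unfolded OK_def] that(2) by (elim conjE allE[of _ q]) simp
  have okT: "min (Y q \<omega>) a = min (Y 0 \<omega>) a + (N q \<omega> - ?I q \<omega>) - L a q \<omega> / 2" if "OK \<omega>" "0 \<le> q" for q \<omega>
    using that(1)[unfolded OK_def] that(2) by (elim conjE) (drule spec[of _ q], erule mp)+
  \<comment> \<open>N is a local martingale; \<open>V n\<close> is N stopped at \<open>T n\<close>
    and started from 0, a genuine martingale that has the increments of N up to
    \<open>T n\<close>.\<close>
  define V where "V n t \<omega> = N (min t (T n \<omega>)) \<omega> - N 0 \<omega>" for n t \<omega>
  have Vm: "mart (V n)" for n unfolding V_def[abs_def] by (rule martingale_imp_mart[OF NT])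
  have Mm: "mart M" by (rule martingale_part_mart[OF A u MP x])
  have Vc: "continuous_on {0..} (\<lambda>t. V n t \<omega>)" if "OK \<omega>" "\<omega> \<in> space ?p" for n \<omega>
  proof -
    have "continuous_on {0..} (\<lambda>t. N (min t (T n \<omega>)) \<omega>)"
    proof (rule continuous_on_compose2[of "{0..}" "\<lambda>t. N t \<omega>"])
      show "continuous_on {0..} (\<lambda>t. N t \<omega>)" using that(1) by (simp add: OK_def)
      show "continuous_on {0..} (\<lambda>t. min t (T n \<omega>))"
        by (intro continuous_on_min continuous_on_id continuous_on_const)
      show "(\<lambda>t. min t (T n \<omega>)) ` {0..} \<subseteq> {0..}" using T(2)[OF that(2), of n] by auto
    qed
    then show ?thesis unfolding V_def by (intro continuous_on_diff continuous_on_const)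
  qed
  have [measurable]: "M g \<in> borel_measurable (?F g)" "A g \<in> borel_measurable (?F g)" if "0 \<le> g" for g
    using Mm A that canonical_measurable_filt[OF xp, of "A g" g] by (auto simp: mart_def cont_additive_functional_def)
  \<comment> \<open>Two requirements at time g: N has not yet been stopped, and Y is away from the
    level by a margin that survives limits along rationals. Writing Y as
    \<open>u x + M g - A g\<close> makes the complement an event of
    \<open>filt_at W x g\<close>.\<close>
  define G1 where "G1 n m g \<omega> \<longleftrightarrow> g < T n \<omega> \<and> u x + M g \<omega> - A g \<omega> < a - 1 / real (Suc m)" for n m :: nat and g \<omega>
  define G2 where "G2 n m g \<omega> \<longleftrightarrow> g < T n \<omega> \<and> a + 1 / real (Suc m) < u x + M g \<omega> - A g \<omega>" for n m :: nat and g \<omega>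
  have TleF: "{\<omega>\<in>space ?p. T n \<omega> \<le> g} \<in> sets (?F g)" if "0 \<le> g" for n g
    using stopping_timeD[OF T(1)[of n], of g] space_F[OF that] by (simp add: pred_def)
  have G1m: "{\<omega>\<in>space ?p. \<not> G1 n m g \<omega>} \<in> sets (?F g)" if "0 \<le> g" for n m g
  proof -
    have "{\<omega>\<in>space (?F g). \<not> u x + M g \<omega> - A g \<omega> < a - 1 / real (Suc m)} \<in> sets (?F g)"
      using that by measurable
    moreover have "{\<omega>\<in>space ?p. \<not> G1 n m g \<omega>} = {\<omega>\<in>space ?p. T n \<omega> \<le> g}
        \<union> {\<omega>\<in>space (?F g). \<not> u x + M g \<omega> - A g \<omega> < a - 1 / real (Suc m)}"
      using space_F[OF that] by (auto simp: G1_def)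
    ultimately show ?thesis using TleF[OF that] by (simp only: sets.Un)
  qed
  have G2m: "{\<omega>\<in>space ?p. \<not> G2 n m g \<omega>} \<in> sets (?F g)" if "0 \<le> g" for n m g
  proof -
    have "{\<omega>\<in>space (?F g). \<not> a + 1 / real (Suc m) < u x + M g \<omega> - A g \<omega>} \<in> sets (?F g)"
      using that by measurable
    moreover have "{\<omega>\<in>space ?p. \<not> G2 n m g \<omega>} = {\<omega>\<in>space ?p. T n \<omega> \<le> g}
        \<union> {\<omega>\<in>space (?F g). \<not> a + 1 / real (Suc m) < u x + M g \<omega> - A g \<omega>}"
      using space_F[OF that] by (auto simp: G2_def)
    ultimately show ?thesis using TleF[OF that] by (simp only: sets.Un)
  qed
  have Tge: "r \<le> T n \<omega>" if "s < r" "\<And>g. g \<in> \<rat> \<Longrightarrow> s \<le> g \<Longrightarrow> g < r \<Longrightarrow> g < T n \<omega>" for s r n \<omega>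
  proof (rule ccontr)
    assume "\<not> r \<le> T n \<omega>"
    then have "max s (T n \<omega>) < r" using that(1) by simp
    then obtain g where "g \<in> \<rat>" "max s (T n \<omega>) < g" "g < r" using Rats_dense_in_real by blast
    with that(2)[of g] show False by auto
  qed
  \<comment> \<open>Below the level the integral against A grows by the full increment of A, which
    cancels against the A in the decomposition of Y.\<close>
  have key1: "(M r \<omega> - V n r \<omega>) - (M s \<omega> - V n s \<omega>) = - (L a r \<omega> - L a s \<omega>) / 2"
    if ok: "OK \<omega>" and s: "0 \<le> s" "s < r" and g: "\<And>g. g \<in> \<rat> \<Longrightarrow> s \<le> g \<Longrightarrow> g < r \<Longrightarrow> G1 n m g \<omega>" for \<omega> s r n m
  proof -
    have Tr: "r \<le> T n \<omega>" by (rule Tge[OF s(2)]) (use g in \<open>auto simp: G1_def\<close>)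
    have Yb: "Y q \<omega> < a" if "s \<le> q" "q \<le> r" for q
    proof -
      have "Y q \<omega> \<le> a - 1 / real (Suc m)"
        by (rule le_of_rat_less[OF Yc[OF ok] s _ that]) (use g ok s in \<open>force simp: G1_def OK_def\<close>)
      moreover have "0 < 1 / real (Suc m)" by simp
      ultimately show ?thesis by linarith
    qed
    have I: "?I r \<omega> = ?I s \<omega> + (A r \<omega> - A s \<omega>)"
      by (rule path_integral_threshold(1)) (use ok Yc[OF ok] s Yb in \<open>auto simp: OK_def\<close>)
    have r0: "0 \<le> r" and "s \<le> T n \<omega>" using s Tr by auto
    then have "V n r \<omega> = N r \<omega> - N 0 \<omega>" "V n s \<omega> = N s \<omega> - N 0 \<omega>" using Tr by (simp_all add: V_def)
    moreover define m0 where "m0 = min (Y 0 \<omega>) a"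
    moreover have "Y r \<omega> = m0 + (N r \<omega> - ?I r \<omega>) - L a r \<omega> / 2" "Y s \<omega> = m0 + (N s \<omega> - ?I s \<omega>) - L a s \<omega> / 2"
      using okT[OF ok r0] okT[OF ok s(1)] Yb[of r] Yb[of s] s by (simp_all add: m0_def min_absorb1)
    ultimately show ?thesis
      using okY[OF ok r0] okY[OF ok s(1)] I by (simp add: field_simps)
  qed
  \<comment> \<open>The minus sign turns the increasing phase above the level into a decreasing one,
    so that the same one-sided lemma serves both phases.\<close>
  have key2: "- V n r \<omega> - (- V n s \<omega>) = - (L a r \<omega> - L a s \<omega>) / 2"
    if ok: "OK \<omega>" and s: "0 \<le> s" "s < r" and g: "\<And>g. g \<in> \<rat> \<Longrightarrow> s \<le> g \<Longrightarrow> g < r \<Longrightarrow> G2 n m g \<omega>" for \<omega> s r n m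
  proof -
    have Tr: "r \<le> T n \<omega>" by (rule Tge[OF s(2)]) (use g in \<open>auto simp: G2_def\<close>)
    have Yb: "a \<le> Y q \<omega>" if "s \<le> q" "q \<le> r" for q
    proof -
      have "continuous_on {0..} (\<lambda>q. - Y q \<omega>)" using Yc[OF ok] by (intro continuous_intros)
      then have "- Y q \<omega> \<le> - (a + 1 / real (Suc m))"
        by (rule le_of_rat_less[OF _ s _ that]) (use g ok s in \<open>force simp: G2_def OK_def\<close>)
      moreover have "0 < 1 / real (Suc m)" by simp
      ultimately show ?thesis by linarith
    qed
    have I: "?I r \<omega> = ?I s \<omega>"
      by (rule path_integral_threshold(2)) (use ok Yc[OF ok] s Yb in \<open>auto simp: OK_def\<close>)
    have r0: "0 \<le> r" and "s \<le> T n \<omega>" using s Tr by auto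
    then have "V n r \<omega> = N r \<omega> - N 0 \<omega>" "V n s \<omega> = N s \<omega> - N 0 \<omega>" using Tr by (simp_all add: V_def)
    moreover define m0 where "m0 = min (Y 0 \<omega>) a"
    moreover have "a = m0 + (N r \<omega> - ?I r \<omega>) - L a r \<omega> / 2" "a = m0 + (N s \<omega> - ?I s \<omega>) - L a s \<omega> / 2"
      using okT[OF ok r0] okT[OF ok s(1)] Yb[of r] Yb[of s] s by (simp_all add: m0_def min_absorb2)
    ultimately show ?thesis using I by (simp add: field_simps)
  qed
  have Lmono: "L a s \<omega> \<le> L a r \<omega>" if "OK \<omega>" "0 \<le> s" "s \<le> r" for \<omega> s r
    using that by (auto simp: OK_def mono_on_def)
  have C1: "AE \<omega> in ?p. (\<forall>g\<in>\<rat>. s \<le> g \<and> g < t \<longrightarrow> G1 n m g \<omega>) \<longrightarrow> M t \<omega> - V n t \<omega> = M s \<omega> - V n s \<omega>"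
    if st: "0 \<le> s" "s < t" for s t n m
  proof (rule mart_constant_while_good[OF mart_diff[OF Mm Vm] _ st])
    show "AE \<omega> in ?p. continuous_on {0..} (\<lambda>t. M t \<omega> - V n t \<omega>)"
      using OK AE_space by eventually_elim (intro continuous_on_diff Vc okM)
    show "AE \<omega> in ?p. \<forall>r. s < r \<and> r \<le> t \<and> (\<forall>g\<in>\<rat>. s \<le> g \<and> g < r \<longrightarrow> G1 n m g \<omega>) \<longrightarrow> M r \<omega> - V n r \<omega> \<le> M s \<omega> - V n s \<omega>"
      using OK
    proof (eventually_elim, intro allI impI)
      fix \<omega> r assume "OK \<omega>" "s < r \<and> r \<le> t \<and> (\<forall>g\<in>\<rat>. s \<le> g \<and> g < r \<longrightarrow> G1 n m g \<omega>)"
      then show "M r \<omega> - V n r \<omega> \<le> M s \<omega> - V n s \<omega>"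
        using key1[of \<omega> s r n m] Lmono[of \<omega> s r] st by auto
    qed
  qed (use G1m st in auto)
  have C2: "AE \<omega> in ?p. (\<forall>g\<in>\<rat>. s \<le> g \<and> g < t \<longrightarrow> G2 n m g \<omega>) \<longrightarrow> - V n t \<omega> = - V n s \<omega>"
    if st: "0 \<le> s" "s < t" for s t n m
  proof (rule mart_constant_while_good[OF mart_uminus[OF Vm] _ st])
    show "AE \<omega> in ?p. continuous_on {0..} (\<lambda>t. - V n t \<omega>)"
      using OK AE_space by eventually_elim (intro continuous_on_minus Vc)
    show "AE \<omega> in ?p. \<forall>r. s < r \<and> r \<le> t \<and> (\<forall>g\<in>\<rat>. s \<le> g \<and> g < r \<longrightarrow> G2 n m g \<omega>) \<longrightarrow> - V n r \<omega> \<le> - V n s \<omega>"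
      using OK
    proof (eventually_elim, intro allI impI)
      fix \<omega> r assume "OK \<omega>" "s < r \<and> r \<le> t \<and> (\<forall>g\<in>\<rat>. s \<le> g \<and> g < r \<longrightarrow> G2 n m g \<omega>)"
      then show "- V n r \<omega> \<le> - V n s \<omega>"
        using key2[of \<omega> s r n m] Lmono[of \<omega> s r] st by auto
    qed
  qed (use G2m st in auto)
  \<comment> \<open>Pairs of rational times, stopping indices n and margins m are countably many, so
    one null set serves all of them.\<close>
  define D where "D = {(s::real, t::real). s \<in> \<rat> \<and> t \<in> \<rat> \<and> 0 \<le> s \<and> s < t}"
  have cD: "countable D"
    by (rule countable_subset[of _ "\<rat> \<times> \<rat>"]) (auto simp: D_def countable_rat)
  have "AE \<omega> in ?p. \<forall>i\<in>D. \<forall>n m. (\<forall>g\<in>\<rat>. fst i \<le> g \<and> g < snd i \<longrightarrow> G1 n m g \<omega>) \<longrightarrow> M (snd i) \<omega> - V n (snd i) \<omega> = M (fst i) \<omega> - V n (fst i) \<omega>"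
    by (subst AE_ball_countable[OF cD], intro ballI, subst AE_all_countable, intro allI, subst AE_all_countable, intro allI C1) (auto simp: D_def)
  moreover have "AE \<omega> in ?p. \<forall>i\<in>D. \<forall>n m. (\<forall>g\<in>\<rat>. fst i \<le> g \<and> g < snd i \<longrightarrow> G2 n m g \<omega>) \<longrightarrow> - V n (snd i) \<omega> = - V n (fst i) \<omega>"
    by (subst AE_ball_countable[OF cD], intro ballI, subst AE_all_countable, intro allI, subst AE_all_countable, intro allI C2) (auto simp: D_def)
  ultimately have "AE \<omega> in ?p. AE s in stieltjes (\<lambda>r. L a r \<omega>). 0 \<le> s \<longrightarrow> Y s \<omega> = a"
    using OK Tlim
  proof eventually_elim
    fix \<omega>
    assume 1: "\<forall>i\<in>D. \<forall>n m. (\<forall>g\<in>\<rat>. fst i \<le> g \<and> g < snd i \<longrightarrow> G1 n m g \<omega>) \<longrightarrow> M (snd i) \<omega> - V n (snd i) \<omega> = M (fst i) \<omega> - V n (fst i) \<omega>"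
      and 2: "\<forall>i\<in>D. \<forall>n m. (\<forall>g\<in>\<rat>. fst i \<le> g \<and> g < snd i \<longrightarrow> G2 n m g \<omega>) \<longrightarrow> - V n (snd i) \<omega> = - V n (fst i) \<omega>"
      and ok: "OK \<omega>" and Tl: "filterlim (\<lambda>n. T n \<omega>) at_top sequentially"
    show "AE s in stieltjes (\<lambda>r. L a r \<omega>). 0 \<le> s \<longrightarrow> Y s \<omega> = a"
    proof (rule stieltjes_null_off_level)
      show "continuous_on {0..} (\<lambda>r. L a r \<omega>)" "mono_on {0..} (\<lambda>r. L a r \<omega>)" using ok by (auto simp: OK_def)
      show "continuous_on {0..} (\<lambda>s. Y s \<omega>)" by (rule Yc[OF ok])
      fix s t m assume st: "s \<in> \<rat>" "t \<in> \<rat>" "0 \<le> s" "s < t"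
        and Y: "(\<forall>r\<in>{s..t}. Y r \<omega> < a - 1 / real (Suc m)) \<or> (\<forall>r\<in>{s..t}. a + 1 / real (Suc m) < Y r \<omega>)"
      have D: "(s, t) \<in> D" using st by (simp add: D_def)
      \<comment> \<open>The index n depends on the path, which is why the exceptional sets were
        collected over all n.\<close>
      obtain n where n: "t \<le> T n \<omega>"
        using Tl unfolding filterlim_at_top eventually_sequentially by blast
      note Yq = okY[OF ok]
      from Y show "L a t \<omega> = L a s \<omega>"
      proof
        assume *: "\<forall>r\<in>{s..t}. Y r \<omega> < a - 1 / real (Suc m)"
        have G: "G1 n m g \<omega>" if "s \<le> g" "g < t" for g
          using *[rule_format, of g] that n st Yq[of g] by (auto simp: G1_def)
        then have "M t \<omega> - V n t \<omega> = M s \<omega> - V n s \<omega>" using 1[rule_format, OF D, of n m] by simp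
        with key1[OF ok st(3,4), of n m] G show ?thesis by simp
      next
        assume *: "\<forall>r\<in>{s..t}. a + 1 / real (Suc m) < Y r \<omega>"
        have G: "G2 n m g \<omega>" if "s \<le> g" "g < t" for g
          using *[rule_format, of g] that n st Yq[of g] by (auto simp: G2_def)
        then have "- V n t \<omega> = - V n s \<omega>" using 2[rule_format, OF D, of n m] by simp
        with key2[OF ok st(3,4), of n m] G show ?thesis by simp
      qed
    qed
  qed
  then show ?thesis unfolding Y_def AE_completion_iff .
qed

section \<open>Markov property and resolvent\<close>

text \<open>The \<open>+ 1\<close> puts the point strictly after s, also when s itself is dyadic, so
  that these points approach s within \<open>at_right s\<close>.\<close>

definition dyadic_after :: "nat \<Rightarrow> real \<Rightarrow> real" where
  "dyadic_after n s = (of_int \<lfloor>2 ^ n * s\<rfloor> + 1) / 2 ^ n"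

lemma dyadic_after_gt: "s < dyadic_after n s" "dyadic_after n s \<le> s + (1 / 2) ^ n"
proof -
  have p: "(0::real) < 2 ^ n" by simp
  have "2 ^ n * s < of_int \<lfloor>2 ^ n * s\<rfloor> + 1" "of_int \<lfloor>2 ^ n * s\<rfloor> + 1 \<le> 2 ^ n * s + 1" by linarith+
  then show "s < dyadic_after n s" "dyadic_after n s \<le> s + (1 / 2) ^ n"
    using p by (simp_all add: dyadic_after_def field_simps power_divide)
qed

lemma dyadic_after_filterlim: "filterlim (\<lambda>n. dyadic_after n s) (at_right s) sequentially"
proof (rule tendsto_imp_filterlim_at_right)
  have "(\<lambda>n. s + (1 / 2) ^ n) \<longlonglongrightarrow> s + 0"
    by (intro tendsto_intros LIMSEQ_realpow_zero) auto
  then have *: "(\<lambda>n. s + (1 / 2) ^ n) \<longlonglongrightarrow> s" by simp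
  show "(\<lambda>n. dyadic_after n s) \<longlonglongrightarrow> s"
    by (rule tendsto_sandwich[OF _ _ tendsto_const *])
      (auto intro!: always_eventually less_imp_le dyadic_after_gt)
qed (auto intro!: always_eventually dyadic_after_gt)

lemma measurable_dyadic_after:
  assumes h: "\<And>t. 0 \<le> t \<Longrightarrow> h t \<in> measurable M N"
  shows "(\<lambda>(s, \<omega>). h (dyadic_after n (max 0 s)) \<omega>) \<in> measurable (borel \<Otimes>\<^sub>M M) N"
proof -
  \<comment> \<open>The absolute value keeps the time nonnegative for every integer k, as the
    assumption on \<open>h\<close> demands, and changes nothing for the integers that occur.\<close>
  have *: "(\<lambda>x. (\<lambda>k x. h ((of_int \<bar>k\<bar> + 1) / 2 ^ n) (snd x)) \<lfloor>(2::real) ^ n * max 0 (fst x)\<rfloor> x) \<in> measurable (borel \<Otimes>\<^sub>M M) N"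
  proof (rule measurable_compose_countable[where f="\<lambda>k x. h ((of_int \<bar>k\<bar> + 1) / 2 ^ n) (snd x)" and g="\<lambda>x. \<lfloor>(2::real) ^ n * max 0 (fst x)\<rfloor>"])
    fix k :: int
    have [measurable]: "h ((of_int \<bar>k\<bar> + 1) / 2 ^ n) \<in> measurable M N" by (rule h) simp
    show "(\<lambda>x. h ((of_int \<bar>k\<bar> + 1) / 2 ^ n) (snd x)) \<in> measurable (borel \<Otimes>\<^sub>M M) N" by measurable
  qed measurable
  have eq: "(\<lambda>x. (\<lambda>k x. h ((of_int \<bar>k\<bar> + 1) / 2 ^ n) (snd x)) \<lfloor>(2::real) ^ n * max 0 (fst x)\<rfloor> x)
      = (\<lambda>(s, \<omega>). h (dyadic_after n (max 0 s)) \<omega>)"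
  proof (rule ext)
    fix x :: "real \<times> 'a"
    have "(0::real) \<le> 2 ^ n * max 0 (fst x)" by simp
    then have "0 \<le> \<lfloor>(2::real) ^ n * max 0 (fst x)\<rfloor>" by (simp only: zero_le_floor)
    then show "(\<lambda>k x. h ((of_int \<bar>k\<bar> + 1) / 2 ^ n) (snd x)) \<lfloor>(2::real) ^ n * max 0 (fst x)\<rfloor> x = (\<lambda>(s, \<omega>). h (dyadic_after n (max 0 s)) \<omega>) x"
      by (simp add: dyadic_after_def split_beta')
  qed
  show ?thesis using * unfolding eq .
qed

text \<open>Sampling at the next dyadic time uses countably many time values and is therefore
  jointly measurable; right continuity makes the samples converge.\<close>

lemma borel_measurable_right_continuous_process:
  fixes h :: "real \<Rightarrow> 'w \<Rightarrow> 'b::metric_space"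
  assumes h: "\<And>t. 0 \<le> t \<Longrightarrow> h t \<in> borel_measurable M"
    and rc: "\<And>t \<omega>. 0 \<le> t \<Longrightarrow> \<omega> \<in> space M \<Longrightarrow> ((\<lambda>s. h s \<omega>) \<longlongrightarrow> h t \<omega>) (at_right t)"
  shows "(\<lambda>(s, \<omega>). h (max 0 s) \<omega>) \<in> borel_measurable (borel \<Otimes>\<^sub>M M)"
proof (rule borel_measurable_LIMSEQ_metric)
  show "(\<lambda>(s, \<omega>). h (dyadic_after n (max 0 s)) \<omega>) \<in> borel_measurable (borel \<Otimes>\<^sub>M M)" for n
    by (rule measurable_dyadic_after[OF h])
  fix x :: "real \<times> 'w" assume x: "x \<in> space (borel \<Otimes>\<^sub>M M)"
  obtain s \<omega> where [simp]: "x = (s, \<omega>)" by (cases x)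
  show "(\<lambda>n. case x of (s, \<omega>) \<Rightarrow> h (dyadic_after n (max 0 s)) \<omega>) \<longlonglongrightarrow> (case x of (s, \<omega>) \<Rightarrow> h (max 0 s) \<omega>)"
    using x by (auto simp: space_pair_measure intro!: filterlim_compose[OF rc dyadic_after_filterlim])
qed

lemma borel_measurable_right_continuous_process_ennreal:
  fixes h :: "real \<Rightarrow> 'w \<Rightarrow> ennreal"
  assumes h: "\<And>t. 0 \<le> t \<Longrightarrow> h t \<in> borel_measurable M"
    and rc: "\<And>t \<omega>. 0 \<le> t \<Longrightarrow> \<omega> \<in> space M \<Longrightarrow> ((\<lambda>s. h s \<omega>) \<longlongrightarrow> h t \<omega>) (at_right t)"
  shows "(\<lambda>(s, \<omega>). h (max 0 s) \<omega>) \<in> borel_measurable (borel \<Otimes>\<^sub>M M)"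
proof (rule borel_measurable_LIMSEQ_order)
  show "(\<lambda>(s, \<omega>). h (dyadic_after n (max 0 s)) \<omega>) \<in> borel_measurable (borel \<Otimes>\<^sub>M M)" for n
    by (rule measurable_dyadic_after[OF h])
  fix x :: "real \<times> 'w" assume x: "x \<in> space (borel \<Otimes>\<^sub>M M)"
  obtain s \<omega> where [simp]: "x = (s, \<omega>)" by (cases x)
  show "(\<lambda>n. case x of (s, \<omega>) \<Rightarrow> h (dyadic_after n (max 0 s)) \<omega>) \<longlonglongrightarrow> (case x of (s, \<omega>) \<Rightarrow> h (max 0 s) \<omega>)"
    using x by (auto simp: space_pair_measure intro!: filterlim_compose[OF rc dyadic_after_filterlim])
qed

section \<open>The laws as a kernel, the Markov property for integrals, resolvents of continuous
  functions\<close>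

context right_process begin

abbreviation borel_points :: "'e measure" where "borel_points \<equiv> restrict_space borel (points W)"

abbreviation univ_points :: "'e measure" where "univ_points \<equiv> universal_completion borel_points"

abbreviation univ_St :: "'e measure" where "univ_St \<equiv> universal_completion (restrict_space borel (St W))"

lemma X_nat [measurable]: "0 \<le> t \<Longrightarrow> X W t \<in> borel_measurable nat_alg"
  by (rule measurable_X_natural) simp

lemma X_points: "0 \<le> t \<Longrightarrow> X W t \<in> measurable nat_alg borel_points"
  using X_in_points[of t] by (intro measurable_restrict_space2 X_nat) auto

lemma X_univ_points:
  assumes "prob_space p" "sets p = sets nat_alg" "0 \<le> t"
  shows "X W t \<in> measurable (completion p) univ_points"
  using X_points[OF assms(3)] assms(1,2)
  by (intro measurable_completion_universal) (simp_all cong: measurable_cong_sets)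

lemma X_joint: "(\<lambda>(s, \<omega>). X W (max 0 s) \<omega>) \<in> borel_measurable (borel \<Otimes>\<^sub>M nat_alg)"
  by (rule borel_measurable_right_continuous_process) (auto intro: right_cont)

lemma kernel_P: "P W \<in> measurable univ_points (subprob_algebra nat_alg)"
proof (rule measurable_subprob_algebra)
  fix x assume "x \<in> space univ_points"
  then have "x \<in> points W" by simp
  then show "subprob_space (P W x)" "sets (P W x) = sets nat_alg"
    using prob_space_imp_subprob_space[OF prob_space_P] sets_P by simp_all
qed (rule measurable_P)

lemma Shift_nat:
  assumes t: "0 \<le> t" shows "Shift W t \<in> measurable nat_alg nat_alg"
proof (rule measurable_sigma_sets[OF sets_natural_alg])
  fix A assume "A \<in> {X W s -` B \<inter> Paths W |s B. s \<in> {0..} \<and> B \<in> sets borel}"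
  then obtain s B where A: "A = X W s -` B \<inter> Paths W" "0 \<le> s" "B \<in> sets borel" by auto
  have "Shift W t -` A \<inter> space nat_alg = X W (s + t) -` B \<inter> space nat_alg"
    using A t Shift_in_Paths X_Shift by auto
  also have "\<dots> \<in> sets nat_alg"
    using A t by (intro measurable_sets[OF X_nat]) auto
  finally show "Shift W t -` A \<inter> space nat_alg \<in> sets nat_alg" .
qed (use Shift_in_Paths[OF t] in auto)

lemma nn_integral_P_univ:
  assumes "(\<lambda>(y, \<omega>). F y \<omega>) \<in> borel_measurable (M \<Otimes>\<^sub>M nat_alg)" "K \<in> measurable M univ_points"
  shows "(\<lambda>y. \<integral>\<^sup>+\<omega>. F y \<omega> \<partial>P W (K y)) \<in> borel_measurable M"
  by (rule nn_integral_measurable_subprob_algebra2[OF assms(1) measurable_compose[OF assms(2) kernel_P]])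

text \<open>With the whole path space as earlier event, the axiom \<open>markov\<close> equates two
  measures on paths: the law of the shifted path and a mixture of the laws \<open>P W\<close>. The
  kernel is only universally measurable, hence the passage to the completion of
  \<open>P W x\<close>.\<close>

lemma markov_nn_integral:
  assumes x: "x \<in> points W" and t: "0 \<le> t" and F: "F \<in> borel_measurable nat_alg"
  shows "(\<integral>\<^sup>+\<omega>. F (Shift W t \<omega>) \<partial>P W x) = (\<integral>\<^sup>+\<omega>. \<integral>\<^sup>+\<omega>'. F \<omega>' \<partial>P W (X W t \<omega>) \<partial>P W x)"
proof -
  let ?p = "completion (P W x)"
  interpret prob_space "P W x" by (rule prob_space_P[OF x])
  have K: "(\<lambda>\<omega>. P W (X W t \<omega>)) \<in> measurable ?p (subprob_algebra nat_alg)"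
    by (rule measurable_compose[OF X_univ_points kernel_P]) (use sets_P[OF x] t prob_space_axioms in auto)
  have S: "Shift W t \<in> measurable (P W x) nat_alg"
    using Shift_nat[OF t] sets_P[OF x] by (simp cong: measurable_cong_sets)
  have ne: "space ?p \<noteq> {}" using not_empty by simp
  have "distr (P W x) nat_alg (Shift W t) = ?p \<bind> (\<lambda>\<omega>. P W (X W t \<omega>))"
  proof (rule measure_eqI)
    show "sets (distr (P W x) nat_alg (Shift W t)) = sets (?p \<bind> (\<lambda>\<omega>. P W (X W t \<omega>)))"
      using sets_bind[OF sets_kernel[OF K] ne] by simp
    fix \<Gamma> assume "\<Gamma> \<in> sets (distr (P W x) nat_alg (Shift W t))"
    then have \<Gamma>: "\<Gamma> \<in> sets nat_alg" by simp
    have "emeasure (distr (P W x) nat_alg (Shift W t)) \<Gamma> = emeasure (P W x) (Paths W \<inter> Shift W t -` \<Gamma>)"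
      using S \<Gamma> by (subst emeasure_distr) (auto simp: space_P[OF x] Int_commute)
    also have "\<dots> = (\<integral>\<^sup>+\<omega>. indicator (Paths W) \<omega> * emeasure (P W (X W t \<omega>)) \<Gamma> \<partial>P W x)"
      using sets.top[of "natural_alg W {0..t}"] by (intro markov[OF x t _ \<Gamma>]) simp
    also have "\<dots> = (\<integral>\<^sup>+\<omega>. emeasure (P W (X W t \<omega>)) \<Gamma> \<partial>?p)"
      unfolding nn_integral_completion by (intro nn_integral_cong) (simp add: space_P[OF x])
    also have "\<dots> = emeasure (?p \<bind> (\<lambda>\<omega>. P W (X W t \<omega>))) \<Gamma>"
      by (rule emeasure_bind[OF ne K \<Gamma>, symmetric])
    finally show "emeasure (distr (P W x) nat_alg (Shift W t)) \<Gamma> = emeasure (?p \<bind> (\<lambda>\<omega>. P W (X W t \<omega>))) \<Gamma>" .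
  qed
  then have "(\<integral>\<^sup>+\<omega>. F \<omega> \<partial>distr (P W x) nat_alg (Shift W t)) = (\<integral>\<^sup>+\<omega>. F \<omega> \<partial>(?p \<bind> (\<lambda>\<omega>. P W (X W t \<omega>))))"
    by simp
  then show ?thesis
    using nn_integral_distr[OF S, of F] F nn_integral_bind[OF F K] by (simp add: nn_integral_completion)
qed

lemma AE_P_Cem: "AE \<omega> in P W (Cem W). \<forall>s\<ge>0. X W s \<omega> = Cem W"
  using normal[OF Cem_points] AE_space
proof eventually_elim
  fix \<omega> assume "X W 0 \<omega> = Cem W" "\<omega> \<in> space (P W (Cem W))"
  then show "\<forall>s\<ge>0. X W s \<omega> = Cem W"
    using absorbing[of 0 _ \<omega>] space_P[OF Cem_points] by auto
qed

lemma points_cases: "x \<in> points W \<Longrightarrow> x \<notin> St W \<longleftrightarrow> x = Cem W"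
  using cemetery by (auto simp: points_def)

lemma St_borel_points: "St W \<in> sets borel_points"
proof -
  have "St W = points W - {Cem W}" using cemetery by (auto simp: points_def)
  then show ?thesis using sets.top[of borel_points] singleton_points[OF Cem_points] by (simp del: sets.top)
qed

text \<open>The exponential density is \<alpha> exp (- \<alpha> s), so the expectation of
  \<open>G \<alpha>\<close> is \<alpha> times the \<alpha>-resolvent of f. It is \<alpha>-excessive,
  and as the rate grows it tends to f because paths start at x and are right continuous. This is how
  continuous functions are seen to be measurable for \<open>state_alg W\<close>.\<close>

lemma excessive_resolvent:
  fixes f :: "'e \<Rightarrow> real"
  assumes f: "continuous_on UNIV f" "\<And>x. 0 \<le> f x" "\<And>x. f x \<le> 1" and \<alpha>: "0 < \<alpha>"
  defines "G \<equiv> \<lambda>\<alpha> \<omega>. \<integral>\<^sup>+s. ennreal (exponential_density \<alpha> s) * ext0 W (\<lambda>x. ennreal (f x)) (X W (max 0 s) \<omega>) \<partial>lborel"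
  shows "excessive W \<alpha> (\<lambda>x. \<integral>\<^sup>+\<omega>. G \<alpha> \<omega> \<partial>P W x)"
    and "x \<in> St W \<Longrightarrow> (\<lambda>n. \<integral>\<^sup>+\<omega>. G (real (Suc n)) \<omega> \<partial>P W x) \<longlonglongrightarrow> ennreal (f x)"
proof -
  let ?e = "\<lambda>\<alpha> s. ennreal (exponential_density \<alpha> s)"
  define g where "g = ext0 W (\<lambda>x. ennreal (f x))"
  define R where "R \<alpha> x = (\<integral>\<^sup>+\<omega>. G \<alpha> \<omega> \<partial>P W x)" for \<alpha> x
  have em[measurable]: "(\<lambda>s. exponential_density \<alpha> s) \<in> borel_measurable borel" for \<alpha>
    by measurable
  have g1: "g y \<le> 1" for y using f(3) by (simp add: g_def ext0_def)
  have fm[measurable]: "f \<in> borel_measurable borel" by (rule borel_measurable_continuous_onI[OF f(1)])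
  have gX: "g (X W s \<omega>) = (if X W s \<omega> = Cem W then 0 else ennreal (f (X W s \<omega>)))" if "0 \<le> s" "\<omega> \<in> Paths W" for s \<omega>
    using X_in_points[OF that] cemetery by (auto simp: g_def ext0_def points_def)
  have gCem: "g (Cem W) = 0" using cemetery by (simp add: g_def ext0_def)
  have gj: "(\<lambda>(s, \<omega>). g (X W (max 0 s) \<omega>)) \<in> borel_measurable (borel \<Otimes>\<^sub>M nat_alg)"
  proof -
    note X_joint[measurable]
    have "(\<lambda>x. if (\<lambda>(s, \<omega>). X W (max 0 s) \<omega>) x = Cem W then 0 else ennreal (f ((\<lambda>(s, \<omega>). X W (max 0 s) \<omega>) x)))
        \<in> borel_measurable (borel \<Otimes>\<^sub>M nat_alg)" by measurable
    then show ?thesis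
      by (rule iffD1[OF measurable_cong, rotated]) (use cemetery in \<open>auto simp: space_pair_measure gX gCem\<close>)
  qed
  have gj': "(\<lambda>(\<omega>, s). g (X W (max 0 s) \<omega>)) \<in> borel_measurable (nat_alg \<Otimes>\<^sub>M lborel)"
    using measurable_compose[OF measurable_pair_swap' gj] by (simp add: split_beta' cong: measurable_cong_sets)
  have gs: "(\<lambda>s. g (X W (max 0 s) \<omega>)) \<in> borel_measurable borel" if "\<omega> \<in> Paths W" for \<omega>
    using measurable_Pair2[OF gj', of \<omega>] that by simp
  have Gm: "G \<alpha> \<in> borel_measurable nat_alg" for \<alpha>
    unfolding G_def g_def[symmetric] using gj'
    by (intro sigma_finite_measure.borel_measurable_nn_integral[OF sigma_finite_lborel]) (simp add: split_beta')
  have e1: "(\<integral>\<^sup>+s. ?e \<alpha> s \<partial>lborel) = 1" if "0 < \<alpha>" for \<alpha>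
    using prob_space.emeasure_space_1[OF prob_space_exponential_density[OF that]] by (simp add: emeasure_density)
  have G1: "G \<alpha> \<omega> \<le> 1" if "0 < \<alpha>" for \<alpha> \<omega>
  proof -
    have "G \<alpha> \<omega> \<le> (\<integral>\<^sup>+s. ?e \<alpha> s * 1 \<partial>lborel)"
      unfolding G_def g_def[symmetric] by (intro nn_integral_mono mult_left_mono g1) simp
    then show ?thesis using e1[OF that] by simp
  qed
  have R1: "R \<alpha> x \<le> 1" if "x \<in> points W" "0 < \<alpha>" for x \<alpha>
  proof -
    have "R \<alpha> x \<le> (\<integral>\<^sup>+\<omega>. 1 \<partial>P W x)" unfolding R_def by (intro nn_integral_mono G1 that)
    then show ?thesis using prob_space.emeasure_space_1[OF prob_space_P[OF that(1)]] by simp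
  qed
  have Rm: "R \<alpha> \<in> borel_measurable univ_points" for \<alpha>
    unfolding R_def using Gm by (intro nn_integral_P_univ[where K="\<lambda>x. x"]) auto
  have RSt: "R \<alpha> \<in> borel_measurable univ_St" for \<alpha>
  proof -
    have "(\<lambda>x. x) \<in> measurable (restrict_space borel (St W)) borel_points"
      by (intro measurable_restrict_space2 measurable_restrict_space1) (auto simp: space_restrict_space points_def)
    from measurable_compose[OF measurable_universal_completion_map[OF this] Rm] show ?thesis .
  qed
  \<comment> \<open>Since the resolvent vanishes at the cemetery, \<open>ext0\<close> does not alter
    it, and \<open>semigroup_op\<close> can be evaluated by the Markov property.\<close>
  have RCem: "R \<alpha> (Cem W) = 0" for \<alpha>
  proof -
    have "R \<alpha> (Cem W) = (\<integral>\<^sup>+\<omega>. 0 \<partial>P W (Cem W))"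
      unfolding R_def
    proof (intro nn_integral_cong_AE, use AE_P_Cem in eventually_elim)
      fix \<omega> assume "\<forall>s\<ge>0. X W s \<omega> = Cem W"
      then show "G \<alpha> \<omega> = 0" using cemetery by (simp add: G_def ext0_def)
    qed
    then show ?thesis by simp
  qed
  \<comment> \<open>Translating the exponential density by t reproduces it up to the discount
    factor, so shifting the path and discounting cuts off the part of the integral before t.\<close>
  have GS: "ennreal (exp (- \<alpha> * t)) * G \<alpha> (Shift W t \<omega>) = (\<integral>\<^sup>+s. indicator {t..} s * (?e \<alpha> s * g (X W (max 0 s) \<omega>)) \<partial>lborel)"
    if \<omega>: "\<omega> \<in> Paths W" and t: "0 \<le> t" for \<omega> t
  proof -
    note gs[OF \<omega>, measurable]
    have "G \<alpha> (Shift W t \<omega>) = (\<integral>\<^sup>+s. ?e \<alpha> s * g (X W (max 0 (t + 1 * s)) \<omega>) \<partial>lborel)"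
      unfolding G_def g_def[symmetric] using t X_Shift[OF _ t \<omega>]
      by (intro nn_integral_cong) (auto simp: exponential_density_def add.commute)
    also have "\<dots> = (\<integral>\<^sup>+s. ?e \<alpha> (s - t) * g (X W (max 0 s) \<omega>) \<partial>lborel)"
      by (subst (2) nn_integral_real_affine[where c=1 and t=t]) (auto simp: add.commute)
    finally have "ennreal (exp (- \<alpha> * t)) * G \<alpha> (Shift W t \<omega>)
        = (\<integral>\<^sup>+s. ennreal (exp (- \<alpha> * t)) * (?e \<alpha> (s - t) * g (X W (max 0 s) \<omega>)) \<partial>lborel)"
      by (simp add: nn_integral_cmult)
    also have "\<dots> = (\<integral>\<^sup>+s. indicator {t..} s * (?e \<alpha> s * g (X W (max 0 s) \<omega>)) \<partial>lborel)"
    proof (rule nn_integral_cong)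
      fix s
      have "ennreal (exp (- \<alpha> * t)) * ?e \<alpha> (s - t) = indicator {t..} s * ?e \<alpha> s"
        using t \<alpha> by (auto simp: exponential_density_def ennreal_mult'[symmetric] exp_add[symmetric] indicator_def algebra_simps)
      then show "ennreal (exp (- \<alpha> * t)) * (?e \<alpha> (s - t) * g (X W (max 0 s) \<omega>)) = indicator {t..} s * (?e \<alpha> s * g (X W (max 0 s) \<omega>))"
        by (simp add: mult.assoc[symmetric])
    qed
    finally show ?thesis .
  qed
  have PtR: "ennreal (exp (- \<alpha> * t)) * semigroup_op W t (R \<alpha>) x = (\<integral>\<^sup>+\<omega>. ennreal (exp (- \<alpha> * t)) * G \<alpha> (Shift W t \<omega>) \<partial>P W x)"
    if x: "x \<in> St W" and t: "0 \<le> t" for x t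
  proof -
    have GSm: "(\<lambda>\<omega>. G \<alpha> (Shift W t \<omega>)) \<in> borel_measurable (P W x)"
      using measurable_compose[OF Shift_nat[OF t] Gm] sets_P[OF St_points[OF x]] by (simp cong: measurable_cong_sets)
    have "semigroup_op W t (R \<alpha>) x = (\<integral>\<^sup>+\<omega>. R \<alpha> (X W t \<omega>) \<partial>P W x)"
      unfolding semigroup_op_def
    proof (rule nn_integral_cong)
      fix \<omega> assume "\<omega> \<in> space (P W x)"
      then have "X W t \<omega> \<in> points W" using X_in_points[OF t] space_P[OF St_points[OF x]] by simp
      then show "ext0 W (R \<alpha>) (X W t \<omega>) = R \<alpha> (X W t \<omega>)" using points_cases RCem by (auto simp: ext0_def)
    qed
    also have "\<dots> = (\<integral>\<^sup>+\<omega>. G \<alpha> (Shift W t \<omega>) \<partial>P W x)"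
      unfolding R_def by (rule markov_nn_integral[OF St_points[OF x] t Gm, symmetric])
    finally show ?thesis using GSm by (simp add: nn_integral_cmult)
  qed
  \<comment> \<open>The part cut off is at most \<alpha> times t, since the density is bounded by
    \<alpha> and f by 1. The first bound yields the supermedian inequality, the second the
    convergence as t tends to 0.\<close>
  have up: "ennreal (exp (- \<alpha> * t)) * G \<alpha> (Shift W t \<omega>) \<le> G \<alpha> \<omega>"
    "G \<alpha> \<omega> \<le> ennreal (exp (- \<alpha> * t)) * G \<alpha> (Shift W t \<omega>) + ennreal (\<alpha> * t)" if \<omega>: "\<omega> \<in> Paths W" and t: "0 \<le> t" for \<omega> t
  proof -
    note gs[OF \<omega>, measurable]
    show "ennreal (exp (- \<alpha> * t)) * G \<alpha> (Shift W t \<omega>) \<le> G \<alpha> \<omega>"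
      unfolding GS[OF \<omega> t] unfolding G_def g_def[symmetric] by (intro nn_integral_mono) (auto simp: indicator_def)
    have "G \<alpha> \<omega> \<le> (\<integral>\<^sup>+s. indicator {t..} s * (?e \<alpha> s * g (X W (max 0 s) \<omega>)) + ennreal \<alpha> * indicator {0..t} s \<partial>lborel)"
      unfolding G_def g_def[symmetric]
    proof (rule nn_integral_mono)
      fix s
      have "?e \<alpha> s * g (X W (max 0 s) \<omega>) \<le> ennreal \<alpha> * indicator {0..t} s" if "s < t"
      proof (cases "s < 0")
        case False
        have "?e \<alpha> s \<le> ennreal \<alpha>" using \<alpha> False by (auto simp: exponential_density_def intro!: ennreal_leI)
        then have "?e \<alpha> s * g (X W (max 0 s) \<omega>) \<le> ennreal \<alpha> * 1" by (intro mult_mono g1) auto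
        then show ?thesis using False that by simp
      qed (simp add: exponential_density_def)
      then show "?e \<alpha> s * g (X W (max 0 s) \<omega>) \<le> indicator {t..} s * (?e \<alpha> s * g (X W (max 0 s) \<omega>)) + ennreal \<alpha> * indicator {0..t} s"
        by (cases "s < t") (auto simp: indicator_def)
    qed
    also have "\<dots> = ennreal (exp (- \<alpha> * t)) * G \<alpha> (Shift W t \<omega>) + ennreal (\<alpha> * t)"
      unfolding GS[OF \<omega> t] using t \<alpha> by (subst nn_integral_add) (auto simp: nn_integral_cmult_indicator ennreal_mult')
    finally show "G \<alpha> \<omega> \<le> ennreal (exp (- \<alpha> * t)) * G \<alpha> (Shift W t \<omega>) + ennreal (\<alpha> * t)" .
  qed
  show "excessive W \<alpha> (\<lambda>x. \<integral>\<^sup>+\<omega>. G \<alpha> \<omega> \<partial>P W x)"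
    unfolding excessive_def R_def[symmetric]
  proof (intro conjI ballI allI impI RSt[of \<alpha>])
    fix x assume x: "x \<in> St W"
    note xp = St_points[OF x]
    interpret prob_space "P W x" by (rule prob_space_P[OF xp])
    let ?h = "\<lambda>t. ennreal (exp (- \<alpha> * t)) * semigroup_op W t (R \<alpha>) x"
    have b1: "?h t \<le> R \<alpha> x" if t: "0 \<le> t" for t
      unfolding PtR[OF x t] R_def by (intro nn_integral_mono up(1) t) (simp add: space_P[OF xp])
    then show "0 \<le> t \<Longrightarrow> ?h t \<le> R \<alpha> x" for t .
    have b2: "R \<alpha> x \<le> ?h t + ennreal (\<alpha> * t)" if t: "0 \<le> t" for t
    proof -
      have GSm: "(\<lambda>\<omega>. ennreal (exp (- \<alpha> * t)) * G \<alpha> (Shift W t \<omega>)) \<in> borel_measurable (P W x)"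
        using measurable_compose[OF Shift_nat[OF t] Gm] sets_P[OF xp] by (simp cong: measurable_cong_sets)
      have "R \<alpha> x \<le> (\<integral>\<^sup>+\<omega>. ennreal (exp (- \<alpha> * t)) * G \<alpha> (Shift W t \<omega>) + ennreal (\<alpha> * t) \<partial>P W x)"
        unfolding R_def by (intro nn_integral_mono up(2) t) (simp add: space_P[OF xp])
      also have "\<dots> = (\<integral>\<^sup>+\<omega>. ennreal (exp (- \<alpha> * t)) * G \<alpha> (Shift W t \<omega>) \<partial>P W x) + (\<integral>\<^sup>+\<omega>. ennreal (\<alpha> * t) \<partial>P W x)"
        by (rule nn_integral_add[OF GSm]) simp
      also have "\<dots> = ?h t + ennreal (\<alpha> * t)" unfolding PtR[OF x t] by (simp add: emeasure_space_1)
      finally show ?thesis .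
    qed
    obtain \<rho> where \<rho>: "R \<alpha> x = ennreal \<rho>" "0 \<le> \<rho>"
      using R1[OF xp \<alpha>] by (cases "R \<alpha> x") (auto simp: top_unique)
    show "(?h \<longlongrightarrow> R \<alpha> x) (at_right 0)"
    proof (rule tendsto_sandwich)
      have "((\<lambda>t. ennreal (\<rho> - \<alpha> * t)) \<longlongrightarrow> ennreal (\<rho> - \<alpha> * 0)) (at_right 0)"
        by (intro tendsto_intros)
      then show "((\<lambda>t. ennreal (\<rho> - \<alpha> * t)) \<longlongrightarrow> R \<alpha> x) (at_right 0)" using \<rho> by simp
      have "ennreal (\<rho> - \<alpha> * t) \<le> ?h t" if "0 < t" for t
      proof -
        have "ennreal (\<rho> - \<alpha> * t) = ennreal \<rho> - ennreal (\<alpha> * t)" using that \<alpha> by (simp add: ennreal_minus)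
        also have "\<dots> \<le> ?h t" using b2[of t] that \<rho> by (simp add: ennreal_minus_le_iff add.commute)
        finally show ?thesis .
      qed
      then show "eventually (\<lambda>t. ennreal (\<rho> - \<alpha> * t) \<le> ?h t) (at_right 0)"
        using eventually_at_right_less[of "0::real"] by (auto elim: eventually_mono)
      show "eventually (\<lambda>t. ?h t \<le> R \<alpha> x) (at_right 0)"
        using eventually_at_right_less[of "0::real"] b1 by (auto elim!: eventually_mono)
    qed auto
  qed
  show "(\<lambda>n. \<integral>\<^sup>+\<omega>. G (real (Suc n)) \<omega> \<partial>P W x) \<longlonglongrightarrow> ennreal (f x)" if x: "x \<in> St W"
  proof -
    note xp = St_points[OF x]
    interpret prob_space "P W x" by (rule prob_space_P[OF xp])
    have GmP: "G \<alpha> \<in> borel_measurable (P W x)" for \<alpha> using Gm sets_P[OF xp] by (simp cong: measurable_cong_sets)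
    have "(\<lambda>n. \<integral>\<^sup>+\<omega>. G (real (Suc n)) \<omega> \<partial>P W x) \<longlonglongrightarrow> (\<integral>\<^sup>+\<omega>. ennreal (f x) \<partial>P W x)"
    proof (rule nn_integral_dominated_convergence[where w="\<lambda>_. 1"])
      show "AE \<omega> in P W x. (\<lambda>n. G (real (Suc n)) \<omega>) \<longlonglongrightarrow> ennreal (f x)"
        using normal[OF xp] AE_space
      proof eventually_elim
        fix \<omega> assume X0: "X W 0 \<omega> = x" and "\<omega> \<in> space (P W x)"
        then have \<omega>: "\<omega> \<in> Paths W" using space_P[OF xp] by simp
        note gs[OF \<omega>, measurable]
        have Xl: "((\<lambda>s. X W s \<omega>) \<longlongrightarrow> x) (at_right 0)" using right_cont[of 0 \<omega>] \<omega> X0 by simp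
        have gl: "((\<lambda>s. g (X W s \<omega>)) \<longlongrightarrow> ennreal (f x)) (at_right 0)"
        proof -
          have "((\<lambda>s. ennreal (f (X W s \<omega>))) \<longlongrightarrow> ennreal (f x)) (at_right 0)"
            using f(1) Xl by (intro tendsto_ennrealI isCont_tendsto_compose[of x f]) (auto simp: continuous_on_eq_continuous_at)
          moreover have "x \<noteq> Cem W" using x cemetery by auto
          then have "eventually (\<lambda>s. X W s \<omega> \<noteq> Cem W) (at_right 0)"
            using Xl by (rule tendsto_imp_eventually_ne[rotated])
          then have "eventually (\<lambda>s. ennreal (f (X W s \<omega>)) = g (X W s \<omega>)) (at_right 0)"
            using eventually_at_right_less[of "0::real"] by eventually_elim (simp add: gX \<omega>)
          ultimately show ?thesis by (rule Lim_transform_eventually)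
        qed
        \<comment> \<open>Rescaling time normalizes the rate to 1, so that n appears in the argument
          of the path only and dominated convergence applies.\<close>
        have Geq: "G (real (Suc n)) \<omega> = (\<integral>\<^sup>+r. ?e 1 r * g (X W (max 0 (r / real (Suc n))) \<omega>) \<partial>lborel)" for n
        proof -
          let ?a = "real (Suc n)"
          have "G ?a \<omega> = ennreal \<bar>1 / ?a\<bar> * (\<integral>\<^sup>+r. ?e ?a (0 + 1 / ?a * r) * g (X W (max 0 (0 + 1 / ?a * r)) \<omega>) \<partial>lborel)"
            unfolding G_def g_def[symmetric] by (rule nn_integral_real_affine) auto
          also have "\<dots> = (\<integral>\<^sup>+r. ennreal (1 / ?a) * (?e ?a (r / ?a) * g (X W (max 0 (r / ?a)) \<omega>)) \<partial>lborel)"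
            by (subst nn_integral_cmult) (auto)
          also have "\<dots> = (\<integral>\<^sup>+r. ?e 1 r * g (X W (max 0 (r / ?a)) \<omega>) \<partial>lborel)"
          proof (rule nn_integral_cong)
            fix r
            have "exponential_density ?a (r / ?a) = ?a * exponential_density 1 r"
              by (simp add: exponential_density_def divide_less_0_iff)
            then have "ennreal (1 / ?a) * ?e ?a (r / ?a) = ?e 1 r"
              by (simp add: ennreal_mult'[symmetric] del: of_nat_Suc)
            then show "ennreal (1 / ?a) * (?e ?a (r / ?a) * g (X W (max 0 (r / ?a)) \<omega>)) = ?e 1 r * g (X W (max 0 (r / ?a)) \<omega>)"
              by (simp only: mult.assoc[symmetric])
          qed
          finally show ?thesis .
        qed
        have "(\<lambda>n. \<integral>\<^sup>+r. ?e 1 r * g (X W (max 0 (r / real (Suc n))) \<omega>) \<partial>lborel) \<longlonglongrightarrow> (\<integral>\<^sup>+r. ?e 1 r * ennreal (f x) \<partial>lborel)"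
        proof (rule nn_integral_dominated_convergence[where w="?e 1"])
          show "AE r in lborel. (\<lambda>n. ?e 1 r * g (X W (max 0 (r / real (Suc n))) \<omega>)) \<longlonglongrightarrow> ?e 1 r * ennreal (f x)"
          proof (rule AE_I2)
            fix r :: real
            show "(\<lambda>n. ?e 1 r * g (X W (max 0 (r / real (Suc n))) \<omega>)) \<longlonglongrightarrow> ?e 1 r * ennreal (f x)"
            proof (cases "0 < r")
              case True
              have "filterlim (\<lambda>n. r / real (Suc n)) (at_right 0) sequentially"
                using True by (intro tendsto_imp_filterlim_at_right lim_const_over_n[THEN LIMSEQ_Suc]) auto
              from filterlim_compose[OF gl this] have "(\<lambda>n. g (X W (r / real (Suc n)) \<omega>)) \<longlonglongrightarrow> ennreal (f x)" .
              moreover have "max 0 (r / real (Suc n)) = r / real (Suc n)" for n using True by simp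
              ultimately show ?thesis by (intro ennreal_tendsto_cmult) auto
            next
              case False
              have "g (X W 0 \<omega>) = ennreal (f x)" using X0 x by (simp add: g_def ext0_def)
              moreover have "max 0 (r / real (Suc n)) = 0" for n using False by (auto simp: max_def zero_le_divide_iff)
              ultimately show ?thesis by simp
            qed
          qed
          show "AE r in lborel. ?e 1 r * g (X W (max 0 (r / real (Suc n))) \<omega>) \<le> ?e 1 r" for n
            using mult_left_mono[OF g1, of "?e 1 _"] by simp
          show "(\<integral>\<^sup>+r. ?e 1 r \<partial>lborel) < \<infinity>" using e1[of 1] by simp
        qed measurable
        moreover have "(\<integral>\<^sup>+r. ?e 1 r * ennreal (f x) \<partial>lborel) = ennreal (f x)"
          using e1[of 1] by (simp add: nn_integral_multc)
        ultimately show "(\<lambda>n. G (real (Suc n)) \<omega>) \<longlonglongrightarrow> ennreal (f x)" unfolding Geq by simp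
      qed
    qed (use GmP G1 in \<open>auto simp: emeasure_space_1\<close>)
    then show ?thesis by (simp add: emeasure_space_1)
  qed
qed

end

text \<open>A probability measure on M restricts to a finite measure on S, possibly of mass less
  than 1 or even 0. The sigma-finite version of the completion lemma covers it.\<close>

lemma universal_completion_restrict:
  assumes S: "S \<in> sets M"
  shows "sets (universal_completion (restrict_space M S)) \<subseteq> sets (universal_completion M)"
proof
  fix A assume A: "A \<in> sets (universal_completion (restrict_space M S))"
  have AS: "A \<subseteq> S" using sets.sets_into_space[OF A] by (auto simp: space_restrict_space)
  show "A \<in> sets (universal_completion M)"
  proof (rule sets_universal_completionI)
    show "A \<subseteq> space M" using AS sets.sets_into_space[OF S] by auto
    fix \<mu> assume \<mu>: "prob_space \<mu>" "sets \<mu> = sets M"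
    interpret prob_space \<mu> by fact
    have S\<mu>: "S \<in> sets \<mu>" using S \<mu> by simp
    have "finite_measure (restrict_space \<mu> S)"
      by (rule finite_measure_restrict_space) (use S\<mu> in auto)
    then have "sigma_finite_measure (restrict_space \<mu> S)" by (rule finite_measure.sigma_finite_measure)
    moreover have "sets (restrict_space \<mu> S) = sets (restrict_space M S)"
      using \<mu>(2) by (rule sets_restrict_space_cong)
    ultimately have "A \<in> sets (completion (restrict_space \<mu> S))"
      using sets_universal_completion_sigma_finite A by blast
    then obtain B Z Z' where *: "A = B \<union> Z" "Z \<subseteq> Z'" "Z' \<in> null_sets (restrict_space \<mu> S)" "B \<in> sets (restrict_space \<mu> S)"
      by (auto elim!: sets_completionE)
    have "B \<in> sets \<mu>" using *(4) S\<mu> by (auto simp: sets_restrict_space)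
    moreover have "Z' \<in> null_sets \<mu>" using *(3) S\<mu> null_sets_restrict_space[OF S\<mu>] by auto
    ultimately show "A \<in> sets (completion \<mu>)" using *(1,2) by (intro sets_completionI) auto
  qed
qed

lemma universal_completion_cong:
  "sets M = sets N \<Longrightarrow> universal_completion M = universal_completion N"
  using sets_eq_imp_space_eq[of M N] by (simp add: universal_completion_def)

section \<open>The sigma-algebra generated by excessive functions\<close>

context right_process begin

lemma space_state_alg [simp]: "space (state_alg W) = St W"
  unfolding state_alg_def by (rule space_measure_of) auto

lemma sets_state_alg:
  "sets (state_alg W) = sigma_sets (St W) {f -` B \<inter> St W |f B \<alpha>. 0 \<le> \<alpha> \<and> excessive W \<alpha> f \<and> B \<in> sets borel}"
  unfolding state_alg_def by (rule sets_measure_of) auto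

lemma excessive_state_measurable:
  assumes "0 \<le> \<alpha>" "excessive W \<alpha> f" shows "f \<in> borel_measurable (state_alg W)"
proof (rule measurableI)
  fix B :: "ennreal set" assume "B \<in> sets borel"
  then show "f -` B \<inter> space (state_alg W) \<in> sets (state_alg W)"
    using assms by (auto simp: sets_state_alg intro!: sigma_sets.Basic)
qed simp

lemma continuous_state_measurable:
  fixes f :: "'e \<Rightarrow> real"
  assumes f: "continuous_on UNIV f" "\<And>x. 0 \<le> f x" "\<And>x. f x \<le> 1"
  shows "(\<lambda>x. ennreal (f x)) \<in> borel_measurable (state_alg W)"
proof (rule borel_measurable_LIMSEQ_order)
  fix n
  show "(\<lambda>x. \<integral>\<^sup>+\<omega>. \<integral>\<^sup>+s. ennreal (exponential_density (real (Suc n)) s) *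
      ext0 W (\<lambda>x. ennreal (f x)) (X W (max 0 s) \<omega>) \<partial>lborel \<partial>P W x) \<in> borel_measurable (state_alg W)"
    by (rule excessive_state_measurable[OF _ excessive_resolvent(1)[OF f]]) auto
next
  fix x assume "x \<in> space (state_alg W)"
  then show "(\<lambda>n. \<integral>\<^sup>+\<omega>. \<integral>\<^sup>+s. ennreal (exponential_density (real (Suc n)) s) *
      ext0 W (\<lambda>x. ennreal (f x)) (X W (max 0 s) \<omega>) \<partial>lborel \<partial>P W x) \<longlonglongrightarrow> ennreal (f x)"
    by (intro excessive_resolvent(2)[OF f, where \<alpha>=1]) auto
qed

text \<open>An open set V other than the whole space is where the continuous function
  \<open>min 1 (infdist x (- V))\<close> is positive, and such functions are limits of resolvents.
  The whole space is treated apart because \<open>infdist\<close> to the empty set is 0.\<close>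

lemma id_state_borel: "(\<lambda>x. x) \<in> borel_measurable (state_alg W)"
proof (rule borel_measurableI)
  fix V :: "'e set" assume V: "open V"
  show "(\<lambda>x. x) -` V \<inter> space (state_alg W) \<in> sets (state_alg W)"
  proof (cases "V = UNIV")
    case True then show ?thesis using sets.top[of "state_alg W"] by simp
  next
    case False
    define f where "f x = min 1 (infdist x (- V))" for x
    have f: "continuous_on UNIV f" "\<And>x. 0 \<le> f x" "\<And>x. f x \<le> 1"
      unfolding f_def[abs_def] by (auto intro!: continuous_intros infdist_nonneg)
    note fm[measurable] = continuous_state_measurable[OF f]
    have "x \<in> V \<longleftrightarrow> 0 < ennreal (f x)" for x
    proof -
      have "0 < ennreal (f x) \<longleftrightarrow> 0 < infdist x (- V)" by (auto simp: f_def)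
      then show ?thesis
        using in_closed_iff_infdist_zero[of "- V" x] V False infdist_nonneg[of x "- V"]
        by (auto simp: closed_Compl less_le)
    qed
    then have "(\<lambda>x. x) -` V \<inter> space (state_alg W) = {x\<in>space (state_alg W). 0 < ennreal (f x)}" by auto
    also have "\<dots> \<in> sets (state_alg W)" by measurable
    finally show ?thesis .
  qed
qed

lemma id_state_points: "(\<lambda>x. x) \<in> measurable (state_alg W) borel_points"
  by (intro measurable_restrict_space2 id_state_borel) (auto simp: points_def)

text \<open>E differs from \<open>points W\<close> by one Borel point, so universally measurable
  sets of E remain so in the larger space.\<close>

lemma ext0_univ:
  fixes f :: "'e \<Rightarrow> ennreal"
  assumes "f \<in> borel_measurable univ_St"
  shows "ext0 W f \<in> borel_measurable univ_points"
proof (rule measurableI)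
  fix A :: "ennreal set" assume A: "A \<in> sets borel"
  have sp: "space univ_St = St W" by (simp add: space_restrict_space)
  have "sets (restrict_space borel_points (St W)) = sets (restrict_space borel (points W \<inter> St W))"
    by (rule sets_restrict_restrict_space)
  also have "points W \<inter> St W = St W" by (auto simp: points_def)
  finally have le: "sets univ_St \<subseteq> sets univ_points"
    using universal_completion_restrict[OF St_borel_points] universal_completion_cong by metis
  have "f -` A \<inter> St W \<in> sets univ_points" using measurable_sets[OF assms A] sp le by auto
  moreover have "{Cem W} \<in> sets univ_points"
    using singleton_points[OF Cem_points] sets_le_universal_completion by auto
  moreover have "ext0 W f -` A \<inter> space univ_points = (f -` A \<inter> St W) \<union> (if 0 \<in> A then {Cem W} else {})"
  proof -
    have "space univ_points = points W" by simp
    then show ?thesis using cemetery by (auto simp: ext0_def points_def simp del: space_universal_completion)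
  qed
  ultimately show "ext0 W f -` A \<inter> space univ_points \<in> sets univ_points"
    by (cases "0 \<in> A") (simp_all only: if_True if_False sets.Un Un_empty_right)
qed simp

text \<open>
  For \<open>B\<close> not Borel the process \<open>indicator B (X\<^sub>s)\<close> need not be jointly measurable. It is so off a
  null set because the generators of \<open>state_alg W\<close> are right continuous along the paths.
\<close>

lemma state_path_process_ex:
  assumes B: "B \<in> sets (state_alg W)" and \<mu>: "\<mu> \<in> initial_laws W"
  shows "\<exists>N\<in>null_sets (law_from W \<mu>). \<exists>H\<in>borel_measurable (borel \<Otimes>\<^sub>M completion (law_from W \<mu>)).
    \<forall>\<omega>\<in>Paths W - N. \<forall>s\<ge>0. ext0 W (indicator B) (X W s \<omega>) = (H (s, \<omega>) :: ennreal)"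
proof -
  let ?p = "law_from W \<mu>"
  interpret p: prob_space ?p by (rule prob_space_law_from[OF \<mu>])
  have Xj: "(\<lambda>(s, \<omega>). X W (max 0 s) \<omega>) \<in> borel_measurable (borel \<Otimes>\<^sub>M completion ?p)"
  proof -
    have 1: "X W s \<in> borel_measurable (completion ?p)" if "0 \<le> s" for s
      using X_nat[OF that] by (intro measurable_completion) (simp cong: measurable_cong_sets)
    show ?thesis
      by (rule borel_measurable_right_continuous_process[OF 1]) (auto intro: right_cont)
  qed
  \<comment> \<open>The indicator of not having reached the cemetery. It realizes
    \<open>ext0\<close> of the constant 1 and turns complements within E into differences.\<close>
  define live where "live = (\<lambda>(s, \<omega>). if X W (max 0 s) \<omega> = Cem W then 0 else 1 :: ennreal)"
  have live: "live \<in> borel_measurable (borel \<Otimes>\<^sub>M completion ?p)"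
  proof -
    note Xj[measurable]
    have "(\<lambda>x. if (\<lambda>(s, \<omega>). X W (max 0 s) \<omega>) x = Cem W then 0 else 1 :: ennreal) \<in> borel_measurable (borel \<Otimes>\<^sub>M completion ?p)"
      by measurable
    then show ?thesis by (simp add: live_def split_beta')
  qed
  have liveX: "live (s, \<omega>) = ext0 W (\<lambda>_. 1) (X W s \<omega>)" if "\<omega> \<in> Paths W" "0 \<le> s" for s \<omega>
    using X_in_points[OF that(2,1)] points_cases[of "X W s \<omega>"] cemetery that by (auto simp: live_def ext0_def)
  from B have "B \<in> sigma_sets (St W) {f -` B \<inter> St W |f B \<alpha>. 0 \<le> \<alpha> \<and> excessive W \<alpha> f \<and> B \<in> sets borel}"
    by (simp add: sets_state_alg)
  then show ?thesis
  proof induct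
    case (Basic A)
    then obtain f D \<alpha> where A: "A = f -` D \<inter> St W" "0 \<le> \<alpha>" "excessive W \<alpha> f" "D \<in> sets borel" by auto
    \<comment> \<open>The generators of \<open>state_alg W\<close> include index 0, whereas right
      continuity along paths is assumed for positive indices; an \<alpha>-excessive function is also
      excessive for \<alpha> + 1.\<close>
    have ex1: "excessive W (\<alpha> + 1) f"
      unfolding excessive_def
    proof (intro conjI ballI allI impI)
      show "f \<in> borel_measurable univ_St" using A(3) by (simp add: excessive_def)
      fix x assume x: "x \<in> St W"
      have *: "ennreal (exp (- (\<alpha> + 1) * t)) * semigroup_op W t f x = ennreal (exp (- t)) * (ennreal (exp (- \<alpha> * t)) * semigroup_op W t f x)" for t
        by (simp add: mult.assoc[symmetric] ennreal_mult'[symmetric] exp_add[symmetric] algebra_simps)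
      fix t :: real assume t: "0 \<le> t"
      have "ennreal (exp (- t)) * (ennreal (exp (- \<alpha> * t)) * semigroup_op W t f x) \<le> 1 * f x"
        using A(3) x t by (intro mult_mono) (auto simp: excessive_def ennreal_le_1)
      then show "ennreal (exp (- (\<alpha> + 1) * t)) * semigroup_op W t f x \<le> f x" unfolding * by simp
    next
      fix x assume x: "x \<in> St W"
      have *: "ennreal (exp (- (\<alpha> + 1) * t)) * semigroup_op W t f x = ennreal (exp (- t)) * (ennreal (exp (- \<alpha> * t)) * semigroup_op W t f x)" for t
        by (simp add: mult.assoc[symmetric] ennreal_mult'[symmetric] exp_add[symmetric] algebra_simps)
      have "((\<lambda>t. ennreal (exp (- t))) \<longlongrightarrow> ennreal (exp (- 0))) (at_right 0)" by (intro tendsto_intros)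
      moreover have "((\<lambda>t. ennreal (exp (- \<alpha> * t)) * semigroup_op W t f x) \<longlongrightarrow> f x) (at_right 0)"
        using A(3) x by (simp add: excessive_def)
      ultimately have "((\<lambda>t. ennreal (exp (- t)) * (ennreal (exp (- \<alpha> * t)) * semigroup_op W t f x)) \<longlongrightarrow> ennreal (exp (- 0)) * f x) (at_right 0)"
        by (rule tendsto_mult_ennreal) auto
      then show "((\<lambda>t. ennreal (exp (- (\<alpha> + 1) * t)) * semigroup_op W t f x) \<longlongrightarrow> f x) (at_right 0)" unfolding * by simp
    qed
    have "AE \<omega> in ?p. \<forall>t\<ge>0. ((\<lambda>s. ext0 W f (X W s \<omega>)) \<longlongrightarrow> ext0 W f (X W t \<omega>)) (at_right t)"
      using A(2) by (intro excessive_right_cont[OF \<mu> _ ex1]) simp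
    then obtain N where N: "N \<in> null_sets ?p" "{\<omega>\<in>space ?p. \<not> (\<forall>t\<ge>0. ((\<lambda>s. ext0 W f (X W s \<omega>)) \<longlongrightarrow> ext0 W f (X W t \<omega>)) (at_right t))} \<subseteq> N"
      by (auto elim!: AE_E simp: null_sets_def)
    have Nrc: "((\<lambda>s. ext0 W f (X W s \<omega>)) \<longlongrightarrow> ext0 W f (X W t \<omega>)) (at_right t)" if "\<omega> \<in> Paths W" "\<omega> \<notin> N" "0 \<le> t" for t \<omega>
      using N(2) that by auto
    \<comment> \<open>Set to 0 on the exceptional paths, so that right continuity holds along every
      path.\<close>
    define h where "h t \<omega> = (if \<omega> \<in> N then 0 else ext0 W f (X W t \<omega>))" for t \<omega>
    have hm: "h t \<in> borel_measurable (completion ?p)" if t: "0 \<le> t" for t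
    proof -
      have "(\<lambda>\<omega>. ext0 W f (X W t \<omega>)) \<in> borel_measurable (completion ?p)"
        using A(3) by (intro measurable_compose[OF X_univ_points[OF p.prob_space_axioms sets_law_from t] ext0_univ]) (simp add: excessive_def)
      moreover have "{\<omega>\<in>space (completion ?p). \<omega> \<in> N} \<in> sets (completion ?p)"
        using N(1) sets.sets_into_space[of N ?p] by (simp add: null_sets_def Collect_conj_eq Int_absorb1 del: sets_law_from)
      ultimately show ?thesis unfolding h_def[abs_def] by (intro measurable_If) auto
    qed
    have "(\<lambda>(s, \<omega>). h (max 0 s) \<omega>) \<in> borel_measurable (borel \<Otimes>\<^sub>M completion ?p)"
    proof (rule borel_measurable_right_continuous_process_ennreal[OF hm])
      fix t \<omega> assume t: "(0::real) \<le> t" "\<omega> \<in> space (completion ?p)"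
      show "((\<lambda>s. h s \<omega>) \<longlongrightarrow> h t \<omega>) (at_right t)"
        using Nrc[of \<omega> t] t by (cases "\<omega> \<in> N") (simp_all add: h_def)
    qed
    then have "(\<lambda>x. live x * indicator D ((\<lambda>(s, \<omega>). h (max 0 s) \<omega>) x)) \<in> borel_measurable (borel \<Otimes>\<^sub>M completion ?p)"
      using live A(4) by (intro borel_measurable_times_ennreal borel_measurable_indicator') auto
    moreover have "ext0 W (indicator A) (X W s \<omega>) = live (s, \<omega>) * indicator D ((\<lambda>(s, \<omega>). h (max 0 s) \<omega>) (s, \<omega>))"
      if "\<omega> \<in> Paths W - N" "0 \<le> s" for s \<omega>
      using that liveX[of \<omega> s] by (auto simp: h_def ext0_def A(1) indicator_def)
    ultimately show ?case using N(1) by (intro bexI[of _ N] bexI[of _ "\<lambda>x. live x * indicator D ((\<lambda>(s, \<omega>). h (max 0 s) \<omega>) x)"] ballI allI impI)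
  next
    case Empty
    show ?case by (intro bexI[of _ "{}"] bexI[of _ "\<lambda>_. 0"]) (auto simp: ext0_def)
  next
    case (Compl A)
    from Compl(2) obtain N H where N: "N \<in> null_sets ?p" and H: "H \<in> borel_measurable (borel \<Otimes>\<^sub>M completion ?p)"
      and HX: "\<forall>\<omega>\<in>Paths W - N. \<forall>s\<ge>0. ext0 W (indicator A) (X W s \<omega>) = (H (s, \<omega>) :: ennreal)" by (elim bexE) (rule that)
    have "ext0 W (indicator (St W - A)) (X W s \<omega>) = live (s, \<omega>) - H (s, \<omega>)" if "\<omega> \<in> Paths W - N" "0 \<le> s" for s \<omega>
      using HX[rule_format, OF that] liveX[of \<omega> s] that by (auto simp: ext0_def indicator_def split: if_splits)
    moreover have "(\<lambda>x. live x - H x) \<in> borel_measurable (borel \<Otimes>\<^sub>M completion ?p)"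
      using live H by (rule borel_measurable_minus_ennreal)
    ultimately show ?case using N by (intro bexI[of _ N] bexI[of _ "\<lambda>x. live x - H x"] ballI allI impI)
  next
    case (Union A)
    define R where "R i N H \<longleftrightarrow> N \<in> null_sets ?p \<and> H \<in> borel_measurable (borel \<Otimes>\<^sub>M completion ?p) \<and>
      (\<forall>\<omega>\<in>Paths W - N. \<forall>s\<ge>0. ext0 W (indicator (A i)) (X W s \<omega>) = (H (s, \<omega>) :: ennreal))" for i N H
    have "\<exists>N H. R i N H" for i
      using Union(2)[of i] unfolding R_def by (elim bexE) (intro exI conjI)
    then obtain N H where R: "R i (N i) (H i)" for i by metis
    have "ext0 W (indicator (\<Union>i. A i)) (X W s \<omega>) = (SUP i. H i (s, \<omega>))" if \<omega>: "\<omega> \<in> Paths W - (\<Union>i. N i)" and s: "0 \<le> s" for s \<omega>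
    proof -
      have "H i (s, \<omega>) = ext0 W (indicator (A i)) (X W s \<omega>)" for i using R[of i] \<omega> s unfolding R_def by auto
      then have "(SUP i. H i (s, \<omega>)) = (SUP i. ext0 W (indicator (A i)) (X W s \<omega>))" by simp
      also have "\<dots> = ext0 W (indicator (\<Union>i. A i)) (X W s \<omega>)"
      proof (cases "X W s \<omega> \<in> St W \<and> X W s \<omega> \<in> (\<Union>i. A i)")
        case True
        then obtain i where i: "X W s \<omega> \<in> A i" by auto
        show ?thesis
        proof (rule antisym)
          show "(SUP i. ext0 W (indicator (A i)) (X W s \<omega>)) \<le> (ext0 W (indicator (\<Union>i. A i)) (X W s \<omega>) :: ennreal)"
            using True by (intro SUP_least) (auto simp: ext0_def indicator_def)
          show "(ext0 W (indicator (\<Union>i. A i)) (X W s \<omega>) :: ennreal) \<le> (SUP i. ext0 W (indicator (A i)) (X W s \<omega>))"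
            using True i by (intro SUP_upper2[of i]) (auto simp: ext0_def)
        qed
      next
        case False
        then show ?thesis by (auto simp: ext0_def indicator_def)
      qed
      finally show ?thesis by simp
    qed
    moreover have "(\<Union>i. N i) \<in> null_sets ?p" using R by (intro null_sets_UN) (simp add: R_def)
    moreover have "(\<lambda>x. SUP i. H i x) \<in> borel_measurable (borel \<Otimes>\<^sub>M completion ?p)"
      using R by (intro borel_measurable_SUP) (auto simp: R_def)
    ultimately show ?case by (intro bexI[of _ "\<Union>i. N i"] bexI[of _ "\<lambda>x. SUP i. H i x"] ballI allI impI)
  qed
qed

section \<open>Passage from a dominating initial law to the reference measure\<close>

definition dominates :: "'e measure \<Rightarrow> 'e measure \<Rightarrow> bool" where
  "dominates \<mu> \<xi> \<longleftrightarrow> (\<forall>Z\<in>sets borel_points. emeasure \<mu> Z = 0 \<longrightarrow> emeasure \<xi> (Z \<inter> St W) = 0)"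

text \<open>A probability measure equivalent to \<xi> is transported from \<open>state_alg W\<close>
  to the Borel sets of \<open>points W\<close>. If \<xi> is zero it has no equivalent probability
  measure, but then every initial law dominates it.\<close>

lemma reference_initial_law_ex:
  assumes \<xi>: "excessive_reference_measure W \<xi>"
  shows "\<exists>\<mu>\<in>initial_laws W. dominates \<mu> \<xi>"
proof (cases "emeasure \<xi> (space \<xi>) = 0")
  case True
  have "emeasure \<xi> Z = 0" if "Z \<in> sets \<xi>" for Z
    using emeasure_space[of \<xi> Z] True by simp
  moreover have "emeasure \<xi> Z = 0" if "Z \<notin> sets \<xi>" for Z using that by (rule emeasure_notin_sets)
  ultimately show ?thesis using return_initial_law[OF Cem_points] unfolding dominates_def by blast
next
  case False
  have sets: "sets \<xi> = sets (state_alg W)" and sf: "sigma_finite_measure \<xi>"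
    using \<xi> by (auto simp: excessive_reference_measure_def)
  obtain D where D: "prob_space D" "sets D = sets \<xi>" "null_sets D = null_sets \<xi>"
    using equivalent_probability_ex[OF sf False] by blast
  have spD: "space D = St W" using sets_eq_imp_space_eq[of D "state_alg W"] D(2) sets by simp
  have idm: "(\<lambda>x. x) \<in> measurable D borel_points"
    using id_state_points sets D(2) by (simp cong: measurable_cong_sets)
  define \<mu> where "\<mu> = distr D borel_points (\<lambda>x. x)"
  have "\<mu> \<in> initial_laws W"
    using prob_space.prob_space_distr[OF D(1) idm] by (simp add: initial_laws_def \<mu>_def)
  moreover have "emeasure \<xi> (Z \<inter> St W) = 0" if Z: "Z \<in> sets borel_points" "emeasure \<mu> Z = 0" for Z
  proof -
    have "Z \<inter> St W \<in> sets D" using measurable_sets[OF idm Z(1)] spD by simp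
    moreover have "emeasure D (Z \<inter> St W) = 0"
      using Z(2) spD unfolding \<mu>_def by (subst (asm) emeasure_distr[OF idm Z(1)]) simp
    ultimately have "Z \<inter> St W \<in> null_sets D" by (simp add: null_sets_def)
    then show ?thesis unfolding D(3) by (rule null_setsD1)
  qed
  ultimately show ?thesis unfolding dominates_def by blast
qed

text \<open>Expectations as functions of the starting point are universally measurable; through this
  map they become measurable for the completion of \<xi>, as Tonelli's theorem requires.\<close>

lemma id_completion_reference:
  assumes \<xi>: "excessive_reference_measure W \<xi>"
  shows "(\<lambda>x. x) \<in> measurable (completion \<xi>) univ_points"
proof (rule measurableI)
  have sets: "sets \<xi> = sets (state_alg W)" and sf: "sigma_finite_measure \<xi>"
    using \<xi> by (auto simp: excessive_reference_measure_def)
  have sp: "space \<xi> = St W" using sets_eq_imp_space_eq[OF sets] by simp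
  fix A assume "A \<in> sets univ_points"
  from measurable_sets[OF measurable_universal_completion_map[OF id_state_points] this]
  show "(\<lambda>x. x) -` A \<inter> space (completion \<xi>) \<in> sets (completion \<xi>)"
    using sets_universal_completion_sigma_finite[OF sf sets] sp by auto
next
  fix x assume "x \<in> space (completion \<xi>)"
  then show "x \<in> space univ_points"
    using \<xi> sets_eq_imp_space_eq[of \<xi> "state_alg W"] by (auto simp: excessive_reference_measure_def St_points)
qed

lemma AE_reference_transfer:
  assumes \<xi>: "excessive_reference_measure W \<xi>" and \<mu>: "\<mu> \<in> initial_laws W"
    and dom: "dominates \<mu> \<xi>"
    and ae: "AE x in \<mu>. Q x"
  shows "AE x in \<xi>. Q x"
proof -
  have sets: "sets \<xi> = sets (state_alg W)" using \<xi> by (auto simp: excessive_reference_measure_def)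
  have sp: "space \<xi> = St W" using sets_eq_imp_space_eq[OF sets] by simp
  obtain Z where Z: "Z \<in> sets \<mu>" "emeasure \<mu> Z = 0" "{x\<in>space \<mu>. \<not> Q x} \<subseteq> Z"
    using ae by (auto elim!: AE_E)
  have Zb: "Z \<in> sets borel_points" using Z(1) initial_lawD(2)[OF \<mu>] by simp
  have "(\<lambda>x. x) -` Z \<inter> space (state_alg W) \<in> sets (state_alg W)" by (rule measurable_sets[OF id_state_points Zb])
  then have "Z \<inter> St W \<in> null_sets \<xi>" using dom Zb Z(2) sets by (simp add: null_sets_def dominates_def)
  then show ?thesis
    by (rule AE_I') (use Z(3) sp initial_lawD(3)[OF \<mu>] St_points in auto)
qed

lemma kernel_reference:
  assumes "excessive_reference_measure W \<xi>"
  shows "P W \<in> measurable (completion \<xi>) (subprob_algebra nat_alg)"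
  by (rule measurable_compose[OF id_completion_reference[OF assms] kernel_P])

text \<open>Excessivity of \<xi> is stated for sets of \<open>state_alg W\<close>, while k is
  universally measurable. It is therefore replaced by a Borel majorant with the same \<xi>-integral.
  A majorant everywhere, rather than a version almost everywhere, gives the comparison along the
  paths directly.\<close>

lemma excessive_integral_le:
  fixes k :: "'e \<Rightarrow> ennreal"
  assumes \<xi>: "excessive_reference_measure W \<xi>" and k: "k \<in> borel_measurable univ_points" "k (Cem W) = 0"
    and t: "0 \<le> t"
  shows "(\<integral>\<^sup>+x. \<integral>\<^sup>+\<omega>. k (X W t \<omega>) \<partial>P W x \<partial>\<xi>) \<le> (\<integral>\<^sup>+x. k x \<partial>\<xi>)"
proof (cases "St W = {}")
  case True
  have "space \<xi> = St W" using \<xi> sets_eq_imp_space_eq[of \<xi> "state_alg W"] by (auto simp: excessive_reference_measure_def)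
  then have "(\<integral>\<^sup>+x. \<integral>\<^sup>+\<omega>. k (X W t \<omega>) \<partial>P W x \<partial>\<xi>) = (\<integral>\<^sup>+x. 0 \<partial>\<xi>)"
    using True by (intro nn_integral_cong) auto
  then show ?thesis by simp
next
  case False
  have sets: "sets \<xi> = sets (state_alg W)" using \<xi> by (auto simp: excessive_reference_measure_def)
  have sp: "space \<xi> = St W" using sets_eq_imp_space_eq[OF sets] by simp
  obtain \<mu> where \<mu>: "\<mu> \<in> initial_laws W"
    and dom: "dominates \<mu> \<xi>"
    using reference_initial_law_ex[OF \<xi>] by blast
  note AEt = AE_reference_transfer[OF \<xi> \<mu> dom]
  have "k \<in> borel_measurable (completion \<mu>)"
    using k(1) sets_universal_completion_prob[OF initial_lawD(1,2)[OF \<mu>]] initial_lawD(3)[OF \<mu>]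
    by (auto simp: measurable_def)
  then obtain k' where k': "k' \<in> borel_measurable \<mu>" "AE x in \<mu>. k x = k' x"
    using completion_ex_borel_measurable by blast
  obtain Z where Z: "Z \<in> null_sets \<mu>" "{x\<in>space \<mu>. k x \<noteq> k' x} \<subseteq> Z"
    using k'(2) by (auto elim!: AE_E simp: null_sets_def)
  \<comment> \<open>The value \<infinity> on the exceptional set Z makes k2 an upper bound of k
    everywhere without changing the \<xi>-integral. Off E it is 0, as k is at the cemetery.\<close>
  define k2 where "k2 x = (if x \<in> St W then k' x + (if x \<in> Z then \<infinity> else 0) else 0)" for x
  have k2m: "k2 \<in> borel_measurable borel_points"
  proof -
    have [measurable]: "k' \<in> borel_measurable borel_points"
      using k'(1) initial_lawD(2)[OF \<mu>] by (simp cong: measurable_cong_sets)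
    have [measurable]: "Z \<in> sets borel_points" using Z(1) initial_lawD(2)[OF \<mu>] by auto
    note St_borel_points[measurable]
    show ?thesis unfolding k2_def[abs_def] by measurable
  qed
  have kk2: "k x \<le> k2 x" if "x \<in> points W" for x
    using that Z(2) initial_lawD(3)[OF \<mu>] k(2) points_cases[OF that] by (cases "x \<in> Z") (auto simp: k2_def)
  have k2int: "(\<integral>\<^sup>+x. k2 x \<partial>\<xi>) = (\<integral>\<^sup>+x. k x \<partial>\<xi>)"
  proof (rule nn_integral_cong_AE)
    have "AE x in \<xi>. x \<notin> Z \<and> k x = k' x" by (rule AEt) (use AE_not_in[OF Z(1)] k'(2) in auto)
    then show "AE x in \<xi>. k2 x = k x" using AE_space by eventually_elim (simp add: k2_def sp)
  qed
  define K where "K x = distr (P W x) borel_points (X W t)" for x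
  have Km: "K \<in> measurable (completion \<xi>) (subprob_algebra borel_points)"
    unfolding K_def[abs_def]
    by (rule measurable_compose[OF kernel_reference[OF \<xi>] measurable_distr[OF X_points[OF t]]])
  define \<eta> where "\<eta> = completion \<xi> \<bind> K"
  have ne: "space (completion \<xi>) \<noteq> {}" using False sp by simp
  have s\<eta>: "sets \<eta> = sets borel_points" unfolding \<eta>_def using sets_bind[OF sets_kernel[OF Km] ne] by simp
  have XP: "X W t \<in> measurable (P W x) borel_points" if "x \<in> St W" for x
    using X_points[OF t] sets_P[OF St_points[OF that]] by (simp cong: measurable_cong_sets)
  have Kint: "(\<integral>\<^sup>+y. f y \<partial>K x) = (\<integral>\<^sup>+\<omega>. f (X W t \<omega>) \<partial>P W x)" if "f \<in> borel_measurable borel_points" "x \<in> St W" for f x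
    unfolding K_def using that XP by (intro nn_integral_distr) auto
  let ?\<xi> = "distr \<xi> borel_points (\<lambda>x. x)"
  let ?\<eta> = "density \<eta> (indicator (St W))"
  have idm: "(\<lambda>x. x) \<in> measurable \<xi> borel_points" using id_state_points sets by (simp cong: measurable_cong_sets)
  have St\<eta>: "St W \<in> sets \<eta>" using St_borel_points s\<eta> by simp
  \<comment> \<open>Here \<eta> is the distribution at time t of the process started from \<xi>, and
    the claim is excessivity for the trace of A on E.\<close>
  have le: "emeasure ?\<eta> A \<le> emeasure ?\<xi> A" if A: "A \<in> sets borel_points" for A
  proof -
    have AS: "A \<inter> St W \<in> sets borel_points" using A St_borel_points by simp
    have "(\<lambda>x. x) -` (A \<inter> St W) \<inter> space (state_alg W) \<in> sets (state_alg W)"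
      by (rule measurable_sets[OF id_state_points AS])
    then have AS\<xi>: "A \<inter> St W \<in> sets \<xi>" using sets by (simp add: Int_assoc)
    have "emeasure ?\<eta> A = emeasure \<eta> (A \<inter> St W)"
      using A St\<eta> s\<eta> by (subst emeasure_density) (auto simp: nn_integral_indicator[symmetric] simp del: nn_integral_indicator intro!: nn_integral_cong split: split_indicator)
    also have "\<dots> = (\<integral>\<^sup>+x. emeasure (K x) (A \<inter> St W) \<partial>\<xi>)"
      unfolding \<eta>_def by (subst emeasure_bind[OF ne Km AS]) (simp add: nn_integral_completion)
    also have "\<dots> = (\<integral>\<^sup>+x. semigroup_op W t (indicator (A \<inter> St W)) x \<partial>\<xi>)"
    proof (rule nn_integral_cong)
      fix x assume "x \<in> space \<xi>"
      then have x: "x \<in> St W" using sp by simp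
      have "emeasure (K x) (A \<inter> St W) = (\<integral>\<^sup>+y. indicator (A \<inter> St W) y \<partial>K x)"
        using AS by (subst nn_integral_indicator) (auto simp: K_def)
      also have "\<dots> = (\<integral>\<^sup>+\<omega>. indicator (A \<inter> St W) (X W t \<omega>) \<partial>P W x)"
        using AS x by (intro Kint) auto
      also have "\<dots> = semigroup_op W t (indicator (A \<inter> St W)) x"
        unfolding semigroup_op_def by (intro nn_integral_cong) (auto simp: ext0_def indicator_def)
      finally show "emeasure (K x) (A \<inter> St W) = semigroup_op W t (indicator (A \<inter> St W)) x" .
    qed
    also have "\<dots> \<le> emeasure \<xi> (A \<inter> St W)"
      using \<xi> t AS\<xi> by (simp add: excessive_reference_measure_def)
    also have "\<dots> = emeasure ?\<xi> A" using A sp by (simp add: emeasure_distr[OF idm A])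
    finally show ?thesis .
  qed
  have "?\<eta> \<le> ?\<xi>"
  proof -
    have "emeasure ?\<eta> A \<le> emeasure ?\<xi> A" for A
      using le[of A] s\<eta> by (cases "A \<in> sets borel_points") (auto simp: emeasure_notin_sets)
    then show ?thesis using s\<eta> sets_eq_imp_space_eq[OF s\<eta>] by (simp add: le_measure_iff le_fun_def)
  qed
  then have "(\<integral>\<^sup>+y. k2 y \<partial>?\<eta>) \<le> (\<integral>\<^sup>+y. k2 y \<partial>?\<xi>)"
    using s\<eta> by (intro nn_integral_mono_measure) auto
  also have "(\<integral>\<^sup>+y. k2 y \<partial>?\<xi>) = (\<integral>\<^sup>+x. k x \<partial>\<xi>)"
    using k2m by (subst nn_integral_distr[OF idm]) (auto simp: k2int)
  also have "(\<integral>\<^sup>+y. k2 y \<partial>?\<eta>) = (\<integral>\<^sup>+y. k2 y \<partial>\<eta>)"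
  proof -
    have "k2 \<in> borel_measurable \<eta>" using k2m s\<eta> by (simp cong: measurable_cong_sets)
    then show ?thesis using St\<eta>
      by (subst nn_integral_density) (auto simp: k2_def intro!: nn_integral_cong split: split_indicator)
  qed
  also have "\<dots> = (\<integral>\<^sup>+x. \<integral>\<^sup>+y. k2 y \<partial>K x \<partial>\<xi>)"
    unfolding \<eta>_def by (subst nn_integral_bind[OF k2m Km]) (simp add: nn_integral_completion)
  also have "\<dots> = (\<integral>\<^sup>+x. \<integral>\<^sup>+\<omega>. k2 (X W t \<omega>) \<partial>P W x \<partial>\<xi>)"
    using Kint[OF k2m] sp by (intro nn_integral_cong) auto
  finally have "(\<integral>\<^sup>+x. \<integral>\<^sup>+\<omega>. k2 (X W t \<omega>) \<partial>P W x \<partial>\<xi>) \<le> (\<integral>\<^sup>+x. k x \<partial>\<xi>)" .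
  moreover have "(\<integral>\<^sup>+x. \<integral>\<^sup>+\<omega>. k (X W t \<omega>) \<partial>P W x \<partial>\<xi>) \<le> (\<integral>\<^sup>+x. \<integral>\<^sup>+\<omega>. k2 (X W t \<omega>) \<partial>P W x \<partial>\<xi>)"
  proof (intro nn_integral_mono)
    fix x \<omega> assume "x \<in> space \<xi>" "\<omega> \<in> space (P W x)"
    then have "\<omega> \<in> Paths W" using sp space_P St_points by auto
    then show "k (X W t \<omega>) \<le> k2 (X W t \<omega>)" using X_in_points[OF t] by (intro kk2) auto
  qed
  ultimately show ?thesis by (rule order_trans[rotated])
qed

text \<open>A null set of the path law for \<mu> is null under P_x for \<mu>-almost every, hence
  \<xi>-almost every x. For shifted paths the Markov property replaces P_x by P_y with y the
  position at time t, and excessivity bounds the \<xi>-integral by the unshifted one, which is 0.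
  Paths absorbed by time t are excepted because \<xi> does not control the law started at the
  cemetery.\<close>

lemma reference_null_shift:
  assumes \<xi>: "excessive_reference_measure W \<xi>" and \<mu>: "\<mu> \<in> initial_laws W"
    and dom: "dominates \<mu> \<xi>"
    and N: "N \<in> null_sets (law_from W \<mu>)" and t: "0 \<le> t"
  shows "AE x in \<xi>. AE \<omega> in P W x. \<omega> \<notin> N \<and> (X W t \<omega> \<noteq> Cem W \<longrightarrow> Shift W t \<omega> \<notin> N)"
proof -
  have sets: "sets \<xi> = sets (state_alg W)" using \<xi> by (auto simp: excessive_reference_measure_def)
  have sp: "space \<xi> = St W" using sets_eq_imp_space_eq[OF sets] by simp
  have Nn: "N \<in> sets nat_alg" using N by auto
  have "(\<integral>\<^sup>+x. emeasure (P W x) N \<partial>completion \<mu>) = 0"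
    using emeasure_law_from[OF \<mu> Nn] N by (simp add: nn_integral_completion null_sets_def)
  then have "AE x in completion \<mu>. emeasure (P W x) N = 0"
    using nn_integral_0_iff_AE[OF P_measurable_completion[OF \<mu> Nn]] by simp
  then have ae: "AE x in \<xi>. emeasure (P W x) N = 0"
    unfolding AE_completion_iff by (rule AE_reference_transfer[OF \<xi> \<mu> dom])
  \<comment> \<open>Removing the paths that start at the cemetery makes the probability of N' vanish
    there, as \<open>excessive_integral_le\<close> requires.\<close>
  define N' where "N' = N \<inter> (X W 0 -` (- {Cem W}) \<inter> space nat_alg)"
  have N': "N' \<in> sets nat_alg" unfolding N'_def by (intro sets.Int Nn measurable_sets[OF X_nat]) auto
  have "emeasure (P W (Cem W)) N' = 0"
  proof -
    have "AE \<omega> in P W (Cem W). \<omega> \<notin> N'"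
      using AE_P_Cem by eventually_elim (auto simp: N'_def)
    then show ?thesis using N' sets_P[OF Cem_points] AE_iff_null_sets[of N' "P W (Cem W)"] by auto
  qed
  from excessive_integral_le[OF \<xi> measurable_P[OF N'] this t]
  have "(\<integral>\<^sup>+x. \<integral>\<^sup>+\<omega>. emeasure (P W (X W t \<omega>)) N' \<partial>P W x \<partial>\<xi>) \<le> (\<integral>\<^sup>+x. emeasure (P W x) N' \<partial>\<xi>)" .
  also have "\<dots> = (\<integral>\<^sup>+x. 0 \<partial>\<xi>)"
  proof (rule nn_integral_cong_AE)
    show "AE x in \<xi>. emeasure (P W x) N' = 0"
      using ae AE_space
    proof eventually_elim
      fix x assume x: "emeasure (P W x) N = 0" "x \<in> space \<xi>"
      then have "emeasure (P W x) N' \<le> emeasure (P W x) N"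
        using Nn sets_P St_points sp by (intro emeasure_mono) (auto simp: N'_def)
      with x show "emeasure (P W x) N' = 0" by simp
    qed
  qed
  finally have z: "(\<integral>\<^sup>+x. \<integral>\<^sup>+\<omega>. emeasure (P W (X W t \<omega>)) N' \<partial>P W x \<partial>\<xi>) = 0" by simp
  have mk: "(\<integral>\<^sup>+\<omega>. emeasure (P W (X W t \<omega>)) N' \<partial>P W x) = (\<integral>\<^sup>+\<omega>. indicator N' (Shift W t \<omega>) \<partial>P W x)" if "x \<in> St W" for x
  proof -
    have "(\<integral>\<^sup>+\<omega>. emeasure (P W (X W t \<omega>)) N' \<partial>P W x) = (\<integral>\<^sup>+\<omega>. \<integral>\<^sup>+\<omega>'. indicator N' \<omega>' \<partial>P W (X W t \<omega>) \<partial>P W x)"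
    proof (rule nn_integral_cong)
      fix \<omega> assume "\<omega> \<in> space (P W x)"
      then have "X W t \<omega> \<in> points W" using X_in_points[OF t] space_P[OF St_points[OF that]] by simp
      then show "emeasure (P W (X W t \<omega>)) N' = (\<integral>\<^sup>+\<omega>'. indicator N' \<omega>' \<partial>P W (X W t \<omega>))"
        using N' sets_P by simp
    qed
    then show ?thesis using markov_nn_integral[OF St_points[OF that] t, of "indicator N'"] N' by simp
  qed
  have "AE x in completion \<xi>. (\<integral>\<^sup>+\<omega>. indicator N' (Shift W t \<omega>) \<partial>P W x) = 0"
  proof (subst nn_integral_0_iff_AE[symmetric])
    have "(\<lambda>(x, \<omega>). indicator N' (Shift W t \<omega>) :: ennreal) \<in> borel_measurable (completion \<xi> \<Otimes>\<^sub>M nat_alg)"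
      using measurable_compose[OF measurable_compose[OF measurable_snd Shift_nat[OF t]] borel_measurable_indicator[OF N']]
      by (simp add: split_beta')
    then show "(\<lambda>x. \<integral>\<^sup>+\<omega>. indicator N' (Shift W t \<omega>) \<partial>P W x) \<in> borel_measurable (completion \<xi>)"
      by (rule nn_integral_P_univ[OF _ id_completion_reference[OF \<xi>]])
    have "(\<integral>\<^sup>+x. \<integral>\<^sup>+\<omega>. indicator N' (Shift W t \<omega>) \<partial>P W x \<partial>completion \<xi>) = (\<integral>\<^sup>+x. \<integral>\<^sup>+\<omega>. emeasure (P W (X W t \<omega>)) N' \<partial>P W x \<partial>\<xi>)"
      unfolding nn_integral_completion by (rule nn_integral_cong) (simp add: mk sp)
    then show "(\<integral>\<^sup>+x. \<integral>\<^sup>+\<omega>. indicator N' (Shift W t \<omega>) \<partial>P W x \<partial>completion \<xi>) = 0" using z by simp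
  qed
  then have "AE x in \<xi>. (\<integral>\<^sup>+\<omega>. indicator N' (Shift W t \<omega>) \<partial>P W x) = 0" unfolding AE_completion_iff .
  with ae show ?thesis using AE_space
  proof eventually_elim
    fix x assume x: "emeasure (P W x) N = 0" "(\<integral>\<^sup>+\<omega>. indicator N' (Shift W t \<omega>) \<partial>P W x) = 0" "x \<in> space \<xi>"
    then have xp: "x \<in> points W" using sp St_points by simp
    have "AE \<omega> in P W x. \<omega> \<notin> N"
      using x(1) Nn sets_P[OF xp] by (intro AE_not_in) (simp add: null_sets_def)
    moreover have "AE \<omega> in P W x. indicator N' (Shift W t \<omega>) = (0::ennreal)"
    proof (subst nn_integral_0_iff_AE[symmetric])
      show "(\<lambda>\<omega>. indicator N' (Shift W t \<omega>) :: ennreal) \<in> borel_measurable (P W x)"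
        using measurable_compose[OF Shift_nat[OF t] borel_measurable_indicator[OF N']] sets_P[OF xp] by (simp cong: measurable_cong_sets)
    qed (rule x(2))
    ultimately show "AE \<omega> in P W x. \<omega> \<notin> N \<and> (X W t \<omega> \<noteq> Cem W \<longrightarrow> Shift W t \<omega> \<notin> N)"
      using AE_space
    proof eventually_elim
      fix \<omega> assume "\<omega> \<notin> N" "indicator N' (Shift W t \<omega>) = (0::ennreal)" "\<omega> \<in> space (P W x)"
      moreover then have "\<omega> \<in> Paths W" using space_P[OF xp] by simp
      ultimately show "\<omega> \<notin> N \<and> (X W t \<omega> \<noteq> Cem W \<longrightarrow> Shift W t \<omega> \<notin> N)"
        using X_Shift[of 0 t \<omega>] Shift_in_Paths[OF t] t by (auto simp: N'_def indicator_def split: if_splits)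
    qed
  qed
qed

end

section \<open>Integrals along additive functionals\<close>

lemma sigma_finite_completion:
  assumes "sigma_finite_measure M" shows "sigma_finite_measure (completion M)"
proof -
  interpret sigma_finite_measure M by fact
  obtain A where A: "countable A" "A \<subseteq> sets M" "\<Union>A = space M" "\<forall>a\<in>A. emeasure M a \<noteq> \<infinity>"
    using sigma_finite_countable by auto
  show ?thesis
  proof (unfold_locales, intro exI conjI)
    show "countable A" "\<Union>A = space (completion M)" using A by auto
    show "A \<subseteq> sets (completion M)" using A(2) by auto
    show "\<forall>a\<in>A. emeasure (completion M) a \<noteq> \<infinity>" using A(2,4) by auto
  qed
qed

text \<open>One of the two measures is a translate of the other, and on half-lines both are
  increments of c. The interval is open at t, so a possible atom at t stays with the earlier
  part.\<close>

lemma stieltjes_shift_integral: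
  assumes c: "cadlag_increasing c" and t: "0 \<le> t" "0 \<le> r" and f: "f \<in> borel_measurable borel"
  shows "(\<integral>\<^sup>+s. f s * indicator {t<..t + r} s \<partial>stieltjes c)
    = (\<integral>\<^sup>+s. f (t + s) * indicator {0<..r} s \<partial>stieltjes (\<lambda>s. c (t + s) - c t))"
proof -
  let ?c = "\<lambda>s. c (t + s) - c t"
  have c': "cadlag_increasing ?c"
  proof -
    have "continuous (at_right s) ?c" if "0 \<le> s" for s
    proof -
      have "(c \<longlongrightarrow> c (t + s)) (at_right (t + s))"
        using c that t by (auto simp: cadlag_increasing_def continuous_within)
      moreover have "filterlim (\<lambda>s. t + s) (at_right (t + s)) (at_right s)"
        using filterlim_at_right_to_0[of "\<lambda>s. t + s" "at_right (t + s)" s]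
        by (intro tendsto_imp_filterlim_at_right tendsto_intros) (auto simp: eventually_at_filter)
      ultimately have "((\<lambda>s. c (t + s)) \<longlongrightarrow> c (t + s)) (at_right s)"
        by (rule filterlim_compose)
      then show ?thesis unfolding continuous_within by (intro tendsto_intros)
    qed
    moreover have "mono_on {0..} ?c"
      using c t by (auto simp: cadlag_increasing_def mono_on_def)
    ultimately show ?thesis by (simp add: cadlag_increasing_def)
  qed
  let ?M = "density (stieltjes c) (indicator {t<..t + r})"
  let ?N' = "density (stieltjes ?c) (indicator {0<..r})"
  let ?N = "distr ?N' borel (\<lambda>s. t + s)"
  have "?M = ?N"
  proof (rule measure_eqI_lessThan)
    fix q
    define m where "m = max t (min q (t + r))"
    have m: "t \<le> m" "m \<le> t + r" using t by (auto simp: m_def)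
    have "emeasure ?M {q<..} = emeasure (stieltjes c) {m<..t + r}"
      by (subst emeasure_density)
        (auto simp: nn_integral_indicator[symmetric] m_def simp del: nn_integral_indicator intro!: nn_integral_cong split: split_indicator)
    also have "\<dots> = ennreal (c (t + r) - c m)" using emeasure_stieltjes_Ioc[OF c m(2)] m t by simp
    finally have 1: "emeasure ?M {q<..} = ennreal (c (t + r) - c m)" .
    then show "emeasure ?M {q<..} < \<infinity>" by simp
    have "emeasure ?N {q<..} = emeasure ?N' ((\<lambda>s. t + s) -` {q<..} \<inter> space ?N')"
      by (rule emeasure_distr) auto
    also have "(\<lambda>s. t + s) -` {q<..} \<inter> space ?N' = {q - t<..}" by auto
    also have "emeasure ?N' {q - t<..} = emeasure (stieltjes ?c) {m - t<..r}"
      by (subst emeasure_density)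
        (auto simp: nn_integral_indicator[symmetric] m_def simp del: nn_integral_indicator intro!: nn_integral_cong split: split_indicator)
    also have "\<dots> = ennreal (c (t + r) - c m)" using emeasure_stieltjes_Ioc[OF c', of "m - t" r] m t by simp
    finally show "emeasure ?M {q<..} = emeasure ?N {q<..}" using 1 by simp
  qed auto
  then have "(\<integral>\<^sup>+s. f s \<partial>?M) = (\<integral>\<^sup>+s. f s \<partial>?N)" by simp
  also have "(\<integral>\<^sup>+s. f s \<partial>?N) = (\<integral>\<^sup>+s. f (t + s) \<partial>?N')" using f by (intro nn_integral_distr) auto
  also have "\<dots> = (\<integral>\<^sup>+s. f (t + s) * indicator {0<..r} s \<partial>stieltjes ?c)"
  proof -
    have "(\<lambda>s. f (t + s)) \<in> borel_measurable borel" using measurable_compose[OF _ f, of "\<lambda>s. t + s" borel] by simp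
    then show ?thesis by (subst nn_integral_density) (auto intro!: nn_integral_cong simp: mult.commute)
  qed
  also have "(\<integral>\<^sup>+s. f s \<partial>?M) = (\<integral>\<^sup>+s. f s * indicator {t<..t + r} s \<partial>stieltjes c)"
    using f by (subst nn_integral_density) (auto intro!: nn_integral_cong simp: mult.commute)
  finally show ?thesis .
qed

section \<open>Path integrals along additive functionals, jointly in level and path\<close>

context right_process begin

definition path_mass :: "'e set \<Rightarrow> (real \<Rightarrow> 'w \<Rightarrow> real) \<Rightarrow> real \<Rightarrow> 'w \<Rightarrow> ennreal" where
  "path_mass B C t \<omega> = (\<integral>\<^sup>+s\<in>{0..t}. ext0 W (indicator B) (X W s \<omega>) \<partial>stieltjes (\<lambda>r. C r \<omega>))"

text \<open>Almost surely equal to \<open>path_mass\<close> for an additive functional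
  (\<open>path_mass_regularize\<close>). Being built from rational times, it has a version that is
  measurable in level and path off one null set (\<open>path_mass_modification\<close>).\<close>

abbreviation regular_mass :: "'e set \<Rightarrow> (real \<Rightarrow> 'w \<Rightarrow> real) \<Rightarrow> real \<Rightarrow> 'w \<Rightarrow> ennreal" where
  "regular_mass B C t \<omega> \<equiv>
     (\<integral>\<^sup>+s\<in>{0..t}. ext0 W (indicator B) (X W s \<omega>) \<partial>stieltjes (regularize (\<lambda>r. C r \<omega>)))"

abbreviation path_measurable :: "'e set \<Rightarrow> 'w \<Rightarrow> bool" where
  "path_measurable B \<omega> \<equiv>
     (\<lambda>s. ext0 W (indicator B) (X W (max 0 s) \<omega>) :: ennreal) \<in> borel_measurable borel"

lemma caf_paths:
  assumes C: "cont_additive_functional W C" and x: "x \<in> points W"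
  shows "AE \<omega> in P W x. C 0 \<omega> = 0 \<and> continuous_on {0..} (\<lambda>t. C t \<omega>) \<and> mono_on {0..} (\<lambda>t. C t \<omega>)"
  using C x by (force simp: cont_additive_functional_def elim!: eventually_mono)

lemma caf_regularize:
  assumes C: "cont_additive_functional W C" and x: "x \<in> points W"
  shows "AE \<omega> in P W x. \<forall>t\<ge>0. regularize (\<lambda>r. C r \<omega>) t = C t \<omega>"
  using caf_paths[OF C x]
proof eventually_elim
  fix \<omega> assume "C 0 \<omega> = 0 \<and> continuous_on {0..} (\<lambda>t. C t \<omega>) \<and> mono_on {0..} (\<lambda>t. C t \<omega>)"
  then have "cadlag_increasing (\<lambda>t. C t \<omega>)" by (intro cadlag_increasing_continuous) auto
  then show "\<forall>t\<ge>0. regularize (\<lambda>r. C r \<omega>) t = C t \<omega>" using regularize_eq(2) by blast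
qed

text \<open>Measurability is first obtained for the completed law; then a function J measurable for
  the natural sigma-algebra is chosen that differs on a null set of paths only. This null set does
  not depend on the level, and J can be integrated against every \<open>P W x\<close>.\<close>

lemma path_mass_modification:
  assumes \<mu>: "\<mu> \<in> initial_laws W" and B: "B \<in> sets (state_alg W)" and t: "0 \<le> t"
    and Lm: "\<forall>r\<ge>0. (\<lambda>(a, \<omega>). L a r \<omega>) \<in> borel_measurable (borel \<Otimes>\<^sub>M canonical_alg W r)"
  shows "\<exists>J\<in>borel_measurable (borel \<Otimes>\<^sub>M nat_alg). \<exists>N\<in>null_sets (law_from W \<mu>).
    (\<forall>a::real. \<forall>\<omega>\<in>Paths W - N. regular_mass B (L a) t \<omega> = J (a, \<omega>)) \<and>
    (\<forall>\<omega>\<in>Paths W - N. path_measurable B \<omega>)"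
proof -
  let ?p = "law_from W \<mu>"
  obtain N1 H where N1: "N1 \<in> null_sets ?p" and H: "H \<in> borel_measurable (borel \<Otimes>\<^sub>M completion ?p)"
    and HX: "\<forall>\<omega>\<in>Paths W - N1. \<forall>s\<ge>0. ext0 W (indicator B) (X W s \<omega>) = (H (s, \<omega>) :: ennreal)"
    using state_path_process_ex[OF B \<mu>] by (elim bexE) (rule that)
  let ?M = "borel \<Otimes>\<^sub>M completion ?p"
  have Lm': "(\<lambda>y. L (fst y) q (snd y)) \<in> borel_measurable ?M" if q: "0 \<le> q" for q
  proof -
    have "(\<lambda>\<omega>. \<omega>) \<in> measurable (completion ?p) (canonical_alg W q)"
      using canonical_le_completion[OF \<mu>, of q] sets.sets_into_space[of _ "canonical_alg W q"]
      by (auto simp: measurable_def Int_absorb2)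
    then have "(\<lambda>y. (fst y, snd y)) \<in> measurable ?M (borel \<Otimes>\<^sub>M canonical_alg W q)"
      by (intro measurable_Pair measurable_fst measurable_compose[OF measurable_snd])
    from measurable_compose[OF this Lm[rule_format, OF q]] show ?thesis by (simp add: split_beta')
  qed
  have Hf: "(\<lambda>(y, s). H (s, snd y)) \<in> borel_measurable (?M \<Otimes>\<^sub>M borel)"
    using measurable_compose[OF _ H, of "\<lambda>z. (snd z, snd (fst z))" "?M \<Otimes>\<^sub>M borel"] by (simp add: split_beta')
  define g where "g y = (\<integral>\<^sup>+s\<in>{0..t}. H (s, snd y) \<partial>stieltjes (regularize (\<lambda>r. L (fst y) r (snd y))))" for y
  have "g \<in> borel_measurable ?M"
    unfolding g_def[abs_def] by (rule borel_measurable_stieltjes_integral[OF Lm' t Hf])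
  then obtain J N2 where J: "J \<in> borel_measurable (borel \<Otimes>\<^sub>M ?p)" and N2: "N2 \<in> null_sets ?p"
    and gJ: "\<forall>a\<in>space borel. \<forall>w\<in>space ?p - N2. g (a, w) = J (a, w)"
    using pair_completion_borel_ex by (metis (no_types, lifting))
  show ?thesis
  proof (rule bexI[of _ J], rule bexI[of _ "N1 \<union> N2"], intro conjI allI ballI)
    show "J \<in> borel_measurable (borel \<Otimes>\<^sub>M nat_alg)"
      using J by (simp cong: measurable_cong_sets sets_pair_measure_cong)
    show "N1 \<union> N2 \<in> null_sets ?p" using N1 N2 by (rule null_sets.Un)
  next
    fix a \<omega> assume \<omega>: "\<omega> \<in> Paths W - (N1 \<union> N2)"
    have "regular_mass B (L a) t \<omega> = g (a, \<omega>)"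
      unfolding g_def fst_conv snd_conv using HX \<omega> by (intro nn_integral_cong) (auto split: split_indicator)
    then show "regular_mass B (L a) t \<omega> = J (a, \<omega>)"
      using gJ \<omega> by simp
  next
    fix \<omega> assume \<omega>: "\<omega> \<in> Paths W - (N1 \<union> N2)"
    have "(\<lambda>s. H (s, \<omega>)) \<in> borel_measurable borel" using H \<omega> by (intro measurable_Pair1) auto
    then have "(\<lambda>s. H (max 0 s, \<omega>)) \<in> borel_measurable borel"
      using measurable_compose[of "\<lambda>s. max 0 s" borel borel "\<lambda>s. H (s, \<omega>)"] by simp
    moreover have "(\<lambda>s. ext0 W (indicator B) (X W (max 0 s) \<omega>)) = (\<lambda>s. H (max 0 s, \<omega>))"
      using HX \<omega> by auto
    ultimately show "path_measurable B \<omega>" by simp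
  qed
qed

lemma path_mass_regularize:
  assumes C: "cont_additive_functional W C" and x: "x \<in> points W"
  shows "AE \<omega> in P W x. path_mass B C t \<omega> = regular_mass B C t \<omega>"
  using caf_regularize[OF C x]
proof eventually_elim
  fix \<omega> assume "\<forall>t\<ge>0. regularize (\<lambda>r. C r \<omega>) t = C t \<omega>"
  then have "stieltjes (\<lambda>r. C r \<omega>) = stieltjes (regularize (\<lambda>r. C r \<omega>))" by (intro stieltjes_cong) simp
  then show "path_mass B C t \<omega> = regular_mass B C t \<omega>"
    by (simp add: path_mass_def)
qed

text \<open>The occupation formula at rational times exhibits the measure of Q as the mixture of
  those of the \<open>L a\<close>. Measurability along the path is a premise of the almost sure
  claim, because its exceptional set comes from the dominating law and not from
  \<open>P W x\<close>.\<close>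

lemma path_mass_occupation:
  assumes x: "x \<in> St W" and t: "0 \<le> t" "t \<in> \<rat>"
    and Q: "cont_additive_functional W Q" and L: "\<And>a. cont_additive_functional W (L a)"
    and Lm: "\<forall>r\<ge>0. (\<lambda>(a, \<omega>). L a r \<omega>) \<in> borel_measurable (borel \<Otimes>\<^sub>M canonical_alg W r)"
    and occ: "\<forall>r\<ge>0. AE \<omega> in P W x. (\<integral>\<^sup>+s\<in>{0..r}. 1 \<partial>stieltjes (\<lambda>r. Q r \<omega>)) = (\<integral>\<^sup>+a. ennreal (L a r \<omega>) \<partial>lborel)"
  shows "AE \<omega> in P W x. path_measurable B \<omega> \<longrightarrow>
    path_mass B Q t \<omega> = (\<integral>\<^sup>+a. regular_mass B (L a) t \<omega> \<partial>lborel)"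
proof -
  note xp = St_points[OF x]
  let ?p = "completion (P W x)"
  interpret p: prob_space ?p by (rule prob_space.prob_space_completion[OF prob_space_P[OF xp]])
  interpret pair_sigma_finite lborel ?p ..
  define R where "R = {q::real. q \<in> \<rat> \<and> 0 \<le> q}"
  have cR: "countable R" using countable_rat by (rule countable_subset[rotated]) (auto simp: R_def)
  have canon: "(\<lambda>\<omega>. \<omega>) \<in> measurable ?p (canonical_alg W q)" if "0 \<le> q" for q
    using canonical_le_completion[OF return_initial_law[OF xp], of q] law_from_return[OF xp] sets.sets_into_space[of _ "canonical_alg W q"] space_P[OF xp]
    by (auto simp: measurable_def Int_absorb2)
  have Lm': "(\<lambda>y. L (fst y) q (snd y)) \<in> borel_measurable (lborel \<Otimes>\<^sub>M ?p)" if q: "0 \<le> q" for q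
  proof -
    have "(\<lambda>y. (fst y, snd y)) \<in> measurable (lborel \<Otimes>\<^sub>M ?p) (borel \<Otimes>\<^sub>M canonical_alg W q)"
      using canon[OF q] by (intro measurable_Pair measurable_compose[OF measurable_snd]) simp_all
    from measurable_compose[OF this Lm[rule_format, OF q]] show ?thesis by (simp add: split_beta')
  qed
  \<comment> \<open>Regularity at rational times is a countable condition and defines a measurable
    set of pairs. "For every level, almost surely" can therefore be exchanged for "almost surely,
    for almost every level".\<close>
  define Reg where "Reg a \<omega> \<longleftrightarrow> (\<forall>q\<in>R. regularize (\<lambda>r. L a r \<omega>) q = L a q \<omega>) \<and> L a 0 \<omega> = 0" for a \<omega>
  have "AE a in lborel. AE \<omega> in ?p. Reg a \<omega>"
  proof (rule AE_I2, rule AE_completion)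
    fix a
    show "AE \<omega> in P W x. Reg a \<omega>"
      using caf_regularize[OF L xp, of a] caf_paths[OF L xp, of a]
      by eventually_elim (auto simp: Reg_def R_def)
  qed
  moreover have "{y\<in>space (lborel \<Otimes>\<^sub>M ?p). Reg (fst y) (snd y)} \<in> sets (lborel \<Otimes>\<^sub>M ?p)"
  proof -
    have [measurable]: "(\<lambda>y. L (fst y) q (snd y)) \<in> borel_measurable (lborel \<Otimes>\<^sub>M ?p)"
      "(\<lambda>y. regularize (\<lambda>r. L (fst y) r (snd y)) q) \<in> borel_measurable (lborel \<Otimes>\<^sub>M ?p)" if "q \<in> R" for q
      using that Lm' by (auto simp: R_def intro!: borel_measurable_regularize)
    have [measurable]: "(\<lambda>y. L (fst y) 0 (snd y)) \<in> borel_measurable (lborel \<Otimes>\<^sub>M ?p)" using Lm'[of 0] by simp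
    show ?thesis unfolding Reg_def using cR by measurable
  qed
  ultimately have ae: "AE \<omega> in ?p. AE a in lborel. Reg a \<omega>" using AE_commute[of Reg] by simp
  have "AE \<omega> in P W x. \<forall>q\<in>R. (\<integral>\<^sup>+s\<in>{0..q}. 1 \<partial>stieltjes (\<lambda>r. Q r \<omega>)) = (\<integral>\<^sup>+a. ennreal (L a q \<omega>) \<partial>lborel)"
    by (subst AE_ball_countable[OF cR], intro ballI occ[rule_format]) (simp add: R_def)
  with ae[unfolded AE_completion_iff] caf_paths[OF Q xp] show ?thesis
    using AE_space
  proof (eventually_elim, intro impI)
    fix \<omega>
    assume 1: "\<forall>q\<in>R. (\<integral>\<^sup>+s\<in>{0..q}. 1 \<partial>stieltjes (\<lambda>r. Q r \<omega>)) = (\<integral>\<^sup>+a. ennreal (L a q \<omega>) \<partial>lborel)"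
      and 2: "AE a in lborel. Reg a \<omega>"
      and 3: "Q 0 \<omega> = 0 \<and> continuous_on {0..} (\<lambda>t. Q t \<omega>) \<and> mono_on {0..} (\<lambda>t. Q t \<omega>)"
      and \<omega>: "\<omega> \<in> space (P W x)"
      and fm: "path_measurable B \<omega>"
    have cQ: "cadlag_increasing (\<lambda>t. Q t \<omega>)" using 3 by (intro cadlag_increasing_continuous) auto
    have "(\<integral>\<^sup>+s\<in>{0..t}. ext0 W (indicator B) (X W (max 0 s) \<omega>) \<partial>stieltjes (\<lambda>t. Q t \<omega>))
      = (\<integral>\<^sup>+a. (\<integral>\<^sup>+s\<in>{0..t}. ext0 W (indicator B) (X W (max 0 s) \<omega>) \<partial>stieltjes (regularize (\<lambda>r. L a r \<omega>))) \<partial>lborel)"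
    proof (rule stieltjes_integral_mixture[OF cQ _ t])
      show "Q 0 \<omega> = 0" using 3 by simp
      show "(\<lambda>a. L a q \<omega>) \<in> borel_measurable lborel" if "q \<in> \<rat>" "0 \<le> q" for q
        using measurable_Pair1[OF Lm'[OF that(2)], of \<omega>] \<omega> by simp
      show "AE a in lborel. regularize (\<lambda>r. L a r \<omega>) 0 = 0"
        using 2 by eventually_elim (auto simp: Reg_def R_def)
      fix q :: real assume q: "q \<in> \<rat>" "0 \<le> q"
      have "ennreal (Q q \<omega>) = emeasure (stieltjes (\<lambda>t. Q t \<omega>)) {0..q}"
        using emeasure_stieltjes_Icc[OF cQ q(2)] 3 by simp
      also have "\<dots> = (\<integral>\<^sup>+s\<in>{0..q}. 1 \<partial>stieltjes (\<lambda>t. Q t \<omega>))" by simp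
      also have "\<dots> = (\<integral>\<^sup>+a. ennreal (L a q \<omega>) \<partial>lborel)" using 1 q by (simp add: R_def)
      also have "\<dots> = (\<integral>\<^sup>+a. ennreal (regularize (\<lambda>r. L a r \<omega>) q) \<partial>lborel)"
        by (intro nn_integral_cong_AE, use 2 in eventually_elim) (use q in \<open>simp add: Reg_def R_def\<close>)
      finally show "ennreal (Q q \<omega>) = (\<integral>\<^sup>+a. ennreal (regularize (\<lambda>r. L a r \<omega>) q) \<partial>lborel)" .
    qed (rule fm)
    moreover have "(\<integral>\<^sup>+s\<in>{0..t}. ext0 W (indicator B) (X W (max 0 s) \<omega>) \<partial>S) = (\<integral>\<^sup>+s\<in>{0..t}. ext0 W (indicator B) (X W s \<omega>) \<partial>S)" for S :: "real measure"
      by (intro nn_integral_cong) (auto split: split_indicator)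
    ultimately show "path_mass B Q t \<omega> = (\<integral>\<^sup>+a. regular_mass B (L a) t \<omega> \<partial>lborel)"
      by (simp add: path_mass_def)
  qed
qed

text \<open>The mass gathered after t is the mass of the shifted path, since additivity holds almost
  surely at all rational times simultaneously. Absorbed paths gather nothing after t; the case
  distinction matches the exception in \<open>reference_null_shift\<close>.\<close>

lemma path_mass_double:
  assumes x: "x \<in> points W" and t: "0 \<le> t" and C: "cont_additive_functional W C"
  shows "AE \<omega> in P W x. path_measurable B \<omega> \<longrightarrow>
    path_mass B C (2 * t) \<omega> \<le> path_mass B C t \<omega> +
      (if X W t \<omega> = Cem W then 0
       else regular_mass B C t (Shift W t \<omega>))"
proof -
  define R where "R = {q::real. q \<in> \<rat> \<and> 0 \<le> q}"
  have cR: "countable R" using countable_rat by (rule countable_subset[rotated]) (auto simp: R_def)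
  have "AE \<omega> in P W x. \<forall>s\<in>R. C (t + s) \<omega> = C t \<omega> + C s (Shift W t \<omega>)"
    using C x t by (subst AE_ball_countable[OF cR]) (auto simp: R_def cont_additive_functional_def)
  then show ?thesis
    using caf_paths[OF C x] AE_space
  proof (eventually_elim, intro impI)
    fix \<omega>
    assume 1: "\<forall>s\<in>R. C (t + s) \<omega> = C t \<omega> + C s (Shift W t \<omega>)"
      and 2: "C 0 \<omega> = 0 \<and> continuous_on {0..} (\<lambda>t. C t \<omega>) \<and> mono_on {0..} (\<lambda>t. C t \<omega>)"
      and \<omega>': "\<omega> \<in> space (P W x)"
      and fm: "path_measurable B \<omega>"
    have \<omega>: "\<omega> \<in> Paths W" using \<omega>' space_P[OF x] by simp
    let ?f = "\<lambda>s. ext0 W (indicator B) (X W (max 0 s) \<omega>) :: ennreal"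
    let ?S = "stieltjes (\<lambda>r. C r \<omega>)" let ?c = "\<lambda>s. C (t + s) \<omega> - C t \<omega>"
    have c: "cadlag_increasing (\<lambda>t. C t \<omega>)" using 2 by (intro cadlag_increasing_continuous) auto
    have c': "cadlag_increasing ?c"
    proof (rule cadlag_increasing_continuous)
      have "continuous_on {0..} (\<lambda>s. C (t + s) \<omega>)"
        using 2 t by (intro continuous_on_compose2[of "{0..}" "\<lambda>t. C t \<omega>" "{0..}" "\<lambda>s. t + s"] continuous_on_add continuous_on_const continuous_on_id) auto
      then show "continuous_on {0..} ?c" by (intro continuous_on_diff continuous_on_const)
      show "mono_on {0..} ?c" using 2 t by (auto simp: mono_on_def)
    qed
    \<comment> \<open>The increments of C after t are continuous, hence equal to their own
      regularization, and this depends on their values at rational times, where they agree with the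
      shifted path.\<close>
    have "stieltjes ?c = stieltjes (regularize (\<lambda>r. C r (Shift W t \<omega>)))"
    proof (rule stieltjes_cong)
      fix s :: real assume s: "0 \<le> s"
      have "?c s = regularize ?c s" using regularize_eq(2)[OF c' s] by simp
      also have "\<dots> = regularize (\<lambda>r. C r (Shift W t \<omega>)) s"
        by (rule regularize_cong) (use 1 s in \<open>auto simp: R_def\<close>)
      finally show "?c s = regularize (\<lambda>r. C r (Shift W t \<omega>)) s" .
    qed
    note S' = this
    have "path_mass B C (2 * t) \<omega> = (\<integral>\<^sup>+s. ?f s * indicator {0..t} s + ?f s * indicator {t<..t + t} s \<partial>?S)"
      unfolding path_mass_def using t by (intro nn_integral_cong) (auto split: split_indicator)
    also have "\<dots> = (\<integral>\<^sup>+s. ?f s * indicator {0..t} s \<partial>?S) + (\<integral>\<^sup>+s. ?f s * indicator {t<..t + t} s \<partial>?S)"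
      using fm by (intro nn_integral_add) (auto intro!: borel_measurable_times_ennreal)
    also have "(\<integral>\<^sup>+s. ?f s * indicator {0..t} s \<partial>?S) = path_mass B C t \<omega>"
      unfolding path_mass_def by (intro nn_integral_cong) (auto split: split_indicator)
    also have "(\<integral>\<^sup>+s. ?f s * indicator {t<..t + t} s \<partial>?S) = (\<integral>\<^sup>+s. ?f (t + s) * indicator {0<..t} s \<partial>stieltjes ?c)"
      by (rule stieltjes_shift_integral[OF c t t fm])
    also have "\<dots> \<le> (if X W t \<omega> = Cem W then 0
       else (\<integral>\<^sup>+s\<in>{0..t}. ext0 W (indicator B) (X W s (Shift W t \<omega>)) \<partial>stieltjes ?c))"
    proof (cases "X W t \<omega> = Cem W")
      case True
      have 0: "?f (t + s) * indicator {0<..t} s = 0" for s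
        using absorbing[OF t _ \<omega> True, of "t + s"] cemetery t by (auto simp: ext0_def indicator_def)
      have "(\<integral>\<^sup>+s. ?f (t + s) * indicator {0<..t} s \<partial>stieltjes ?c) = (\<integral>\<^sup>+s. 0 \<partial>stieltjes ?c)"
        by (rule nn_integral_cong) (rule 0)
      then show ?thesis by simp
    next
      case False
      have "?f (t + s) * indicator {0<..t} s \<le> ext0 W (indicator B) (X W s (Shift W t \<omega>)) * indicator {0..t} s" for s
        using X_Shift[OF _ t \<omega>, of s] t by (auto simp: add.commute split: split_indicator)
      then show ?thesis using False by (simp add: nn_integral_mono)
    qed
    finally show "path_mass B C (2 * t) \<omega> \<le> path_mass B C t \<omega> +
      (if X W t \<omega> = Cem W then 0
       else regular_mass B C t (Shift W t \<omega>))"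
      unfolding S' by (simp add: add_left_mono)
  qed
qed

section \<open>Expected masses under the reference measure\<close>

definition total_mass :: "'e measure \<Rightarrow> 'e set \<Rightarrow> (real \<Rightarrow> 'w \<Rightarrow> real) \<Rightarrow> real \<Rightarrow> ennreal" where
  "total_mass \<xi> B C t = (\<integral>\<^sup>+x. \<integral>\<^sup>+\<omega>. path_mass B C t \<omega> \<partial>P W x \<partial>\<xi>)"

lemma space_reference: "excessive_reference_measure W \<xi> \<Longrightarrow> space \<xi> = St W"
  using sets_eq_imp_space_eq[of \<xi> "state_alg W"] by (simp add: excessive_reference_measure_def)

text \<open>Tonelli's theorem is used twice, over levels and paths under each \<open>P W x\<close>
  and over levels and starting points under the completion of \<xi>, both times with the measurable
  version J in place of the path integrals.\<close>

lemma total_mass_occupation: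
  fixes L :: "real \<Rightarrow> real \<Rightarrow> 'w \<Rightarrow> real"
  assumes \<xi>: "excessive_reference_measure W \<xi>" and B: "B \<in> sets (state_alg W)" and t: "0 \<le> t" "t \<in> \<rat>"
    and Q: "cont_additive_functional W Q" and L: "\<And>a. cont_additive_functional W (L a)"
    and Lm: "\<forall>r\<ge>0. (\<lambda>(a, \<omega>). L a r \<omega>) \<in> borel_measurable (borel \<Otimes>\<^sub>M canonical_alg W r)"
    and occ: "\<forall>x\<in>St W. \<forall>r\<ge>0. AE \<omega> in P W x. (\<integral>\<^sup>+s\<in>{0..r}. 1 \<partial>stieltjes (\<lambda>r. Q r \<omega>)) = (\<integral>\<^sup>+a. ennreal (L a r \<omega>) \<partial>lborel)"
  shows "(\<lambda>a. total_mass \<xi> B (L a) t) \<in> borel_measurable borel"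
    and "total_mass \<xi> B Q t = (\<integral>\<^sup>+a. total_mass \<xi> B (L a) t \<partial>lborel)"
proof -
  note sp = space_reference[OF \<xi>]
  obtain \<mu> where \<mu>: "\<mu> \<in> initial_laws W"
    and dom: "dominates \<mu> \<xi>"
    using reference_initial_law_ex[OF \<xi>] by blast
  obtain J N where J: "J \<in> borel_measurable (borel \<Otimes>\<^sub>M nat_alg)" and N: "N \<in> null_sets (law_from W \<mu>)"
    and JN: "\<forall>a::real. \<forall>\<omega>\<in>Paths W - N. regular_mass B (L a) t \<omega> = J (a, \<omega>)"
    and fm: "\<forall>\<omega>\<in>Paths W - N. path_measurable B \<omega>"
    using path_mass_modification[OF \<mu> B t(1) Lm] by (elim bexE conjE) (rule that)
  have off: "AE x in \<xi>. AE \<omega> in P W x. \<omega> \<notin> N"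
    using reference_null_shift[OF \<xi> \<mu> dom N order_refl] by eventually_elim (auto elim: eventually_mono)
  define G where "G a x = (\<integral>\<^sup>+\<omega>. J (a, \<omega>) \<partial>P W x)" for a x
  have Gm: "(\<lambda>y. G (fst y) (snd y)) \<in> borel_measurable (borel \<Otimes>\<^sub>M completion \<xi>)"
    unfolding G_def
  proof (rule nn_integral_P_univ)
    show "(\<lambda>(y, \<omega>). J (fst y, \<omega>)) \<in> borel_measurable ((borel \<Otimes>\<^sub>M completion \<xi>) \<Otimes>\<^sub>M nat_alg)"
      using measurable_compose[OF _ J, of "\<lambda>z. (fst (fst z), snd z)" "(borel \<Otimes>\<^sub>M completion \<xi>) \<Otimes>\<^sub>M nat_alg"]
      by (simp add: split_beta')
    show "snd \<in> measurable (borel \<Otimes>\<^sub>M completion \<xi>) univ_points"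
      by (rule measurable_compose[OF measurable_snd id_completion_reference[OF \<xi>]])
  qed
  have LG: "total_mass \<xi> B (L a) t = (\<integral>\<^sup>+x. G a x \<partial>completion \<xi>)" for a
    unfolding total_mass_def nn_integral_completion G_def
  proof (rule nn_integral_cong_AE, use off AE_space in eventually_elim, rule nn_integral_cong_AE)
    fix x assume x: "AE \<omega> in P W x. \<omega> \<notin> N" "x \<in> space \<xi>"
    then have xp: "x \<in> points W" using sp St_points by simp
    show "AE \<omega> in P W x. path_mass B (L a) t \<omega> = J (a, \<omega>)"
      using path_mass_regularize[OF L xp, of B a t] x(1) AE_space
      by eventually_elim (use JN space_P[OF xp] in auto)
  qed
  interpret \<xi>: sigma_finite_measure "completion \<xi>"
    using \<xi> by (intro sigma_finite_completion) (simp add: excessive_reference_measure_def)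
  have "(\<lambda>a. \<integral>\<^sup>+x. G a x \<partial>completion \<xi>) \<in> borel_measurable borel"
    using Gm by (intro \<xi>.borel_measurable_nn_integral) (simp add: split_beta')
  then show "(\<lambda>a. total_mass \<xi> B (L a) t) \<in> borel_measurable borel" unfolding LG .
  interpret pair_sigma_finite lborel "completion \<xi>" ..
  have "total_mass \<xi> B Q t = (\<integral>\<^sup>+x. \<integral>\<^sup>+a. G a x \<partial>lborel \<partial>completion \<xi>)"
    unfolding total_mass_def nn_integral_completion
  proof (rule nn_integral_cong_AE, use off AE_space in eventually_elim)
    fix x assume x: "AE \<omega> in P W x. \<omega> \<notin> N" "x \<in> space \<xi>"
    then have xS: "x \<in> St W" and xp: "x \<in> points W" using sp St_points by auto
    interpret p: prob_space "P W x" by (rule prob_space_P[OF xp])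
    interpret p2: pair_sigma_finite lborel "P W x" ..
    have "(\<integral>\<^sup>+\<omega>. path_mass B Q t \<omega> \<partial>P W x) = (\<integral>\<^sup>+\<omega>. \<integral>\<^sup>+a. J (a, \<omega>) \<partial>lborel \<partial>P W x)"
    proof (rule nn_integral_cong_AE)
      show "AE \<omega> in P W x. path_mass B Q t \<omega> = (\<integral>\<^sup>+a. J (a, \<omega>) \<partial>lborel)"
        using path_mass_occupation[OF xS t Q L Lm bspec[OF occ xS], of B] x(1) AE_space
      proof eventually_elim
        fix \<omega>
        assume *: "path_measurable B \<omega> \<longrightarrow>
          path_mass B Q t \<omega> = (\<integral>\<^sup>+a. regular_mass B (L a) t \<omega> \<partial>lborel)"
          and "\<omega> \<notin> N" "\<omega> \<in> space (P W x)"
        then have \<omega>: "\<omega> \<in> Paths W - N" using space_P[OF xp] by simp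
        have "path_mass B Q t \<omega> = (\<integral>\<^sup>+a. regular_mass B (L a) t \<omega> \<partial>lborel)"
          using * fm[rule_format, OF \<omega>] by blast
        then show "path_mass B Q t \<omega> = (\<integral>\<^sup>+a. J (a, \<omega>) \<partial>lborel)"
          unfolding JN[rule_format, OF \<omega>] .
      qed
    qed
    also have "\<dots> = (\<integral>\<^sup>+a. \<integral>\<^sup>+\<omega>. J (a, \<omega>) \<partial>P W x \<partial>lborel)"
      using J sets_P[OF xp] by (intro p2.Fubini) (simp cong: measurable_cong_sets sets_pair_measure_cong)
    finally show "(\<integral>\<^sup>+\<omega>. path_mass B Q t \<omega> \<partial>P W x) = (\<integral>\<^sup>+a. G a x \<partial>lborel)" by (simp add: G_def)
  qed
  also have "\<dots> = (\<integral>\<^sup>+a. \<integral>\<^sup>+x. G a x \<partial>completion \<xi> \<partial>lborel)"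
    using Gm by (intro Fubini') (simp add: split_beta' cong: measurable_cong_sets sets_pair_measure_cong)
  finally show "total_mass \<xi> B Q t = (\<integral>\<^sup>+a. total_mass \<xi> B (L a) t \<partial>lborel)" unfolding LG .
qed

text \<open>The additivity of \<open>C\<close> and the Markov property turn the excessivity of \<open>\<xi>\<close> into subadditivity in \<open>t\<close>.\<close>

lemma total_mass_double:
  assumes \<xi>: "excessive_reference_measure W \<xi>" and B: "B \<in> sets (state_alg W)" and t: "0 \<le> t"
    and C: "cont_additive_functional W C"
  shows "total_mass \<xi> B C (2 * t) \<le> 2 * total_mass \<xi> B C t"
proof -
  note sp = space_reference[OF \<xi>]
  obtain \<mu> where \<mu>: "\<mu> \<in> initial_laws W"
    and dom: "dominates \<mu> \<xi>"
    using reference_initial_law_ex[OF \<xi>] by blast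
  \<comment> \<open>A single functional is regarded as a family constant in the level, so that
    \<open>path_mass_modification\<close> applies.\<close>
  have Cm: "\<forall>r\<ge>0. (\<lambda>(a::real, \<omega>). C r \<omega>) \<in> borel_measurable (borel \<Otimes>\<^sub>M canonical_alg W r)"
  proof (intro allI impI)
    fix r :: real assume "0 \<le> r"
    then have "C r \<in> borel_measurable (canonical_alg W r)" using C by (simp add: cont_additive_functional_def)
    from measurable_compose[OF measurable_snd this] show "(\<lambda>(a::real, \<omega>). C r \<omega>) \<in> borel_measurable (borel \<Otimes>\<^sub>M canonical_alg W r)" by (simp add: split_beta')
  qed
  obtain J N where J: "J \<in> borel_measurable (borel \<Otimes>\<^sub>M nat_alg)" and N: "N \<in> null_sets (law_from W \<mu>)"
    and JN: "\<forall>a::real. \<forall>\<omega>\<in>Paths W - N. regular_mass B C t \<omega> = J (a, \<omega>)"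
    and fm: "\<forall>\<omega>\<in>Paths W - N. path_measurable B \<omega>"
    using path_mass_modification[OF \<mu> B t Cm] by (elim bexE conjE) (rule that)
  note off = reference_null_shift[OF \<xi> \<mu> dom N t]
  define J1 where "J1 \<omega> = J (0, \<omega>)" for \<omega>
  have J1m: "J1 \<in> borel_measurable nat_alg" unfolding J1_def[abs_def] using J by (rule measurable_Pair2) simp
  \<comment> \<open>Paths starting at the cemetery are excluded so that \<open>h\<close> vanishes
    there, as excessivity requires. Nothing is lost, because absorbed paths were given mass 0 after
    t.\<close>
  define J2 where "J2 \<omega> = J1 \<omega> * indicator (- {Cem W}) (X W 0 \<omega>)" for \<omega>
  have J2m: "J2 \<in> borel_measurable nat_alg"
  proof -
    have "(\<lambda>\<omega>. indicator (- {Cem W}) (X W 0 \<omega>) :: ennreal) \<in> borel_measurable nat_alg"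
      by (rule measurable_compose[OF X_nat borel_measurable_indicator]) auto
    then show ?thesis unfolding J2_def[abs_def] using J1m by (intro borel_measurable_times_ennreal)
  qed
  define h where "h y = (\<integral>\<^sup>+\<omega>. J2 \<omega> \<partial>P W y)" for y
  have Pm: "(\<lambda>y. \<integral>\<^sup>+\<omega>. F \<omega> \<partial>P W y) \<in> borel_measurable univ_points" if "F \<in> borel_measurable nat_alg" for F
    by (rule nn_integral_P_univ[where K="\<lambda>x. x"]) (use that in auto)
  have hm: "h \<in> borel_measurable univ_points" unfolding h_def by (rule Pm[OF J2m])
  have hC: "h (Cem W) = 0"
  proof -
    have "h (Cem W) = (\<integral>\<^sup>+\<omega>. 0 \<partial>P W (Cem W))"
      unfolding h_def by (intro nn_integral_cong_AE, use AE_P_Cem in eventually_elim) (simp add: J2_def)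
    then show ?thesis by simp
  qed
  have J2S: "(\<lambda>\<omega>. J2 (Shift W t \<omega>)) \<in> borel_measurable nat_alg"
    by (rule measurable_compose[OF Shift_nat[OF t] J2m])
  have one: "total_mass \<xi> B C t = (\<integral>\<^sup>+x. \<integral>\<^sup>+\<omega>. J1 \<omega> \<partial>P W x \<partial>\<xi>)"
    unfolding total_mass_def
  proof (rule nn_integral_cong_AE, use off AE_space in eventually_elim, rule nn_integral_cong_AE)
    fix x assume x: "AE \<omega> in P W x. \<omega> \<notin> N \<and> (X W t \<omega> \<noteq> Cem W \<longrightarrow> Shift W t \<omega> \<notin> N)" "x \<in> space \<xi>"
    then have xp: "x \<in> points W" using sp St_points by simp
    show "AE \<omega> in P W x. path_mass B C t \<omega> = J1 \<omega>"
      using path_mass_regularize[OF C xp, of B t] x(1) AE_space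
      by eventually_elim (use JN space_P[OF xp] in \<open>auto simp: J1_def\<close>)
  qed
  have "total_mass \<xi> B C (2 * t) \<le> (\<integral>\<^sup>+x. (\<integral>\<^sup>+\<omega>. J1 \<omega> \<partial>P W x) + (\<integral>\<^sup>+\<omega>. J2 (Shift W t \<omega>) \<partial>P W x) \<partial>\<xi>)"
    unfolding total_mass_def
  proof (rule nn_integral_mono_AE, use off AE_space in eventually_elim)
    fix x assume x: "AE \<omega> in P W x. \<omega> \<notin> N \<and> (X W t \<omega> \<noteq> Cem W \<longrightarrow> Shift W t \<omega> \<notin> N)" "x \<in> space \<xi>"
    then have xp: "x \<in> points W" using sp St_points by simp
    have "(\<integral>\<^sup>+\<omega>. path_mass B C (2 * t) \<omega> \<partial>P W x) \<le> (\<integral>\<^sup>+\<omega>. J1 \<omega> + J2 (Shift W t \<omega>) \<partial>P W x)"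
    proof (rule nn_integral_mono_AE)
      show "AE \<omega> in P W x. path_mass B C (2 * t) \<omega> \<le> J1 \<omega> + J2 (Shift W t \<omega>)"
        using path_mass_double[OF xp t C, of B] path_mass_regularize[OF C xp, of B t] x(1) AE_space
      proof eventually_elim
        fix \<omega>
        assume 1: "path_measurable B \<omega> \<longrightarrow>
            path_mass B C (2 * t) \<omega> \<le> path_mass B C t \<omega> + (if X W t \<omega> = Cem W then 0
              else regular_mass B C t (Shift W t \<omega>))"
          and 2: "path_mass B C t \<omega> = regular_mass B C t \<omega>"
          and 3: "\<omega> \<notin> N \<and> (X W t \<omega> \<noteq> Cem W \<longrightarrow> Shift W t \<omega> \<notin> N)" and "\<omega> \<in> space (P W x)"
        then have \<omega>: "\<omega> \<in> Paths W" "\<omega> \<in> Paths W - N" using space_P[OF xp] by auto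
        have "path_mass B C t \<omega> = J1 \<omega>" using 2 JN[rule_format, OF \<omega>(2), of 0] by (simp add: J1_def)
        moreover have "(if X W t \<omega> = Cem W then 0
              else regular_mass B C t (Shift W t \<omega>))
            \<le> J2 (Shift W t \<omega>)"
        proof (cases "X W t \<omega> = Cem W")
          case False
          then have "Shift W t \<omega> \<in> Paths W - N" using 3 Shift_in_Paths[OF t \<omega>(1)] by simp
          from JN[rule_format, OF this, of 0] show ?thesis
            using False X_Shift[OF order_refl t \<omega>(1)] by (simp add: J1_def J2_def)
        qed simp
        ultimately show "path_mass B C (2 * t) \<omega> \<le> J1 \<omega> + J2 (Shift W t \<omega>)"
          using 1[rule_format, OF fm[rule_format, OF \<omega>(2)]] by (simp only:) (erule order_trans, rule add_left_mono)
      qed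
    qed
    also have "\<dots> = (\<integral>\<^sup>+\<omega>. J1 \<omega> \<partial>P W x) + (\<integral>\<^sup>+\<omega>. J2 (Shift W t \<omega>) \<partial>P W x)"
      using J1m J2S sets_P[OF xp] by (intro nn_integral_add) (simp_all cong: measurable_cong_sets)
    finally show "(\<integral>\<^sup>+\<omega>. path_mass B C (2 * t) \<omega> \<partial>P W x) \<le> (\<integral>\<^sup>+\<omega>. J1 \<omega> \<partial>P W x) + (\<integral>\<^sup>+\<omega>. J2 (Shift W t \<omega>) \<partial>P W x)" .
  qed
  also have "\<dots> = (\<integral>\<^sup>+x. (\<integral>\<^sup>+\<omega>. J1 \<omega> \<partial>P W x) \<partial>completion \<xi>) + (\<integral>\<^sup>+x. (\<integral>\<^sup>+\<omega>. J2 (Shift W t \<omega>) \<partial>P W x) \<partial>completion \<xi>)"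
    unfolding nn_integral_completion[of \<xi>, symmetric]
    by (rule nn_integral_add[OF measurable_compose[OF id_completion_reference[OF \<xi>] Pm[OF J1m]]
      measurable_compose[OF id_completion_reference[OF \<xi>] Pm[OF J2S]]])
  also have "(\<integral>\<^sup>+x. (\<integral>\<^sup>+\<omega>. J1 \<omega> \<partial>P W x) \<partial>completion \<xi>) = total_mass \<xi> B C t"
    by (simp add: nn_integral_completion one)
  finally have le: "total_mass \<xi> B C (2 * t) \<le> total_mass \<xi> B C t + (\<integral>\<^sup>+x. (\<integral>\<^sup>+\<omega>. J2 (Shift W t \<omega>) \<partial>P W x) \<partial>completion \<xi>)" .
  \<comment> \<open>The Markov property at t writes the shifted mass as the expectation of
    \<open>h\<close> at the position at time t, and excessivity bounds its \<xi>-integral by that of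
    \<open>h\<close>.\<close>
  have le2: "(\<integral>\<^sup>+x. (\<integral>\<^sup>+\<omega>. J2 (Shift W t \<omega>) \<partial>P W x) \<partial>completion \<xi>) \<le> total_mass \<xi> B C t"
  proof -
    have "(\<integral>\<^sup>+x. (\<integral>\<^sup>+\<omega>. J2 (Shift W t \<omega>) \<partial>P W x) \<partial>completion \<xi>) = (\<integral>\<^sup>+x. \<integral>\<^sup>+\<omega>. h (X W t \<omega>) \<partial>P W x \<partial>\<xi>)"
      unfolding nn_integral_completion h_def using sp St_points t J2m
      by (intro nn_integral_cong[of \<xi>] markov_nn_integral) auto
    also have "\<dots> \<le> (\<integral>\<^sup>+x. h x \<partial>\<xi>)" by (rule excessive_integral_le[OF \<xi> hm hC t])
    also have "\<dots> \<le> total_mass \<xi> B C t"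
      unfolding one h_def by (intro nn_integral_mono) (auto simp: J2_def indicator_def)
    finally show ?thesis .
  qed
  show ?thesis unfolding mult_2[of "total_mass \<xi> B C t"] by (rule order_trans[OF le add_left_mono[OF le2]])
qed

section \<open>Associated measures as limits along powers of 1/2\<close>

lemma associated_measure_dyadic_limit:
  assumes am: "is_associated_measure W \<xi> C \<mu>" and B: "B \<in> sets \<mu>"
  shows "(\<lambda>n. ennreal (2 ^ n) * total_mass \<xi> B C ((1 / 2) ^ n)) \<longlonglongrightarrow> emeasure \<mu> B"
proof -
  have "(indicator B :: 'e \<Rightarrow> ennreal) \<in> borel_measurable (state_alg W)"
    using am B by (intro borel_measurable_indicator) (simp add: is_associated_measure_def)
  then have "((\<lambda>t. ennreal (1 / t) * total_mass \<xi> B C t) \<longlongrightarrow> (\<integral>\<^sup>+x. indicator B x \<partial>\<mu>)) (at_right 0)"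
    using am unfolding is_associated_measure_def total_mass_def path_mass_def by blast
  then have "((\<lambda>t. ennreal (1 / t) * total_mass \<xi> B C t) \<longlongrightarrow> emeasure \<mu> B) (at_right 0)"
    using B by simp
  moreover have "filterlim (\<lambda>n. (1 / 2 :: real) ^ n) (at_right 0) sequentially"
    by (intro tendsto_imp_filterlim_at_right LIMSEQ_realpow_zero) auto
  ultimately have "(\<lambda>n. ennreal (1 / (1 / 2) ^ n) * total_mass \<xi> B C ((1 / 2) ^ n)) \<longlonglongrightarrow> emeasure \<mu> B"
    by (rule filterlim_compose)
  then show ?thesis by (simp add: power_divide)
qed

text \<open>Convergence is contained in \<open>is_associated_measure\<close>; the doubling
  inequality adds that the limit is approached from below, which allows its exchange with the
  integral over levels.\<close>

lemma associated_measure_dyadic_SUP: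
  assumes \<xi>: "excessive_reference_measure W \<xi>" and C: "cont_additive_functional W C"
    and am: "is_associated_measure W \<xi> C \<mu>" and B: "B \<in> sets \<mu>"
  shows "incseq (\<lambda>n. ennreal (2 ^ n) * total_mass \<xi> B C ((1 / 2) ^ n))"
    and "emeasure \<mu> B = (SUP n. ennreal (2 ^ n) * total_mass \<xi> B C ((1 / 2) ^ n))"
proof -
  have Bs: "B \<in> sets (state_alg W)" using am B by (simp add: is_associated_measure_def)
  show inc: "incseq (\<lambda>n. ennreal (2 ^ n) * total_mass \<xi> B C ((1 / 2) ^ n))"
  proof (rule incseq_SucI)
    fix n
    have "total_mass \<xi> B C ((1 / 2) ^ n) \<le> 2 * total_mass \<xi> B C ((1 / 2) ^ Suc n)"
      using total_mass_double[OF \<xi> Bs _ C, of "(1 / 2) ^ Suc n"] by simp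
    then have "ennreal (2 ^ n) * total_mass \<xi> B C ((1 / 2) ^ n) \<le> ennreal (2 ^ n) * (2 * total_mass \<xi> B C ((1 / 2) ^ Suc n))"
      by (rule mult_left_mono) simp
    also have "ennreal (2 ^ n) * (2 * total_mass \<xi> B C ((1 / 2) ^ Suc n)) = ennreal (2 ^ Suc n) * total_mass \<xi> B C ((1 / 2) ^ Suc n)"
    proof -
      have "ennreal (2 ^ Suc n) = ennreal (2 ^ n) * 2"
        by (simp add: ennreal_mult' mult.commute)
      then show ?thesis by (simp only: mult.assoc)
    qed
    finally show "ennreal (2 ^ n) * total_mass \<xi> B C ((1 / 2) ^ n) \<le> ennreal (2 ^ Suc n) * total_mass \<xi> B C ((1 / 2) ^ Suc n)" .
  qed
  show "emeasure \<mu> B = (SUP n. ennreal (2 ^ n) * total_mass \<xi> B C ((1 / 2) ^ n))"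
    using LIMSEQ_unique[OF associated_measure_dyadic_limit[OF am B] LIMSEQ_SUP[OF inc]] .
qed

lemma associated_measure_disintegration:
  fixes L :: "real \<Rightarrow> real \<Rightarrow> 'w \<Rightarrow> real"
  assumes \<xi>: "excessive_reference_measure W \<xi>"
    and Q: "cont_additive_functional W Q" and L: "\<And>a. cont_additive_functional W (L a)"
    and Lm: "\<forall>r\<ge>0. (\<lambda>(a, \<omega>). L a r \<omega>) \<in> borel_measurable (borel \<Otimes>\<^sub>M canonical_alg W r)"
    and occ: "\<forall>x\<in>St W. \<forall>r\<ge>0. AE \<omega> in P W x. (\<integral>\<^sup>+s\<in>{0..r}. 1 \<partial>stieltjes (\<lambda>r. Q r \<omega>)) = (\<integral>\<^sup>+a. ennreal (L a r \<omega>) \<partial>lborel)"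
    and \<nu>: "is_associated_measure W \<xi> Q \<nu>" and \<mu>: "\<And>a. is_associated_measure W \<xi> (L a) (\<mu> a)"
    and B: "B \<in> sets (state_alg W)"
  shows "(\<lambda>a. emeasure (\<mu> a) B) \<in> borel_measurable borel"
    and "emeasure \<nu> B = (\<integral>\<^sup>+a. emeasure (\<mu> a) B \<partial>lborel)"
proof -
  let ?m = "\<lambda>C n. ennreal (2 ^ n) * total_mass \<xi> B C ((1 / 2) ^ n)"
  have B\<nu>: "B \<in> sets \<nu>" and B\<mu>: "B \<in> sets (\<mu> a)" for a
    using \<nu> \<mu>[of a] B by (auto simp: is_associated_measure_def)
  \<comment> \<open>Rationality of these times is what \<open>total_mass_occupation\<close> asks
    for.\<close>
  have t: "0 \<le> (1 / 2 :: real) ^ n" "(1 / 2 :: real) ^ n \<in> \<rat>" for n by auto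
  note occ' = total_mass_occupation[OF \<xi> B t Q L Lm occ]
  have m: "(\<lambda>a. ?m (L a) n) \<in> borel_measurable lborel" for n using occ'(1)[of n] by simp
  have SUPa: "emeasure (\<mu> a) B = (SUP n. ?m (L a) n)" for a
    by (rule associated_measure_dyadic_SUP(2)[OF \<xi> L \<mu> B\<mu>])
  show "(\<lambda>a. emeasure (\<mu> a) B) \<in> borel_measurable borel"
    unfolding SUPa using m by (intro borel_measurable_SUP) auto
  have "emeasure \<nu> B = (SUP n. ?m Q n)" by (rule associated_measure_dyadic_SUP(2)[OF \<xi> Q \<nu> B\<nu>])
  also have "\<dots> = (SUP n. \<integral>\<^sup>+a. ?m (L a) n \<partial>lborel)"
    using occ'(1) by (intro SUP_cong refl) (subst occ'(2), simp add: nn_integral_cmult)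
  also have "\<dots> = (\<integral>\<^sup>+a. (SUP n. ?m (L a) n) \<partial>lborel)"
    using associated_measure_dyadic_SUP(1)[OF \<xi> L \<mu> B\<mu>] m
    by (intro nn_integral_monotone_convergence_SUP[symmetric]) (auto simp: incseq_def le_fun_def)
  finally show "emeasure \<nu> B = (\<integral>\<^sup>+a. emeasure (\<mu> a) B \<partial>lborel)" unfolding SUPa .
qed

text \<open>The expected mass of U vanishes for every starting point in E and every t, so the limit
  defining the associated measure is a limit of zeros.\<close>

lemma associated_measure_carried:
  assumes \<mu>: "is_associated_measure W \<xi> C \<mu>" and sp: "space \<xi> = St W" and U: "U \<in> sets (state_alg W)"
    and null: "\<And>x. x \<in> St W \<Longrightarrow> AE \<omega> in P W x. AE s in stieltjes (\<lambda>r. C r \<omega>). 0 \<le> s \<longrightarrow> X W s \<omega> \<in> St W \<longrightarrow> X W s \<omega> \<notin> U"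
  shows "emeasure \<mu> U = 0"
proof -
  have "total_mass \<xi> U C t = 0" for t
  proof -
    have "total_mass \<xi> U C t = (\<integral>\<^sup>+x. 0 \<partial>\<xi>)"
      unfolding total_mass_def
    proof (rule nn_integral_cong)
      fix x assume "x \<in> space \<xi>"
      then have x: "x \<in> St W" using sp by simp
      have "(\<integral>\<^sup>+\<omega>. path_mass U C t \<omega> \<partial>P W x) = (\<integral>\<^sup>+\<omega>. 0 \<partial>P W x)"
      proof (rule nn_integral_cong_AE, use null[OF x] in eventually_elim)
        fix \<omega> assume *: "AE s in stieltjes (\<lambda>r. C r \<omega>). 0 \<le> s \<longrightarrow> X W s \<omega> \<in> St W \<longrightarrow> X W s \<omega> \<notin> U"
        have "path_mass U C t \<omega> = (\<integral>\<^sup>+s. 0 \<partial>stieltjes (\<lambda>r. C r \<omega>))"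
          unfolding path_mass_def
          by (rule nn_integral_cong_AE, use * in eventually_elim) (auto simp: ext0_def indicator_def)
        then show "path_mass U C t \<omega> = 0" by simp
      qed
      then show "(\<integral>\<^sup>+\<omega>. path_mass U C t \<omega> \<partial>P W x) = 0" by simp
    qed
    then show ?thesis by simp
  qed
  moreover have "U \<in> sets \<mu>" using \<mu> U by (simp add: is_associated_measure_def)
  ultimately have "(\<lambda>n. 0) \<longlonglongrightarrow> emeasure \<mu> U"
    using associated_measure_dyadic_limit[OF \<mu>, of U] by simp
  then show ?thesis by (simp add: LIMSEQ_const_iff)
qed

end

theorem mainTheorem5:
  fixes W :: "('e::polish_space, 'w) process"
    and u :: "'e \<Rightarrow> real"
    and A M Q :: "real \<Rightarrow> 'w \<Rightarrow> real"
    and L :: "real \<Rightarrow> real \<Rightarrow> 'w \<Rightarrow> real"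
    and \<xi> \<nu> :: "'e measure"
    and \<mu> :: "real \<Rightarrow> 'e measure"
  assumes "right_process W"
    and "\<And>x. x \<in> St W \<Longrightarrow> 0 \<le> u x"
    and "excessive W 0 (\<lambda>x. ennreal (u x))"
    and "cont_additive_functional W A"
    and "\<And>x. x \<in> St W \<Longrightarrow> ennreal (u x) = (\<integral>\<^sup>+\<omega>. terminal_value A \<omega> \<partial>P W x)"
    and "is_martingale_part W A M"
    and "\<And>x. x \<in> St W \<Longrightarrow>
           AE \<omega> in P W x. \<forall>t\<ge>0. ext0 W u (X W t \<omega>) = ext0 W u (X W 0 \<omega>) + M t \<omega> - A t \<omega>"
    and "\<And>x. x \<in> St W \<Longrightarrow> AE \<omega> in P W x. continuous_on {0..} (\<lambda>t. M t \<omega>)"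
    and "excessive_reference_measure W \<xi>"
    and "is_bracket_functional W M Q"
    and "is_local_time W u A M Q L"
    and "is_associated_measure W \<xi> Q \<nu>"
    and "\<And>a. is_associated_measure W \<xi> (L a) (\<mu> a)"
  shows "(\<forall>a. AE x in \<mu> a. u x = a)
    \<and> (\<forall>B\<in>sets \<nu>. (\<lambda>a. emeasure (\<mu> a) B) \<in> borel_measurable borel
          \<and> emeasure \<nu> B = (\<integral>\<^sup>+a. emeasure (\<mu> a) B \<partial>lborel))
    \<and> (\<forall>f :: real \<Rightarrow> ennreal. f \<in> borel_measurable borel \<longrightarrow>
          (\<integral>\<^sup>+x. f (u x) \<partial>\<nu>) = (\<integral>\<^sup>+a. (\<integral>\<^sup>+x. f (u x) \<partial>\<mu> a) \<partial>lborel))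
    \<and> (\<forall>B\<in>sets \<nu>. emeasure \<nu> B < \<infinity> \<longrightarrow>
          absolutely_continuous lborel (distr (restrict_space \<nu> B) borel u))"
proof -
  interpret right_process W by fact
  note \<xi> = assms(9)
  have \<nu>s: "sets \<nu> = sets (state_alg W)" and \<mu>s: "sets (\<mu> a) = sets (state_alg W)" for a
    using assms(12) assms(13)[of a] by (simp_all add: is_associated_measure_def)
  have \<nu>sp: "space \<nu> = St W" and \<mu>sp: "space (\<mu> a) = St W" for a
    using sets_eq_imp_space_eq[OF \<nu>s] sets_eq_imp_space_eq[OF \<mu>s] by simp_all
  \<comment> \<open>Excessivity provides measurability of \<open>ennreal (u x)\<close>;
    nonnegativity on E allows the return to real values.\<close>
  have um: "u \<in> borel_measurable (state_alg W)"
  proof -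
    have "(\<lambda>x. enn2real (ennreal (u x))) \<in> borel_measurable (state_alg W)"
      using excessive_state_measurable[OF order_refl assms(3)] by (rule measurable_compose) simp
    then show ?thesis by (rule iffD1[OF measurable_cong, rotated]) (simp add: assms(2))
  qed
  have L: "\<And>a. cont_additive_functional W (L a)"
    and Lm: "\<forall>r\<ge>0. (\<lambda>(a, \<omega>). L a r \<omega>) \<in> borel_measurable (borel \<Otimes>\<^sub>M canonical_alg W r)"
    and occ0: "\<And>g x t. g \<in> borel_measurable borel \<Longrightarrow> x \<in> St W \<Longrightarrow> 0 \<le> t \<Longrightarrow> AE \<omega> in P W x.
          (\<integral>\<^sup>+s\<in>{0..t}. g (ext0 W u (X W s \<omega>)) \<partial>stieltjes (\<lambda>r. Q r \<omega>)) =
          (\<integral>\<^sup>+a. g a * ennreal (L a t \<omega>) \<partial>lborel)"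
    using assms(11) unfolding is_local_time_def Let_def by blast+
  have occ: "\<forall>x\<in>St W. \<forall>r\<ge>0. AE \<omega> in P W x. (\<integral>\<^sup>+s\<in>{0..r}. 1 \<partial>stieltjes (\<lambda>r. Q r \<omega>)) = (\<integral>\<^sup>+a. ennreal (L a r \<omega>) \<partial>lborel)"
    using occ0[of "\<lambda>_. 1"] by simp
  have Q: "cont_additive_functional W Q" using assms(10) by (simp add: is_bracket_functional_def)
  note dis = associated_measure_disintegration[OF \<xi> Q L Lm occ assms(12,13)]
  have level: "AE x in \<mu> a. u x = a" for a
  proof -
    define U where "U = {x\<in>space (state_alg W). u x \<noteq> a}"
    have U: "U \<in> sets (state_alg W)" unfolding U_def using um by measurable
    have "emeasure (\<mu> a) U = 0"
    proof (rule associated_measure_carried[OF assms(13) space_reference[OF \<xi>] U])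
      fix x assume x: "x \<in> St W"
      have fin: "(\<integral>\<^sup>+\<omega>. terminal_value A \<omega> \<partial>P W x) < \<infinity>" using assms(5)[OF x] by (metis ennreal_less_top infinity_ennreal_def)
      show "AE \<omega> in P W x. AE s in stieltjes (\<lambda>r. L a r \<omega>). 0 \<le> s \<longrightarrow> X W s \<omega> \<in> St W \<longrightarrow> X W s \<omega> \<notin> U"
        using local_time_carried_by_level[OF assms(4) fin assms(6) x assms(7)[OF x] assms(8)[OF x] assms(11), of a]
      proof eventually_elim
        fix \<omega> assume "AE s in stieltjes (\<lambda>r. L a r \<omega>). 0 \<le> s \<longrightarrow> ext0 W u (X W s \<omega>) = a"
        then show "AE s in stieltjes (\<lambda>r. L a r \<omega>). 0 \<le> s \<longrightarrow> X W s \<omega> \<in> St W \<longrightarrow> X W s \<omega> \<notin> U"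
          by eventually_elim (auto simp: ext0_def U_def)
      qed
    qed
    then show ?thesis
      using U \<mu>sp[of a] by (intro AE_I[of _ _ U]) (auto simp: U_def \<mu>s)
  qed
  \<comment> \<open>Measurability in the level is carried through the induction because monotone
    convergence over levels needs it.\<close>
  have dis_int: "(\<integral>\<^sup>+x. g x \<partial>\<nu>) = (\<integral>\<^sup>+a. (\<integral>\<^sup>+x. g x \<partial>\<mu> a) \<partial>lborel) \<and> (\<lambda>a. \<integral>\<^sup>+x. g x \<partial>\<mu> a) \<in> borel_measurable borel"
    if "g \<in> borel_measurable (state_alg W)" for g :: "'e \<Rightarrow> ennreal"
    using that
  proof (induct rule: borel_measurable_induct)
    case (cong f g)
    have "(\<integral>\<^sup>+x. f x \<partial>\<nu>) = (\<integral>\<^sup>+x. g x \<partial>\<nu>)" "(\<integral>\<^sup>+x. f x \<partial>\<mu> a) = (\<integral>\<^sup>+x. g x \<partial>\<mu> a)" for a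
      using cong(3) \<nu>sp \<mu>sp by (auto intro!: nn_integral_cong)
    with cong(4) show ?case by simp
  next
    case (set B)
    then show ?case using dis[OF set] by (simp add: \<nu>s \<mu>s)
  next
    case (mult h c)
    have [measurable]: "h \<in> borel_measurable \<nu>" "h \<in> borel_measurable (\<mu> a)" for a
      using mult(2) \<nu>s \<mu>s by (simp_all cong: measurable_cong_sets)
    show ?case using mult(4) by (auto simp: nn_integral_cmult intro!: borel_measurable_times_ennreal)
  next
    case (add h k)
    have [measurable]: "h \<in> borel_measurable \<nu>" "h \<in> borel_measurable (\<mu> a)" "k \<in> borel_measurable \<nu>" "k \<in> borel_measurable (\<mu> a)" for a
      using add(1,4) \<nu>s \<mu>s by (simp_all cong: measurable_cong_sets)
    show ?case using add(3,7) by (auto simp: nn_integral_add intro!: borel_measurable_add)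
  next
    case (seq V)
    have [measurable]: "V i \<in> borel_measurable \<nu>" "V i \<in> borel_measurable (\<mu> a)" for i a
      using seq(1) \<nu>s \<mu>s by (simp_all cong: measurable_cong_sets)
    have sup: "(SUP i. V i) x = (SUP i. V i x)" for x by (simp add: image_comp)
    have int\<mu>: "(\<integral>\<^sup>+x. (SUP i. V i) x \<partial>\<mu> a) = (SUP i. \<integral>\<^sup>+x. V i x \<partial>\<mu> a)" for a
      unfolding sup by (rule nn_integral_monotone_convergence_SUP[OF seq(4)]) simp
    have inc: "incseq (\<lambda>i a. \<integral>\<^sup>+x. V i x \<partial>\<mu> a)"
      using seq(4) by (auto simp: incseq_def le_fun_def intro!: nn_integral_mono)
    have "(\<integral>\<^sup>+x. (SUP i. V i) x \<partial>\<nu>) = (SUP i. \<integral>\<^sup>+x. V i x \<partial>\<nu>)"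
      unfolding sup by (rule nn_integral_monotone_convergence_SUP[OF seq(4)]) simp
    also have "\<dots> = (SUP i. \<integral>\<^sup>+a. (\<integral>\<^sup>+x. V i x \<partial>\<mu> a) \<partial>lborel)" using seq(3) by simp
    also have "\<dots> = (\<integral>\<^sup>+a. (SUP i. \<integral>\<^sup>+x. V i x \<partial>\<mu> a) \<partial>lborel)"
      by (rule nn_integral_monotone_convergence_SUP[symmetric, OF inc]) (use seq(3) in simp)
    finally show ?case
      unfolding int\<mu> using seq(3) by (auto intro!: borel_measurable_SUP)
  qed
  have "absolutely_continuous lborel (distr (restrict_space \<nu> B) borel u)" if B: "B \<in> sets \<nu>" for B
    unfolding absolutely_continuous_def
  proof
    fix Z :: "real set" assume Z: "Z \<in> null_sets lborel"
    then have Zb: "Z \<in> sets borel" by auto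
    have u\<nu>: "u \<in> borel_measurable \<nu>" using um \<nu>s by (simp cong: measurable_cong_sets)
    have uR: "u \<in> borel_measurable (restrict_space \<nu> B)" using u\<nu> by (rule measurable_restrict_space1)
    have BZ: "B \<inter> (u -` Z \<inter> space \<nu>) \<in> sets \<nu>" using B measurable_sets[OF u\<nu> Zb] by auto
    have "emeasure (distr (restrict_space \<nu> B) borel u) Z = emeasure (restrict_space \<nu> B) (u -` Z \<inter> space (restrict_space \<nu> B))"
      by (rule emeasure_distr[OF uR Zb])
    also have "\<dots> = emeasure \<nu> (B \<inter> (u -` Z \<inter> space \<nu>))"
      using B sets.sets_into_space[OF B]
      by (subst emeasure_restrict_space) (auto simp: space_restrict_space intro!: arg_cong[where f="emeasure \<nu>"])
    also have "\<dots> = (\<integral>\<^sup>+a. emeasure (\<mu> a) (B \<inter> (u -` Z \<inter> space \<nu>)) \<partial>lborel)"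
      using dis(2) BZ \<nu>s by simp
    also have "\<dots> = (\<integral>\<^sup>+(a::real). 0 \<partial>lborel)"
    proof (rule nn_integral_cong_AE)
      \<comment> \<open>For a outside Z the measure \<open>\<mu> a\<close> lives on the level set of
        a, which does not meet the preimage of Z; the remaining levels form a Lebesgue null
        set.\<close>
      show "AE a in lborel. emeasure (\<mu> a) (B \<inter> (u -` Z \<inter> space \<nu>)) = 0"
        using AE_not_in[OF Z]
      proof eventually_elim
        fix a assume a: "a \<notin> Z"
        have BZ\<mu>: "B \<inter> (u -` Z \<inter> space \<nu>) \<in> sets (\<mu> a)" using BZ \<nu>s \<mu>s by simp
        have "AE x in \<mu> a. x \<notin> B \<inter> (u -` Z \<inter> space \<nu>)"
          using level[of a] by eventually_elim (use a in auto)
        then show "emeasure (\<mu> a) (B \<inter> (u -` Z \<inter> space \<nu>)) = 0"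
          using AE_iff_null_sets[OF BZ\<mu>] by (simp add: null_sets_def)
      qed
    qed
    finally show "Z \<in> null_sets (distr (restrict_space \<nu> B) borel u)" using Zb by (simp add: null_sets_def)
  qed
  moreover have "(\<integral>\<^sup>+x. f (u x) \<partial>\<nu>) = (\<integral>\<^sup>+a. (\<integral>\<^sup>+x. f (u x) \<partial>\<mu> a) \<partial>lborel)"
    if "f \<in> borel_measurable borel" for f :: "real \<Rightarrow> ennreal"
    using dis_int[OF measurable_compose[OF um that]] by simp
  ultimately show ?thesis using level dis unfolding \<nu>s by (intro conjI allI ballI impI)
qed

end
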